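(* For every $k\ge1$, the polynomial ring $\mathbb Z[x_1,\ldots,x_k]$ is regularly bi-interpretable with the ring $\mathbb Z$.
   Context: A regular interpretation $(\Gamma,\phi)$ of $\mathbb A$ in $\mathbb B$ is a code of $L(\mathbb B)$-formulas with parameters $\bar y$ defining a subset of $B^n$, an equivalence relation on it and the operations of $\mathbb A$ on the quotient, together with a formula $\phi(\bar y)$ with $\phi(\mathbb B)\ne\emptyset$, such that the resulting structure $\Gamma(\mathbb B,\bar p)\cong\mathbb A$ for every $\bar p\in\phi(\mathbb B)$; a coordinate map is a surjection from the defined subset onto $A$ inducing such an isomorphism. $\mathbb A$ and $\mathbb B$ are regularly bi-interpretable if there are regular interpretations $(\Gamma,\phi)$ of $\mathbb A$ in $\mathbb B$ and $(\Delta,\psi)$ of $\mathbb B$ in $\mathbb A$ and formulas $\theta_{\mathbb A},\theta_{\mathbb B}$ such that for every admissible parameter tuple $\bar r_0$ of the composite interpretation $\Gamma\circ\Delta$ of $\mathbb A$ in $\mathbb A$, $\theta_{\mathbb A}(\bar u,x,\bar r_0)$ defines a coordinate map $\Gamma\circ\Delta(\mathbb A,\bar r_0)\to\mathbb A$, and symmetrically for $\Delta\circ\Gamma$ and $\theta_{\mathbb B}$. *)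

theory Defs
  imports "HOL-Library.Poly_Mapping"
begin

section \<open>First-order logic over languages of operations\<close>

class language =
  fixes arity :: "'a \<Rightarrow> nat"

record ('f, 'a) struct =
  univ :: "'a set"
  interp :: "'f \<Rightarrow> 'a list \<Rightarrow> 'a"

datatype 'f tm = Var nat | Fun 'f "'f tm list"

text \<open>Variables are de Bruijn indices: \<open>Ex\<close> binds index 0 and shifts the free ones by one.\<close>

datatype 'f fm = Truth | Eq "'f tm" "'f tm" | Neg "'f fm" | And "'f fm" "'f fm" | Ex "'f fm"

primrec eval_tm :: "('f, 'a) struct \<Rightarrow> (nat \<Rightarrow> 'a) \<Rightarrow> 'f tm \<Rightarrow> 'a" where
  "eval_tm M e (Var i) = e i"
| "eval_tm M e (Fun f ts) = interp M f (map (eval_tm M e) ts)"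

primrec sat :: "('f, 'a) struct \<Rightarrow> (nat \<Rightarrow> 'a) \<Rightarrow> 'f fm \<Rightarrow> bool" where
  "sat M e Truth \<longleftrightarrow> True"
| "sat M e (Eq s t) \<longleftrightarrow> eval_tm M e s = eval_tm M e t"
| "sat M e (Neg \<phi>) \<longleftrightarrow> \<not> sat M e \<phi>"
| "sat M e (And \<phi> \<chi>) \<longleftrightarrow> sat M e \<phi> \<and> sat M e \<chi>"
| "sat M e (Ex \<phi>) \<longleftrightarrow> (\<exists>a\<in>univ M. sat M (case_nat a e) \<phi>)"

text \<open>\<open>fm_in n \<phi>\<close>: \<open>\<phi>\<close> respects arities and its free variables are among \<open>0, \<dots>, n - 1\<close>.\<close>

primrec tm_in :: "nat \<Rightarrow> 'f::language tm \<Rightarrow> bool" where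
  "tm_in n (Var i) \<longleftrightarrow> i < n"
| "tm_in n (Fun f ts) \<longleftrightarrow> length ts = arity f \<and> list_all (tm_in n) ts"

primrec fm_in :: "nat \<Rightarrow> 'f::language fm \<Rightarrow> bool" where
  "fm_in n Truth \<longleftrightarrow> True"
| "fm_in n (Eq s t) \<longleftrightarrow> tm_in n s \<and> tm_in n t"
| "fm_in n (Neg \<phi>) \<longleftrightarrow> fm_in n \<phi>"
| "fm_in n (And \<phi> \<chi>) \<longleftrightarrow> fm_in n \<phi> \<and> fm_in n \<chi>"
| "fm_in n (Ex \<phi>) \<longleftrightarrow> fm_in (Suc n) \<phi>"

definition tuples :: "('f, 'a) struct \<Rightarrow> nat \<Rightarrow> 'a list set" where
  "tuples M n = {xs. length xs = n \<and> set xs \<subseteq> univ M}"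

text \<open>Truth at a tuple; only used for tuples at least as long as the free variables require.\<close>

definition holds :: "('f, 'a) struct \<Rightarrow> 'f fm \<Rightarrow> 'a list \<Rightarrow> bool" where
  "holds M \<phi> xs \<longleftrightarrow> sat M (\<lambda>i. xs ! i) \<phi>"

definition solutions :: "('f, 'a) struct \<Rightarrow> nat \<Rightarrow> 'f fm \<Rightarrow> 'a list set" where
  "solutions M n \<phi> = {xs \<in> tuples M n. holds M \<phi> xs}"

definition is_iso :: "('a \<Rightarrow> 'b) \<Rightarrow> ('f::language, 'a) struct \<Rightarrow> ('f, 'b) struct \<Rightarrow> bool" where
  "is_iso h M N \<longleftrightarrow> bij_betw h (univ M) (univ N) \<and>
     (\<forall>f. \<forall>xs \<in> tuples M (arity f). h (interp M f xs) = interp N f (map h xs))"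

definition isomorphic :: "('f::language, 'a) struct \<Rightarrow> ('f, 'b) struct \<Rightarrow> bool" where
  "isomorphic M N \<longleftrightarrow> (\<exists>h. is_iso h M N)"


section \<open>Interpretations\<close>

text \<open>
  A code interprets \<open>'f\<close>-structures in \<open>'g\<close>-structures. In all formulas of a code
  the variables \<open>0, \<dots>, cpar - 1\<close> stand for the parameters; they are followed by
  consecutive blocks of \<open>cdim\<close> variables, one for each represented element. The formula
  \<open>cop f\<close> defines the graph of \<open>f\<close>, the last block being the value.
\<close>

record ('f, 'g) code =
  cdim :: nat
  cpar :: nat
  cdom :: "'g fm"
  ceqv :: "'g fm"
  cop :: "'f \<Rightarrow> 'g fm"

definition wf_code :: "('f::language, 'g::language) code \<Rightarrow> bool" where
  "wf_code \<Gamma> \<longleftrightarrow> cdim \<Gamma> > 0 \<and>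
     fm_in (cpar \<Gamma> + cdim \<Gamma>) (cdom \<Gamma>) \<and>
     fm_in (cpar \<Gamma> + cdim \<Gamma> * 2) (ceqv \<Gamma>) \<and>
     (\<forall>f. fm_in (cpar \<Gamma> + cdim \<Gamma> * Suc (arity f)) (cop \<Gamma> f))"

definition code_dom :: "('f, 'g) code \<Rightarrow> ('g, 'b) struct \<Rightarrow> 'b list \<Rightarrow> 'b list set" where
  "code_dom \<Gamma> B p = {x \<in> tuples B (cdim \<Gamma>). holds B (cdom \<Gamma>) (p @ x)}"

definition code_eqv :: "('f, 'g) code \<Rightarrow> ('g, 'b) struct \<Rightarrow> 'b list \<Rightarrow> ('b list \<times> 'b list) set" where
  "code_eqv \<Gamma> B p =
     {(x, y). x \<in> code_dom \<Gamma> B p \<and> y \<in> code_dom \<Gamma> B p \<and> holds B (ceqv \<Gamma>) (p @ x @ y)}"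

definition code_graph :: "('f, 'g) code \<Rightarrow> ('g, 'b) struct \<Rightarrow> 'b list \<Rightarrow> 'f \<Rightarrow> 'b list list \<Rightarrow> 'b list \<Rightarrow> bool" where
  "code_graph \<Gamma> B p f xs y \<longleftrightarrow> holds B (cop \<Gamma> f) (p @ concat xs @ y)"

text \<open>The code, at parameters \<open>p\<close>, defines operations on the quotient of a nonempty set.\<close>

definition well_defined :: "('f::language, 'g) code \<Rightarrow> ('g, 'b) struct \<Rightarrow> 'b list \<Rightarrow> bool" where
  "well_defined \<Gamma> B p \<longleftrightarrow>
     (let D = code_dom \<Gamma> B p; E = code_eqv \<Gamma> B p; G = code_graph \<Gamma> B p in
      D \<noteq> {} \<and> equiv D E \<and>
      (\<forall>f. \<forall>xs \<in> lists D. length xs = arity f \<longrightarrow>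
         (\<exists>y\<in>D. G f xs y) \<and>
         (\<forall>y\<in>D. \<forall>y'\<in>D. G f xs y \<and> G f xs y' \<longrightarrow> (y, y') \<in> E) \<and>
         (\<forall>xs' y y'. list_all2 (\<lambda>x x'. (x, x') \<in> E) xs xs' \<and> (y, y') \<in> E \<and> G f xs y
            \<longrightarrow> G f xs' y')))"

definition interp_struct :: "('f, 'g) code \<Rightarrow> ('g, 'b) struct \<Rightarrow> 'b list \<Rightarrow> ('f, 'b list set) struct" where
  "interp_struct \<Gamma> B p =
     \<lparr> univ = code_dom \<Gamma> B p // code_eqv \<Gamma> B p,
       interp = (\<lambda>f Xs. {y \<in> code_dom \<Gamma> B p.
         \<exists>xs. list_all2 (\<in>) xs Xs \<and> code_graph \<Gamma> B p f xs y}) \<rparr>"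

definition coordinate_map ::
  "('f::language, 'g) code \<Rightarrow> ('g, 'b) struct \<Rightarrow> 'b list \<Rightarrow> ('f, 'a) struct \<Rightarrow> ('b list \<Rightarrow> 'a) \<Rightarrow> bool" where
  "coordinate_map \<Gamma> B p A \<mu> \<longleftrightarrow> well_defined \<Gamma> B p \<and>
     \<mu> ` code_dom \<Gamma> B p = univ A \<and>
     (\<exists>h. is_iso h (interp_struct \<Gamma> B p) A \<and>
          (\<forall>x \<in> code_dom \<Gamma> B p. \<mu> x = h (code_eqv \<Gamma> B p `` {x})))"

definition regular_interpretation ::
  "('f::language, 'g::language) code \<Rightarrow> 'g fm \<Rightarrow> ('f, 'a) struct \<Rightarrow> ('g, 'b) struct \<Rightarrow> bool" where
  "regular_interpretation \<Gamma> \<phi> A B \<longleftrightarrow>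
     wf_code \<Gamma> \<and> fm_in (cpar \<Gamma>) \<phi> \<and> solutions B (cpar \<Gamma>) \<phi> \<noteq> {} \<and>
     (\<forall>p \<in> solutions B (cpar \<Gamma>) \<phi>. well_defined \<Gamma> B p \<and> isomorphic (interp_struct \<Gamma> B p) A)"


section \<open>Composition of interpretations\<close>

primrec rename_tm :: "(nat \<Rightarrow> nat) \<Rightarrow> 'f tm \<Rightarrow> 'f tm" where
  "rename_tm \<rho> (Var i) = Var (\<rho> i)"
| "rename_tm \<rho> (Fun f ts) = Fun f (map (rename_tm \<rho>) ts)"

primrec rename :: "(nat \<Rightarrow> nat) \<Rightarrow> 'f fm \<Rightarrow> 'f fm" where
  "rename \<rho> Truth = Truth"
| "rename \<rho> (Eq s t) = Eq (rename_tm \<rho> s) (rename_tm \<rho> t)"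
| "rename \<rho> (Neg \<phi>) = Neg (rename \<rho> \<phi>)"
| "rename \<rho> (And \<phi> \<chi>) = And (rename \<rho> \<phi>) (rename \<rho> \<chi>)"
| "rename \<rho> (Ex \<phi>) = Ex (rename (case_nat 0 (\<lambda>i. Suc (\<rho> i))) \<phi>)"

primrec conj_list :: "'f fm list \<Rightarrow> 'f fm" where
  "conj_list [] = Truth"
| "conj_list (\<phi> # \<phi>s) = And \<phi> (conj_list \<phi>s)"

text \<open>
  Translation of \<open>'f\<close>-formulas along a code \<open>\<Delta>\<close> to \<open>'g\<close>-formulas. Variable \<open>i\<close>
  of the source formula becomes the \<open>i\<close>-th block, that is, the variables
  \<open>cpar \<Delta> + cdim \<Delta> * i + j\<close> for \<open>j < cdim \<Delta>\<close>, the first \<open>cpar \<Delta>\<close> variables being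
  the parameters of \<open>\<Delta>\<close>. The function \<open>on_blocks \<Delta> g\<close> moves block \<open>i\<close> to block \<open>g i\<close>,
  and \<open>ex_block \<Delta>\<close> binds block 0, shifting the other blocks but keeping the parameters.
\<close>

definition on_blocks :: "('f, 'g) code \<Rightarrow> (nat \<Rightarrow> nat) \<Rightarrow> 'g fm \<Rightarrow> 'g fm" where
  "on_blocks \<Delta> g = rename (\<lambda>v. if v < cpar \<Delta> then v else
     cpar \<Delta> + cdim \<Delta> * g ((v - cpar \<Delta>) div cdim \<Delta>) + (v - cpar \<Delta>) mod cdim \<Delta>)"

definition dom_block :: "('f, 'g) code \<Rightarrow> nat \<Rightarrow> 'g fm" where
  "dom_block \<Delta> i = on_blocks \<Delta> (\<lambda>_. i) (cdom \<Delta>)"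

definition ex_block :: "('f, 'g) code \<Rightarrow> 'g fm \<Rightarrow> 'g fm" where
  "ex_block \<Delta> \<phi> = (Ex ^^ cdim \<Delta>) (rename (\<lambda>v. if v < cpar \<Delta> then v + cdim \<Delta>
     else if v < cpar \<Delta> + cdim \<Delta> then v - cpar \<Delta> else v) (And (dom_block \<Delta> 0) \<phi>))"

text \<open>
  \<open>tr_tm \<Delta> t\<close> says that block 0 represents the value of \<open>t\<close>, with variable \<open>i\<close> of \<open>t\<close>
  moved to block \<open>i + 1\<close>. For \<open>Fun f ts\<close> the values of the \<open>k\<close> arguments are existentially
  quantified as blocks \<open>0, \<dots>, k - 1\<close>, which moves the value of the whole term to block \<open>k\<close>.
\<close>

primrec tr_tm :: "('f, 'g) code \<Rightarrow> 'f tm \<Rightarrow> 'g fm" where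
  "tr_tm \<Delta> (Var i) = on_blocks \<Delta> (\<lambda>b. if b = 0 then Suc i else 0) (ceqv \<Delta>)"
| "tr_tm \<Delta> (Fun f ts) =
     (let k = length ts in
      (ex_block \<Delta> ^^ k)
        (And (conj_list (map (\<lambda>(i, \<phi>). on_blocks \<Delta> (case_nat i (\<lambda>b. Suc k + b)) \<phi>)
               (List.enumerate 0 (map (tr_tm \<Delta>) ts))))
             (cop \<Delta> f)))"

primrec tr :: "('f, 'g) code \<Rightarrow> 'f fm \<Rightarrow> 'g fm" where
  "tr \<Delta> Truth = Truth"
| "tr \<Delta> (Eq s t) = ex_block \<Delta> (And (tr_tm \<Delta> s) (tr_tm \<Delta> t))"
| "tr \<Delta> (Neg \<phi>) = Neg (tr \<Delta> \<phi>)"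
| "tr \<Delta> (And \<phi> \<chi>) = And (tr \<Delta> \<phi>) (tr \<Delta> \<chi>)"
| "tr \<Delta> (Ex \<phi>) = ex_block \<Delta> (tr \<Delta> \<phi>)"

text \<open>
  The composite of \<open>\<Gamma>\<close> (of \<open>A\<close> in \<open>B\<close>) and \<open>\<Delta>\<close> (of \<open>B\<close> in \<open>C\<close>) is a code of \<open>A\<close> in \<open>C\<close>.
  Its parameters are those of \<open>\<Delta>\<close> followed by representatives of those of \<open>\<Gamma>\<close>.
\<close>

definition comp_code :: "('f, 'g) code \<Rightarrow> ('g, 'h) code \<Rightarrow> ('f, 'h) code" where
  "comp_code \<Gamma> \<Delta> =
     \<lparr> cdim = cdim \<Gamma> * cdim \<Delta>,
       cpar = cpar \<Delta> + cdim \<Delta> * cpar \<Gamma>,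
       cdom = And (conj_list (map (dom_block \<Delta>) [cpar \<Gamma>..<cpar \<Gamma> + cdim \<Gamma>])) (tr \<Delta> (cdom \<Gamma>)),
       ceqv = tr \<Delta> (ceqv \<Gamma>),
       cop = (\<lambda>f. tr \<Delta> (cop \<Gamma> f)) \<rparr>"

text \<open>The formula defining the admissible parameters of the composite of \<open>(\<Gamma>, \<phi>)\<close> and \<open>(\<Delta>, \<psi>)\<close>.\<close>

definition comp_param :: "('f, 'g) code \<Rightarrow> 'g fm \<Rightarrow> ('g, 'h) code \<Rightarrow> 'h fm \<Rightarrow> 'h fm" where
  "comp_param \<Gamma> \<phi> \<Delta> \<psi> =
     And \<psi> (And (conj_list (map (dom_block \<Delta>) [0..<cpar \<Gamma>])) (tr \<Delta> \<phi>))"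


section \<open>Regular bi-interpretability\<close>

text \<open>
  For all parameters \<open>r\<close> satisfying \<open>\<chi>\<close>, the formula \<open>\<theta>(r, u, x)\<close> defines (the graph of) a
  coordinate map from the interpreted structure to \<open>A\<close> itself.
\<close>

definition defines_coordinate_map ::
  "'f::language fm \<Rightarrow> ('f, 'f) code \<Rightarrow> 'f fm \<Rightarrow> ('f, 'a) struct \<Rightarrow> bool" where
  "defines_coordinate_map \<theta> \<Lambda> \<chi> A \<longleftrightarrow>
     fm_in (cpar \<Lambda> + cdim \<Lambda> + 1) \<theta> \<and>
     (\<forall>r \<in> solutions A (cpar \<Lambda>) \<chi>. \<exists>\<mu>. coordinate_map \<Lambda> A r A \<mu> \<and>
        (\<forall>u \<in> tuples A (cdim \<Lambda>). \<forall>x \<in> univ A.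
           holds A \<theta> (r @ u @ [x]) \<longleftrightarrow> u \<in> code_dom \<Lambda> A r \<and> \<mu> u = x))"

definition regularly_bi_interpretable ::
  "('f::language, 'a) struct \<Rightarrow> ('g::language, 'b) struct \<Rightarrow> bool" where
  "regularly_bi_interpretable A B \<longleftrightarrow>
     (\<exists>(\<Gamma> :: ('f, 'g) code) \<phi> (\<Delta> :: ('g, 'f) code) \<psi> \<theta>A \<theta>B.
        regular_interpretation \<Gamma> \<phi> A B \<and>
        regular_interpretation \<Delta> \<psi> B A \<and>
        defines_coordinate_map \<theta>A (comp_code \<Gamma> \<Delta>) (comp_param \<Gamma> \<phi> \<Delta> \<psi>) A \<and>
        defines_coordinate_map \<theta>B (comp_code \<Delta> \<Gamma>) (comp_param \<Delta> \<psi> \<Gamma> \<phi>) B)"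


section \<open>The rings\<close>

datatype ring_sym = Zero | One | Plus | Times

instantiation ring_sym :: language
begin

primrec arity_ring_sym :: "ring_sym \<Rightarrow> nat" where
  "arity_ring_sym Zero = 0"
| "arity_ring_sym One = 0"
| "arity_ring_sym Plus = 2"
| "arity_ring_sym Times = 2"

instance ..

end

primrec ring_interp :: "ring_sym \<Rightarrow> 'a::comm_ring_1 list \<Rightarrow> 'a" where
  "ring_interp Zero xs = 0"
| "ring_interp One xs = 1"
| "ring_interp Plus xs = xs ! 0 + xs ! 1"
| "ring_interp Times xs = xs ! 0 * xs ! 1"

definition ring_struct :: "'a::comm_ring_1 set \<Rightarrow> (ring_sym, 'a) struct" where
  "ring_struct R = \<lparr> univ = R, interp = ring_interp \<rparr>"

text \<open>
  Exponent vectors are finitely supported maps \<open>nat \<Rightarrow>\<^sub>0 nat\<close>, polynomials are finitely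
  supported maps from exponent vectors to coefficients, and the ring structure on the latter
  is that of \<^theory>\<open>HOL-Library.Poly_Mapping\<close> (multiplication is convolution). The \<open>k\<close> indeterminates
  have indices \<open>0, \<dots>, k - 1\<close>.
\<close>

definition int_mpolys :: "nat \<Rightarrow> ((nat \<Rightarrow>\<^sub>0 nat) \<Rightarrow>\<^sub>0 int) set" where
  "int_mpolys k = {p. \<forall>m \<in> Poly_Mapping.keys p. Poly_Mapping.keys m \<subseteq> {..<k}}"

end

theory Submission
  imports Defs "HOL-Number_Theory.Cong" "HOL-Computational_Algebra.Polynomial"
    "HOL-Computational_Algebra.Primes"
begin

text \<open>
  A polynomial is coded by a straight-line program over \<open>\<int>\<close>: the first values are
  \<open>1, -1, x\<^sub>1, \<dots>, x\<^sub>k\<close> and every further value is \<open>a + b * c\<close> for earlier values \<open>a, b, c\<close>. The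
  positions are stored by Goedel's beta function, so the graph \<open>(u, a, v)\<close> of
  \<open>program u takes the value v at the point a of \<int>\<^sup>k\<close> is definable in \<open>\<int>\<close>, and as integer
  polynomials are determined by their values on \<open>\<int>\<^sup>k\<close>, so are equality, addition and
  multiplication of the coded polynomials.

  Conversely \<open>\<int>\<close> is definable in \<open>\<int>[x\<^sub>1, \<dots>, x\<^sub>k]\<close>; the parameters of this interpretation are a
  tuple \<open>r\<close> of generators of the polynomial ring. A code \<open>u\<close> in the copy of \<open>\<int>\<close> is mapped to the
  unique \<open>f\<close> such that for every integer point \<open>a\<close> the difference of \<open>f\<close> and the value of \<open>u\<close> at
  \<open>a\<close> lies in the ideal generated by \<open>r\<^sub>1 - a\<^sub>1, \<dots>, r\<^sub>k - a\<^sub>k\<close>. That this \<open>f\<close> is unique and that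
  \<open>u\<close> maps bijectively to \<open>f\<close> is a first-order property of \<open>r\<close>, satisfied by the indeterminates; it is
  taken as the definition of admissible parameters.
\<close>

subsection \<open>Definable relations\<close>

text \<open>Automorphisms such as a translation of the indeterminates forbid a formula that singles
  the indeterminates out, so parameters are unavoidable, and regularity wants a formula all of whose
  solutions work. The chosen one forces evaluation at \<open>r\<close> to be an automorphism of the
  polynomial ring; the coordinate map at \<open>r\<close> is decoding followed by this automorphism.
  Evaluation of a polynomial at a point is not an operation of the language. The ideal replaces it:
  modulo the \<open>r_j - a_j\<close> the element \<open>f(r)\<close> is congruent to the integer
  \<open>f(a)\<close>, and an element is determined by its residues once the ideals of all integer
  points meet in 0. Programs are preferred to lists of coefficients because a run is a single
  sequence of integers that obeys a local rule; no exponent vectors have to be coded. Hardly any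
  formula is written down. \<open>definable\<close> says that some formula has a given meaning,
  closure rules build formulas from meanings, and relations over the integers are carried into the
  polynomial ring by restricting quantifiers.\<close>

lemma eval_tm_rename: "eval_tm M e (rename_tm \<rho> t) = eval_tm M (e \<circ> \<rho>) t"
  by (induction t) (auto simp: comp_def intro!: arg_cong[of _ _ "interp M _"])

lemma sat_rename: "sat M e (rename \<rho> \<phi>) \<longleftrightarrow> sat M (e \<circ> \<rho>) \<phi>"
proof (induction \<phi> arbitrary: e \<rho>)
  case (Ex \<phi>)
  have "case_nat a e \<circ> case_nat 0 (\<lambda>i. Suc (\<rho> i)) = case_nat a (e \<circ> \<rho>)" for a
    by (auto simp: fun_eq_iff split: nat.splits)
  then show ?case by (simp only: rename.simps sat.simps Ex.IH)
qed (auto simp: eval_tm_rename)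

lemma eval_tm_cong:
  "tm_in n t \<Longrightarrow> (\<And>i. i < n \<Longrightarrow> e i = e' i) \<Longrightarrow> eval_tm M e t = eval_tm M e' t"
  by (induction t) (auto simp: list_all_iff intro!: arg_cong[of _ _ "interp M _"])

lemma sat_cong:
  "fm_in n \<phi> \<Longrightarrow> (\<And>i. i < n \<Longrightarrow> e i = e' i) \<Longrightarrow> sat M e \<phi> \<longleftrightarrow> sat M e' \<phi>"
proof (induction \<phi> arbitrary: n e e')
  case (Eq s t)
  then show ?case using eval_tm_cong[of n s e e' M] eval_tm_cong[of n t e e' M] by simp
next
  case (Ex \<phi>)
  have "sat M (case_nat a e) \<phi> \<longleftrightarrow> sat M (case_nat a e') \<phi>" for a
    by (rule Ex.IH[of "Suc n"]) (use Ex.prems in \<open>auto split: nat.splits\<close>)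
  then show ?case by simp
next
  case (And \<phi> \<chi>)
  from And.IH(1)[of n e e'] And.IH(2)[of n e e'] And.prems show ?case by simp
next
  case (Neg \<phi>)
  from Neg.IH[of n e e'] Neg.prems show ?case by simp
qed simp

primrec subst_tm :: "(nat \<Rightarrow> 'f tm) \<Rightarrow> 'f tm \<Rightarrow> 'f tm" where
  "subst_tm \<sigma> (Var i) = \<sigma> i"
| "subst_tm \<sigma> (Fun f ts) = Fun f (map (subst_tm \<sigma>) ts)"

primrec subst :: "(nat \<Rightarrow> 'f tm) \<Rightarrow> 'f fm \<Rightarrow> 'f fm" where
  "subst \<sigma> Truth = Truth"
| "subst \<sigma> (Eq s t) = Eq (subst_tm \<sigma> s) (subst_tm \<sigma> t)"
| "subst \<sigma> (Neg \<phi>) = Neg (subst \<sigma> \<phi>)"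
| "subst \<sigma> (And \<phi> \<chi>) = And (subst \<sigma> \<phi>) (subst \<sigma> \<chi>)"
| "subst \<sigma> (Ex \<phi>) = Ex (subst (case_nat (Var 0) (\<lambda>i. rename_tm Suc (\<sigma> i))) \<phi>)"

lemma eval_tm_subst: "eval_tm M e (subst_tm \<sigma> t) = eval_tm M (\<lambda>i. eval_tm M e (\<sigma> i)) t"
  by (induction t) (auto simp: comp_def intro!: arg_cong[of _ _ "interp M _"])

lemma sat_subst: "sat M e (subst \<sigma> \<phi>) \<longleftrightarrow> sat M (\<lambda>i. eval_tm M e (\<sigma> i)) \<phi>"
proof (induction \<phi> arbitrary: e \<sigma>)
  case (Ex \<phi>)
  have "(\<lambda>i. eval_tm M (case_nat a e) (case_nat (Var 0) (\<lambda>i. rename_tm Suc (\<sigma> i)) i))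
        = case_nat a (\<lambda>i. eval_tm M e (\<sigma> i))" for a
    by (auto simp: fun_eq_iff eval_tm_rename comp_def split: nat.splits)
  then show ?case by (simp only: subst.simps sat.simps Ex.IH)
qed (auto simp: eval_tm_subst)

lemma tm_in_rename: "tm_in n t \<Longrightarrow> (\<And>i. i < n \<Longrightarrow> \<rho> i < m) \<Longrightarrow> tm_in m (rename_tm \<rho> t)"
  by (induction t) (auto simp: list_all_iff)

lemma tm_in_subst: "tm_in n t \<Longrightarrow> (\<And>i. i < n \<Longrightarrow> tm_in m (\<sigma> i)) \<Longrightarrow> tm_in m (subst_tm \<sigma> t)"
  by (induction t) (auto simp: list_all_iff)

lemma fm_in_subst: "fm_in n \<phi> \<Longrightarrow> (\<And>i. i < n \<Longrightarrow> tm_in m (\<sigma> i)) \<Longrightarrow> fm_in m (subst \<sigma> \<phi>)"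
proof (induction \<phi> arbitrary: n m \<sigma>)
  case (Ex \<phi>)
  have "fm_in (Suc m) (subst (case_nat (Var 0) (\<lambda>i. rename_tm Suc (\<sigma> i))) \<phi>)"
  proof (rule Ex.IH[of "Suc n"])
    show "tm_in (Suc m) (case_nat (Var 0) (\<lambda>i. rename_tm Suc (\<sigma> i)) i)" if "i < Suc n" for i
      using that Ex.prems(2) by (auto split: nat.splits intro: tm_in_rename)
  qed (use Ex.prems in simp)
  then show ?case by simp
next
  case (And \<phi> \<chi>)
  from And.IH(1)[of n m \<sigma>] And.IH(2)[of n m \<sigma>] And.prems show ?case by simp
qed (auto intro: tm_in_subst)

section \<open>Definable relations and their closure properties\<close>

definition closed_struct :: "('f::language, 'a) struct \<Rightarrow> bool" where
  "closed_struct M \<longleftrightarrow> (\<forall>f. \<forall>xs \<in> tuples M (arity f). interp M f xs \<in> univ M)"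

lemma eval_tm_in_univ:
  "closed_struct M \<Longrightarrow> tm_in n t \<Longrightarrow> (\<And>i. i < n \<Longrightarrow> e i \<in> univ M) \<Longrightarrow> eval_tm M e t \<in> univ M"
proof (induction t)
  case (Fun f ts)
  have "map (eval_tm M e) ts \<in> tuples M (arity f)"
    using Fun by (auto simp: tuples_def list_all_iff)
  then show ?case using Fun.prems(1) by (simp add: closed_struct_def)
qed simp

text \<open>Only functions given by terms: they can be substituted into a formula without adding a
  quantifier. All other functions enter through relations.\<close>

definition definable_fun :: "('f::language, 'a) struct \<Rightarrow> nat \<Rightarrow> ((nat \<Rightarrow> 'a) \<Rightarrow> 'a) \<Rightarrow> bool" where
  "definable_fun M n t \<longleftrightarrow>
     (\<exists>\<tau>. tm_in n \<tau> \<and> (\<forall>e. (\<forall>i<n. e i \<in> univ M) \<longrightarrow> eval_tm M e \<tau> = t e))"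

text \<open>Meaning is prescribed only for assignments whose first \<open>n\<close> values lie in
  the universe, so that facts about the structure may be used to replace \<open>R\<close> by an
  equivalent condition (\<open>definable_cong\<close>).\<close>

definition definable :: "('f::language, 'a) struct \<Rightarrow> nat \<Rightarrow> ((nat \<Rightarrow> 'a) \<Rightarrow> bool) \<Rightarrow> bool" where
  "definable M n R \<longleftrightarrow>
     (\<exists>\<phi>. fm_in n \<phi> \<and> (\<forall>e. (\<forall>i<n. e i \<in> univ M) \<longrightarrow> (sat M e \<phi> \<longleftrightarrow> R e)))"

lemma definable_fun_var: "i < n \<Longrightarrow> definable_fun M n (\<lambda>e. e i)"
  unfolding definable_fun_def by (rule exI[of _ "Var i"]) simp

lemma definable_True: "definable M n (\<lambda>e. True)"
  unfolding definable_def by (rule exI[of _ Truth]) simp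

lemma definable_eq:
  assumes "definable_fun M n s" "definable_fun M n t"
  shows "definable M n (\<lambda>e. s e = t e)"
proof -
  obtain \<sigma> \<tau> where "tm_in n \<sigma>" "tm_in n \<tau>"
    "\<forall>e. (\<forall>i<n. e i \<in> univ M) \<longrightarrow> eval_tm M e \<sigma> = s e"
    "\<forall>e. (\<forall>i<n. e i \<in> univ M) \<longrightarrow> eval_tm M e \<tau> = t e"
    using assms unfolding definable_fun_def by blast
  then show ?thesis unfolding definable_def by (intro exI[of _ "Eq \<sigma> \<tau>"]) auto
qed

lemma definable_not:
  assumes "definable M n R"
  shows "definable M n (\<lambda>e. \<not> R e)"
proof -
  obtain \<phi> where "fm_in n \<phi>" "\<forall>e. (\<forall>i<n. e i \<in> univ M) \<longrightarrow> (sat M e \<phi> \<longleftrightarrow> R e)"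
    using assms unfolding definable_def by blast
  then show ?thesis unfolding definable_def by (intro exI[of _ "Neg \<phi>"]) auto
qed

lemma definable_conj:
  assumes "definable M n R" "definable M n S"
  shows "definable M n (\<lambda>e. R e \<and> S e)"
proof -
  obtain \<phi> \<chi> where "fm_in n \<phi>" "fm_in n \<chi>"
    "\<forall>e. (\<forall>i<n. e i \<in> univ M) \<longrightarrow> (sat M e \<phi> \<longleftrightarrow> R e)"
    "\<forall>e. (\<forall>i<n. e i \<in> univ M) \<longrightarrow> (sat M e \<chi> \<longleftrightarrow> S e)"
    using assms unfolding definable_def by blast
  then show ?thesis unfolding definable_def by (intro exI[of _ "And \<phi> \<chi>"]) auto
qed

text \<open>The curried form makes the conclusion a higher-order pattern: resolution finds
  \<open>R\<close>, and the premise carries out the shift of de Bruijn indices.\<close>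

lemma definable_ex:
  assumes "definable M (Suc n) (\<lambda>e. R (\<lambda>i. e (Suc i)) (e 0))"
  shows "definable M n (\<lambda>e. \<exists>a\<in>univ M. R e a)"
proof -
  obtain \<phi> where \<phi>: "fm_in (Suc n) \<phi>"
    and sat: "\<And>e. (\<forall>i<Suc n. e i \<in> univ M) \<Longrightarrow> sat M e \<phi> \<longleftrightarrow> R (\<lambda>i. e (Suc i)) (e 0)"
    using assms unfolding definable_def by blast
  have "sat M (case_nat a e) \<phi> \<longleftrightarrow> R e a" if "\<forall>i<n. e i \<in> univ M" "a \<in> univ M" for e a
    using that by (subst sat) (auto split: nat.splits)
  with \<phi> show ?thesis unfolding definable_def by (intro exI[of _ "Ex \<phi>"]) auto
qed

lemma definable_disj:
  "definable M n R \<Longrightarrow> definable M n S \<Longrightarrow> definable M n (\<lambda>e. R e \<or> S e)"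
  using definable_not[OF definable_conj[OF definable_not definable_not, of M n R S]] by simp

lemma definable_imp:
  "definable M n R \<Longrightarrow> definable M n S \<Longrightarrow> definable M n (\<lambda>e. R e \<longrightarrow> S e)"
  using definable_not[OF definable_conj[OF _ definable_not, of M n R S]] by simp

lemma definable_all:
  "definable M (Suc n) (\<lambda>e. R (\<lambda>i. e (Suc i)) (e 0)) \<Longrightarrow> definable M n (\<lambda>e. \<forall>a\<in>univ M. R e a)"
  using definable_not[OF definable_ex[of M n "\<lambda>e a. \<not> R e a", OF definable_not]] by simp

text \<open>The bound \<open>k\<close> is a fixed number, so this is a finite conjunction. A
  quantifier bounded by an element of the structure needs a definable order instead.\<close>

lemma definable_all_less:
  fixes k :: nat
  shows "(\<And>j. j < k \<Longrightarrow> definable M n (R j)) \<Longrightarrow> definable M n (\<lambda>e. \<forall>j<k. R j e)"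
proof (induction k)
  case (Suc k)
  have "definable M n (\<lambda>e. (\<forall>j<k. R j e) \<and> R k e)"
    using Suc by (intro definable_conj) auto
  moreover have "(\<forall>j<Suc k. R j e) \<longleftrightarrow> (\<forall>j<k. R j e) \<and> R k e" for e
    by (auto simp: less_Suc_eq)
  ultimately show ?case by simp
qed (simp add: definable_True)

lemma definable_cong:
  "definable M n R \<Longrightarrow> (\<And>e. \<forall>i<n. e i \<in> univ M \<Longrightarrow> R e \<longleftrightarrow> S e) \<Longrightarrow> definable M n S"
  unfolding definable_def by simp

text \<open>Values of the terms stay in the universe by closedness, where the formula for
  \<open>R\<close> is known to be correct; \<open>R_cong\<close> then lets \<open>t j\<close>
  replace the value of its term, although they agree only for \<open>j < m\<close>.\<close>

lemma definable_subst:
  assumes M: "closed_struct M" and R: "definable M m R" and t: "\<And>j. j < m \<Longrightarrow> definable_fun M n (t j)"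
    and R_cong: "\<And>e e'. (\<And>i. i < m \<Longrightarrow> e i = e' i) \<Longrightarrow> R e = R e'"
  shows "definable M n (\<lambda>e. R (\<lambda>j. t j e))"
proof -
  obtain \<tau> where \<tau>: "\<And>j. j < m \<Longrightarrow> tm_in n (\<tau> j)"
    "\<And>j e. j < m \<Longrightarrow> \<forall>i<n. e i \<in> univ M \<Longrightarrow> eval_tm M e (\<tau> j) = t j e"
    using t unfolding definable_fun_def by metis
  obtain \<phi> where \<phi>: "fm_in m \<phi>"
    "\<And>e. \<forall>i<m. e i \<in> univ M \<Longrightarrow> sat M e \<phi> \<longleftrightarrow> R e"
    using R unfolding definable_def by blast
  have "sat M e (subst \<tau> \<phi>) \<longleftrightarrow> R (\<lambda>j. t j e)" if e: "\<forall>i<n. e i \<in> univ M" for e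
  proof -
    have "sat M (\<lambda>j. eval_tm M e (\<tau> j)) \<phi> \<longleftrightarrow> R (\<lambda>j. eval_tm M e (\<tau> j))"
      using \<tau>(1) e by (intro \<phi>(2)) (auto intro: eval_tm_in_univ[OF M])
    also have "\<dots> \<longleftrightarrow> R (\<lambda>j. t j e)"
      using \<tau>(2) e by (intro R_cong) auto
    finally show ?thesis by (simp add: sat_subst)
  qed
  moreover have "fm_in n (subst \<tau> \<phi>)" using fm_in_subst \<phi>(1) \<tau>(1) by blast
  ultimately show ?thesis unfolding definable_def by blast
qed

text \<open>A tuple of terms of fixed length, by which relations on lists receive whole blocks of
  variables.\<close>

definition definable_list ::
  "('f::language, 'a) struct \<Rightarrow> nat \<Rightarrow> nat \<Rightarrow> ((nat \<Rightarrow> 'a) \<Rightarrow> 'a list) \<Rightarrow> bool" where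
  "definable_list M n m l \<longleftrightarrow>
     (\<forall>e. length (l e) = m) \<and> (\<forall>j<m. definable_fun M n (\<lambda>e. l e ! j))"

lemma definable_list_Nil: "definable_list M n 0 (\<lambda>e. [])"
  by (simp add: definable_list_def)

lemma definable_list_Cons:
  "definable_fun M n t \<Longrightarrow> definable_list M n m l \<Longrightarrow> definable_list M n (Suc m) (\<lambda>e. t e # l e)"
  unfolding definable_list_def by (auto simp: less_Suc_eq_0_disj)

lemma definable_list_append:
  assumes "definable_list M n m l" "definable_list M n m' l'"
  shows "definable_list M n (m + m') (\<lambda>e. l e @ l' e)"
proof -
  have "definable_fun M n (\<lambda>e. (l e @ l' e) ! j)" if "j < m + m'" for j
  proof (cases "j < m")
    case True
    then show ?thesis using assms by (simp add: definable_list_def nth_append)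
  next
    case False
    then have "definable_fun M n (\<lambda>e. l' e ! (j - m))" using assms that by (simp add: definable_list_def)
    with False assms show ?thesis by (simp add: definable_list_def nth_append)
  qed
  with assms show ?thesis by (simp add: definable_list_def)
qed

lemma definable_list_map:
  "(\<And>j. j \<in> set js \<Longrightarrow> definable_fun M n (t j)) \<Longrightarrow> length js = m \<Longrightarrow>
    definable_list M n m (\<lambda>e. map (\<lambda>j. t j e) js)"
  by (auto simp: definable_list_def)

lemma definable_apply:
  assumes "closed_struct M" "definable M m (\<lambda>e. R (map e [0..<m]))" "definable_list M n m l"
  shows "definable M n (\<lambda>e. R (l e))"
proof -
  have "definable M n (\<lambda>e. R (map (\<lambda>j. l e ! j) [0..<m]))"
    by (rule definable_subst[OF assms(1,2)])
      (use assms(3) in \<open>auto simp: definable_list_def intro!: arg_cong[of _ _ R]\<close>)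
  moreover have "map (\<lambda>j. l e ! j) [0..<m] = l e" for e
    using assms(3) by (metis definable_list_def map_nth)
  ultimately show ?thesis by simp
qed

lemma definable_ex_tuple:
  assumes "definable M (k + n) (\<lambda>e. R (\<lambda>i. e (k + i)) (map e [0..<k]))"
  shows "definable M n (\<lambda>e. \<exists>xs\<in>tuples M k. R e xs)"
  using assms
proof (induction k arbitrary: n R)
  case 0
  then show ?case by (simp add: tuples_def)
next
  case (Suc k)
  \<comment> \<open>The outermost quantifier takes the last entry: inner binders get the smaller
    indices, so the tuple is read off in order as \<open>map e [0..<k]\<close>.\<close>
  have "definable M (Suc n) (\<lambda>e. \<exists>xs\<in>tuples M k. R (\<lambda>i. e (Suc i)) (xs @ [e 0]))"
    using Suc.prems by (intro Suc.IH) (simp add: algebra_simps)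
  then have "definable M n (\<lambda>e. \<exists>a\<in>univ M. \<exists>xs\<in>tuples M k. R e (xs @ [a]))"
    by (rule definable_ex)
  moreover have "(\<exists>a\<in>univ M. \<exists>xs\<in>tuples M k. R e (xs @ [a])) \<longleftrightarrow> (\<exists>ys\<in>tuples M (Suc k). R e ys)"
    for e
  proof safe
    fix ys assume "ys \<in> tuples M (Suc k)" and R: "R e ys"
    then obtain xs a where "ys = xs @ [a]" by (cases ys rule: rev_cases) (auto simp: tuples_def)
    with \<open>ys \<in> tuples M (Suc k)\<close> R show "\<exists>a\<in>univ M. \<exists>xs\<in>tuples M k. R e (xs @ [a])"
      by (auto simp: tuples_def)
  next
    fix a xs assume "a \<in> univ M" "xs \<in> tuples M k" "R e (xs @ [a])"
    then show "\<exists>ys\<in>tuples M (Suc k). R e ys"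
      by (intro bexI[of _ "xs @ [a]"]) (auto simp: tuples_def)
  qed
  ultimately show ?case by simp
qed

lemma definable_all_tuple:
  assumes "definable M (k + n) (\<lambda>e. R (\<lambda>i. e (k + i)) (map e [0..<k]))"
  shows "definable M n (\<lambda>e. \<forall>xs\<in>tuples M k. R e xs)"
  using definable_not[OF definable_ex_tuple[of M k n "\<lambda>e xs. \<not> R e xs"], OF definable_not[OF assms]]
  by simp

lemma definable_holds:
  assumes "definable M n (\<lambda>e. R (map e [0..<n]))"
  obtains \<phi> where "fm_in n \<phi>" "\<And>xs. xs \<in> tuples M n \<Longrightarrow> holds M \<phi> xs \<longleftrightarrow> R xs"
proof -
  obtain \<phi> where \<phi>: "fm_in n \<phi>"
    "\<And>e. \<forall>i<n. e i \<in> univ M \<Longrightarrow> sat M e \<phi> \<longleftrightarrow> R (map e [0..<n])"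
    using assms unfolding definable_def by blast
  have "holds M \<phi> xs \<longleftrightarrow> R xs" if "xs \<in> tuples M n" for xs
  proof -
    have "sat M ((!) xs) \<phi> \<longleftrightarrow> R (map ((!) xs) [0..<n])"
      using that by (intro \<phi>(2)) (auto simp: tuples_def)
    moreover have "map ((!) xs) [0..<n] = xs" using that by (auto simp: tuples_def map_nth)
    ultimately show ?thesis by (simp add: holds_def)
  qed
  with \<phi>(1) show ?thesis by (rule that)
qed

lemmas definable_intros =
  definable_True definable_eq definable_not definable_conj definable_disj definable_imp
  definable_all_less

section \<open>Definability in ring structures\<close>

definition ring_closed :: "'a::comm_ring_1 set \<Rightarrow> bool" where
  "ring_closed S \<longleftrightarrow> 0 \<in> S \<and> 1 \<in> S \<and> (\<forall>x\<in>S. \<forall>y\<in>S. x + y \<in> S \<and> x * y \<in> S)"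

lemma univ_ring_struct [simp]: "univ (ring_struct S) = S"
  and interp_ring_struct [simp]: "interp (ring_struct S) = ring_interp"
  by (simp_all add: ring_struct_def)

lemma closed_ring_struct: "ring_closed S \<Longrightarrow> closed_struct (ring_struct S)"
  unfolding closed_struct_def
proof safe
  fix f :: ring_sym and xs assume S: "ring_closed S" and xs: "xs \<in> tuples (ring_struct S) (arity f)"
  show "interp (ring_struct S) f xs \<in> univ (ring_struct S)"
    using S xs by (cases f) (auto simp: ring_closed_def tuples_def numeral_2_eq_2 length_Suc_conv)
qed

lemma definable_fun_zero: "definable_fun (ring_struct S) n (\<lambda>e. 0)"
  unfolding definable_fun_def by (rule exI[of _ "Fun Zero []"]) simp

lemma definable_fun_one: "definable_fun (ring_struct S) n (\<lambda>e. 1)"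
  unfolding definable_fun_def by (rule exI[of _ "Fun One []"]) simp

lemma definable_fun_binary_op:
  assumes "definable_fun (ring_struct S) n s" "definable_fun (ring_struct S) n t" "arity f = 2"
  shows "definable_fun (ring_struct S) n (\<lambda>e. ring_interp f [s e, t e])"
proof -
  obtain \<sigma> \<tau> where "tm_in n \<sigma>" "tm_in n \<tau>"
    "\<forall>e. (\<forall>i<n. e i \<in> S) \<longrightarrow> eval_tm (ring_struct S) e \<sigma> = s e"
    "\<forall>e. (\<forall>i<n. e i \<in> S) \<longrightarrow> eval_tm (ring_struct S) e \<tau> = t e"
    using assms(1,2) unfolding definable_fun_def by auto
  with assms(3) show ?thesis unfolding definable_fun_def by (intro exI[of _ "Fun f [\<sigma>, \<tau>]"]) auto
qed

lemma definable_fun_plus: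
  "definable_fun (ring_struct S) n s \<Longrightarrow> definable_fun (ring_struct S) n t \<Longrightarrow>
    definable_fun (ring_struct S) n (\<lambda>e. s e + t e)"
  using definable_fun_binary_op[of S n s t Plus] by simp

lemma definable_fun_times:
  "definable_fun (ring_struct S) n s \<Longrightarrow> definable_fun (ring_struct S) n t \<Longrightarrow>
    definable_fun (ring_struct S) n (\<lambda>e. s e * t e)"
  using definable_fun_binary_op[of S n s t Times] by simp

lemma definable_fun_of_nat: "definable_fun (ring_struct S) n (\<lambda>e. of_nat m)"
proof (induction m)
  case (Suc m)
  then show ?case using definable_fun_plus[OF definable_fun_one Suc] by simp
qed (simp add: definable_fun_zero)

lemma definable_fun_numeral: "definable_fun (ring_struct S) n (\<lambda>e. numeral m)"
  using definable_fun_of_nat[of S n "numeral m"] by simp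

lemma definable_fun_sum:
  fixes k :: nat
  shows "(\<And>j. j < k \<Longrightarrow> definable_fun (ring_struct S) n (t j)) \<Longrightarrow>
    definable_fun (ring_struct S) n (\<lambda>e. \<Sum>j<k. t j e)"
  by (induction k) (auto intro!: definable_fun_zero definable_fun_plus)

lemmas definable_fun_intros =
  definable_fun_zero definable_fun_one definable_fun_numeral definable_fun_of_nat
  definable_fun_plus definable_fun_times definable_fun_sum definable_fun_var

lemma definable_ex_ring:
  "definable (ring_struct S) (Suc n) (\<lambda>e. R (\<lambda>i. e (Suc i)) (e 0)) \<Longrightarrow>
    definable (ring_struct S) n (\<lambda>e. \<exists>a\<in>S. R e a)"
  using definable_ex[of "ring_struct S" n R] by simp

lemma definable_all_ring:
  "definable (ring_struct S) (Suc n) (\<lambda>e. R (\<lambda>i. e (Suc i)) (e 0)) \<Longrightarrow>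
    definable (ring_struct S) n (\<lambda>e. \<forall>a\<in>S. R e a)"
  using definable_all[of "ring_struct S" n R] by simp

lemma definable_ex_UNIV:
  "definable (ring_struct UNIV) (Suc n) (\<lambda>e. R (\<lambda>i. e (Suc i)) (e 0)) \<Longrightarrow>
    definable (ring_struct UNIV) n (\<lambda>e. \<exists>a. R e a)"
  using definable_ex[of "ring_struct UNIV" n R] by simp

lemma definable_all_UNIV:
  "definable (ring_struct UNIV) (Suc n) (\<lambda>e. R (\<lambda>i. e (Suc i)) (e 0)) \<Longrightarrow>
    definable (ring_struct UNIV) n (\<lambda>e. \<forall>a. R e a)"
  using definable_all[of "ring_struct UNIV" n R] by simp

subsection \<open>Coordinate maps and composition of interpretations\<close>

text \<open>Well-definedness costs nothing once the equivalence is the kernel of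
  \<open>\<mu>\<close> and the graphs are the preimages of the operations of \<open>A\<close>:
  everything is then inherited from \<open>A\<close> through \<open>\<mu>\<close>. For a concrete
  code, three conditions on representatives remain to be checked.\<close>

lemma coordinate_mapI:
  fixes \<Gamma> :: "('f::language, 'g) code"
  assumes A: "closed_struct A" "univ A \<noteq> {}"
    and surj: "\<mu> ` code_dom \<Gamma> B p = univ A"
    and eqv: "\<And>x y. x \<in> code_dom \<Gamma> B p \<Longrightarrow> y \<in> code_dom \<Gamma> B p \<Longrightarrow>
      holds B (ceqv \<Gamma>) (p @ x @ y) \<longleftrightarrow> \<mu> x = \<mu> y"
    and graph: "\<And>f xs y. xs \<in> lists (code_dom \<Gamma> B p) \<Longrightarrow> length xs = arity f \<Longrightarrow>
      y \<in> code_dom \<Gamma> B p \<Longrightarrow> code_graph \<Gamma> B p f xs y \<longleftrightarrow> \<mu> y = interp A f (map \<mu> xs)"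
  shows "coordinate_map \<Gamma> B p A \<mu>"
proof -
  define D where "D = code_dom \<Gamma> B p"
  define E where "E = code_eqv \<Gamma> B p"
  note D = D_def[symmetric] and E = E_def[symmetric]
  note surj = surj[unfolded D] and graph = graph[unfolded D]
  have E_iff: "(x, y) \<in> E \<longleftrightarrow> x \<in> D \<and> y \<in> D \<and> \<mu> x = \<mu> y" for x y
    using eqv by (auto simp: E_def D_def code_eqv_def)
  have equiv: "equiv D E"
    by (rule equivI) (auto simp: refl_on_def sym_def trans_def E_iff)
  have val: "interp A f (map \<mu> xs) \<in> univ A" if "xs \<in> lists D" "length xs = arity f" for f :: 'f and xs
  proof -
    have "map \<mu> xs \<in> tuples A (arity f)" using that surj by (auto simp: tuples_def)
    with A(1) show ?thesis by (simp add: closed_struct_def)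
  qed
  have E_lists: "xs' \<in> lists D \<and> map \<mu> xs = map \<mu> xs'" if "list_all2 (\<lambda>x x'. (x, x') \<in> E) xs xs'" for xs xs'
    using that by (induction rule: list_all2_induct) (auto simp: E_iff)
  have wd: "well_defined \<Gamma> B p"
    unfolding well_defined_def Let_def D E
  proof (intro conjI allI ballI impI)
    show "D \<noteq> {}" using A(2) surj by auto
    show "equiv D E" by fact
  next
    fix f :: 'f and xs assume xs: "xs \<in> lists D" and len: "length xs = arity f"
    obtain y where "y \<in> D" "\<mu> y = interp A f (map \<mu> xs)"
      using val[OF xs len] surj by (metis imageE)
    then show "\<exists>y\<in>D. code_graph \<Gamma> B p f xs y" using graph xs len by blast
  next
    fix f :: 'f and xs y y' assume "xs \<in> lists D" "length xs = arity f" "y \<in> D" "y' \<in> D"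
      "code_graph \<Gamma> B p f xs y \<and> code_graph \<Gamma> B p f xs y'"
    then show "(y, y') \<in> E" by (simp add: E_iff graph)
  next
    fix f :: 'f and xs xs' y y' assume xs: "xs \<in> lists D" "length xs = arity f" and
      rel: "list_all2 (\<lambda>x x'. (x, x') \<in> E) xs xs' \<and> (y, y') \<in> E \<and> code_graph \<Gamma> B p f xs y"
    then have "length xs' = arity f" by (auto dest: list_all2_lengthD)
    moreover have "xs' \<in> lists D" "map \<mu> xs' = map \<mu> xs" using E_lists[of xs xs'] rel by auto
    moreover have "y \<in> D" "y' \<in> D" "\<mu> y = \<mu> y'" using rel by (auto simp: E_iff)
    ultimately show "code_graph \<Gamma> B p f xs' y'" using rel graph xs by metis
  qed
  \<comment> \<open>\<open>\<mu>\<close> is constant on classes, so the image of a class has a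
    single element.\<close>
  define h where "h X = the_elem (\<mu> ` X)" for X
  have h: "h (E `` {x}) = \<mu> x" if "x \<in> D" for x
  proof -
    have "\<mu> ` (E `` {x}) = {\<mu> x}" using that by (auto simp: E_iff)
    then show ?thesis by (simp add: h_def)
  qed
  have "is_iso h (interp_struct \<Gamma> B p) A"
    unfolding is_iso_def
  proof (intro conjI allI ballI)
    have "inj_on h (D // E)"
    proof (rule inj_onI)
      fix X Y assume "X \<in> D // E" "Y \<in> D // E" "h X = h Y"
      then obtain x y where "x \<in> D" "y \<in> D" "X = E `` {x}" "Y = E `` {y}"
        by (auto elim!: quotientE)
      with \<open>h X = h Y\<close> h show "X = Y" by (auto simp: E_iff)
    qed
    moreover have "h ` (D // E) = univ A"
      using h surj by (auto simp: quotient_def image_UN)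
    ultimately show "bij_betw h (univ (interp_struct \<Gamma> B p)) (univ A)"
      by (simp add: bij_betw_def interp_struct_def D E)
  next
    fix f :: 'f and Xs assume Xs: "Xs \<in> tuples (interp_struct \<Gamma> B p) (arity f)"
    then have "\<forall>X\<in>set Xs. \<exists>x\<in>D. X = E `` {x}"
      by (auto simp: tuples_def interp_struct_def D E elim!: quotientE)
    then obtain r where r: "\<And>X. X \<in> set Xs \<Longrightarrow> r X \<in> D \<and> X = E `` {r X}" by metis
    define xs where "xs = map r Xs"
    have xs: "xs \<in> lists D" "length xs = arity f"
      using r Xs by (auto simp: xs_def tuples_def)
    have hXs: "map h Xs = map \<mu> xs"
      using r h by (auto simp: xs_def) metis
    have mem: "list_all2 (\<in>) xs' Xs \<longleftrightarrow> xs' \<in> lists D \<and> map \<mu> xs' = map \<mu> xs" for xs'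
    proof -
      have "list_all2 (\<in>) xs' Xs \<longleftrightarrow> list_all2 (\<lambda>x X. x \<in> D \<and> \<mu> x = \<mu> (r X)) xs' Xs"
      proof (rule list.rel_cong[OF refl refl])
        fix x X assume "X \<in> set Xs"
        then have "r X \<in> D" and X: "X = E `` {r X}" using r by blast+
        have "x \<in> X \<longleftrightarrow> x \<in> E `` {r X}" using X by (rule arg_cong)
        also have "\<dots> \<longleftrightarrow> x \<in> D \<and> \<mu> x = \<mu> (r X)" using \<open>r X \<in> D\<close> by (auto simp: E_iff)
        finally show "x \<in> X \<longleftrightarrow> x \<in> D \<and> \<mu> x = \<mu> (r X)" .
      qed
      also have "\<dots> \<longleftrightarrow> xs' \<in> lists D \<and> list_all2 (\<lambda>x X. \<mu> x = \<mu> (r X)) xs' Xs"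
        by (induction xs' arbitrary: Xs) (auto simp: list_all2_Cons1)
      also have "list_all2 (\<lambda>x X. \<mu> x = \<mu> (r X)) xs' Xs \<longleftrightarrow> map \<mu> xs' = map \<mu> xs"
        by (simp add: xs_def list_all2_eq list_all2_map1 list_all2_map2 comp_def list.rel_map)
      finally show ?thesis .
    qed
    obtain y0 where y0: "y0 \<in> D" "\<mu> y0 = interp A f (map \<mu> xs)"
      using val[OF xs] surj by (metis imageE)
    have "interp (interp_struct \<Gamma> B p) f Xs = E `` {y0}"
    proof -
      have "(\<exists>xs'. list_all2 (\<in>) xs' Xs \<and> code_graph \<Gamma> B p f xs' y) \<longleftrightarrow> \<mu> y = \<mu> y0"
        if y: "y \<in> D" for y
      proof
        assume "\<exists>xs'. list_all2 (\<in>) xs' Xs \<and> code_graph \<Gamma> B p f xs' y"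
        then obtain xs' where xs': "xs' \<in> lists D" "map \<mu> xs' = map \<mu> xs" "code_graph \<Gamma> B p f xs' y"
          by (auto simp: mem)
        moreover have "length xs' = arity f" using xs'(2) xs(2) by (metis length_map)
        ultimately show "\<mu> y = \<mu> y0" using graph y y0 by simp
      next
        assume "\<mu> y = \<mu> y0"
        then have "code_graph \<Gamma> B p f xs y" using graph[OF xs y] y0 by simp
        then show "\<exists>xs'. list_all2 (\<in>) xs' Xs \<and> code_graph \<Gamma> B p f xs' y"
          using mem xs by blast
      qed
      then have "y \<in> interp (interp_struct \<Gamma> B p) f Xs \<longleftrightarrow> y \<in> E `` {y0}" for y
        using y0(1) by (cases "y \<in> D") (simp_all add: interp_struct_def D E_iff eq_commute[of "\<mu> y0"])
      then show ?thesis by blast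
    qed
    then show "h (interp (interp_struct \<Gamma> B p) f Xs) = interp A f (map h Xs)"
      using h[OF y0(1)] y0(2) hXs by simp
  qed
  with wd surj h show ?thesis
    unfolding coordinate_map_def D E by auto
qed

text \<open>An isomorphism only speaks of classes. Compatibility of the graph with \<open>E\<close>,
  together with uniqueness of values modulo \<open>E\<close>, shows that the class computed from
  \<open>Xs\<close> is the class of any single value of the graph; this brings the operations back
  to representatives, where translated formulas are evaluated.\<close>

lemma coordinate_mapD:
  fixes \<Gamma> :: "('f::language, 'g) code"
  assumes "coordinate_map \<Gamma> B p A \<mu>"
  shows coordinate_map_surj: "\<mu> ` code_dom \<Gamma> B p = univ A"
    and coordinate_map_eqv: "\<And>x y. x \<in> code_dom \<Gamma> B p \<Longrightarrow> y \<in> code_dom \<Gamma> B p \<Longrightarrow>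
      holds B (ceqv \<Gamma>) (p @ x @ y) \<longleftrightarrow> \<mu> x = \<mu> y"
    and coordinate_map_graph: "\<And>f xs y. xs \<in> lists (code_dom \<Gamma> B p) \<Longrightarrow> length xs = arity f \<Longrightarrow>
      y \<in> code_dom \<Gamma> B p \<Longrightarrow> code_graph \<Gamma> B p f xs y \<longleftrightarrow> \<mu> y = interp A f (map \<mu> xs)"
proof -
  define D where "D = code_dom \<Gamma> B p"
  define E where "E = code_eqv \<Gamma> B p"
  note D = D_def[symmetric] and E = E_def[symmetric]
  obtain h where h: "is_iso h (interp_struct \<Gamma> B p) A" "\<And>x. x \<in> D \<Longrightarrow> \<mu> x = h (E `` {x})"
    and surj: "\<mu> ` D = univ A" and wd: "well_defined \<Gamma> B p"
    using assms unfolding coordinate_map_def D E by blast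
  show "\<mu> ` code_dom \<Gamma> B p = univ A" using surj by (simp add: D)
  have equiv: "equiv D E" using wd by (simp add: well_defined_def Let_def D E)
  have inj: "inj_on h (D // E)"
    using h(1) by (simp add: is_iso_def bij_betw_def interp_struct_def D E)
  have E_iff: "(x, y) \<in> E \<longleftrightarrow> \<mu> x = \<mu> y" if "x \<in> D" "y \<in> D" for x y
  proof -
    have "\<mu> x = \<mu> y \<longleftrightarrow> E `` {x} = E `` {y}"
      using that h(2) inj_on_eq_iff[OF inj, of "E `` {x}" "E `` {y}"] by (simp add: quotientI)
    also have "\<dots> \<longleftrightarrow> (x, y) \<in> E" by (rule eq_equiv_class_iff[OF equiv that])
    finally show ?thesis by simp
  qed
  show "holds B (ceqv \<Gamma>) (p @ x @ y) \<longleftrightarrow> \<mu> x = \<mu> y"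
    if "x \<in> code_dom \<Gamma> B p" "y \<in> code_dom \<Gamma> B p" for x y
    using E_iff[of x y] that unfolding E_def D_def code_eqv_def by simp
  fix f :: 'f and xs y
  assume "xs \<in> lists (code_dom \<Gamma> B p)" and len: "length xs = arity f" and "y \<in> code_dom \<Gamma> B p"
  then have xs: "xs \<in> lists D" and y: "y \<in> D" by (simp_all add: D)
  have ex: "\<exists>y\<in>D. code_graph \<Gamma> B p f xs y"
    and unique: "\<And>y y'. y \<in> D \<Longrightarrow> y' \<in> D \<Longrightarrow> code_graph \<Gamma> B p f xs y \<Longrightarrow> code_graph \<Gamma> B p f xs y' \<Longrightarrow> (y, y') \<in> E"
    using wd xs len unfolding well_defined_def Let_def D E by blast+
  have compat: "code_graph \<Gamma> B p f us' v'"
    if "us \<in> lists D" "length us = arity f" "list_all2 (\<lambda>x x'. (x, x') \<in> E) us us'" "(v, v') \<in> E" "code_graph \<Gamma> B p f us v"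
    for us us' v v'
    using wd that unfolding well_defined_def Let_def D E by blast
  have refl_xs: "list_all2 (\<lambda>x x'. (x, x') \<in> E) xs xs"
    using xs E_iff by (auto simp: list_all2_same)
  define Xs where "Xs = map (\<lambda>x. E `` {x}) xs"
  have Xs: "Xs \<in> tuples (interp_struct \<Gamma> B p) (arity f)"
    using xs len by (auto simp: Xs_def tuples_def interp_struct_def D E intro: quotientI)
  have hXs: "map h Xs = map \<mu> xs" using xs h(2) by (auto simp: Xs_def)
  have graph_val: "\<mu> v = interp A f (map \<mu> xs)" if v: "v \<in> D" and g: "code_graph \<Gamma> B p f xs v" for v
  proof -
    have "interp (interp_struct \<Gamma> B p) f Xs = E `` {v}"
    proof -
      have "(\<exists>xs'. list_all2 (\<in>) xs' Xs \<and> code_graph \<Gamma> B p f xs' w) \<longleftrightarrow> (v, w) \<in> E" if w: "w \<in> D" for w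
      proof
        assume "\<exists>xs'. list_all2 (\<in>) xs' Xs \<and> code_graph \<Gamma> B p f xs' w"
        then obtain xs' where xs': "list_all2 (\<in>) xs' Xs" "code_graph \<Gamma> B p f xs' w" by blast
        have rel: "list_all2 (\<lambda>x' x. (x, x') \<in> E) xs' xs"
          using xs'(1) by (simp add: Xs_def list.rel_map)
        then have "list_all2 (\<lambda>x' x. (x', x) \<in> E) xs' xs"
          by (rule list_all2_mono) (use equiv in \<open>auto simp: equiv_def sym_def\<close>)
        moreover have "xs' \<in> lists D"
          using rel by (induction rule: list_all2_induct) (auto simp: E_def D_def code_eqv_def)
        moreover have "length xs' = arity f" using rel len by (auto dest: list_all2_lengthD)
        moreover have "(w, w) \<in> E" using E_iff w by simp
        ultimately have "code_graph \<Gamma> B p f xs w" using compat xs'(2) by blast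
        with unique v g w show "(v, w) \<in> E" by blast
      next
        assume "(v, w) \<in> E"
        then have "code_graph \<Gamma> B p f xs w" using compat refl_xs xs len g by blast
        moreover have "list_all2 (\<in>) xs Xs"
          using xs E_iff by (auto simp: Xs_def list.rel_map list_all2_same)
        ultimately show "\<exists>xs'. list_all2 (\<in>) xs' Xs \<and> code_graph \<Gamma> B p f xs' w" by blast
      qed
      moreover have "(v, w) \<in> E \<Longrightarrow> w \<in> D" for w
        unfolding E_def D_def code_eqv_def by blast
      ultimately show ?thesis by (auto simp: interp_struct_def D)
    qed
    moreover have "h (interp (interp_struct \<Gamma> B p) f Xs) = interp A f (map h Xs)"
      using h(1) Xs by (simp add: is_iso_def)
    ultimately show ?thesis using h(2)[OF v] hXs by simp
  qed
  show "code_graph \<Gamma> B p f xs y \<longleftrightarrow> \<mu> y = interp A f (map \<mu> xs)"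
  proof
    assume eq: "\<mu> y = interp A f (map \<mu> xs)"
    obtain v where v: "v \<in> D" "code_graph \<Gamma> B p f xs v" using ex by blast
    then have "(v, y) \<in> E" using E_iff graph_val eq y by metis
    then show "code_graph \<Gamma> B p f xs y" using compat refl_xs xs len v by blast
  qed (use graph_val y in blast)
qed

lemma coordinate_map_well_defined: "coordinate_map \<Gamma> B p A \<mu> \<Longrightarrow> well_defined \<Gamma> B p"
  and coordinate_map_isomorphic: "coordinate_map \<Gamma> B p A \<mu> \<Longrightarrow> isomorphic (interp_struct \<Gamma> B p) A"
  by (auto simp: coordinate_map_def isomorphic_def)

section \<open>Concatenating and cutting lists of blocks\<close>

lemma concat_concat_eq: "concat (concat xss) = concat (map concat xss)"
  by (induction xss) auto

lemma concat_nth_uniform: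
  "(\<And>x. x \<in> set xs \<Longrightarrow> length x = d) \<Longrightarrow> i < length xs \<Longrightarrow> j < d \<Longrightarrow>
    concat xs ! (d * i + j) = xs ! i ! j"
proof (induction xs arbitrary: i)
  case (Cons x xs)
  then show ?case by (cases i) (auto simp: nth_append add.assoc)
qed simp

lemma length_concat_uniform: "(\<And>x. x \<in> set xs \<Longrightarrow> length x = d) \<Longrightarrow> length (concat xs) = d * length xs"
  by (induction xs) auto

text \<open>Undoes \<open>concat\<close> on a list of \<open>n\<close> blocks of length
  \<open>d\<close>; coordinate maps of composite codes read their argument through it.\<close>

definition chunks :: "nat \<Rightarrow> nat \<Rightarrow> 'a list \<Rightarrow> 'a list list" where
  "chunks d n u = map (\<lambda>i. take d (drop (d * i) u)) [0..<n]"

lemma chunks_0 [simp]: "chunks d 0 u = []"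
  by (simp add: chunks_def)

lemma chunks_Suc: "chunks d (Suc n) u = take d u # chunks d n (drop d u)"
  unfolding chunks_def map_upt_Suc by (simp add: algebra_simps)

lemma length_chunks [simp]: "length (chunks d n u) = n"
  by (simp add: chunks_def)

lemma concat_chunks: "length u = d * n \<Longrightarrow> concat (chunks d n u) = u"
  by (induction n arbitrary: u) (auto simp: chunks_Suc)

lemma length_in_chunks: "length u = d * n \<Longrightarrow> x \<in> set (chunks d n u) \<Longrightarrow> length x = d"
proof (induction n arbitrary: u)
  case (Suc n)
  from Suc.IH[of "drop d u"] Suc.prems show ?case by (auto simp: chunks_Suc)
qed simp

lemma chunks_concat:
  "(\<And>x. x \<in> set xs \<Longrightarrow> length x = d) \<Longrightarrow> chunks d (length xs) (concat xs) = xs"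
  by (induction xs) (auto simp: chunks_Suc)

lemma chunks_one: "chunks (Suc 0) (length u) u = map (\<lambda>x. [x]) u"
  by (induction u) (auto simp: chunks_Suc)

lemma chunks_whole: "length u = d \<Longrightarrow> chunks d 1 u = [u]"
  by (simp add: chunks_def)

section \<open>Satisfaction of translated formulas\<close>

lemma sat_conj_list: "sat M e (conj_list \<phi>s) \<longleftrightarrow> (\<forall>\<phi>\<in>set \<phi>s. sat M e \<phi>)"
  by (induction \<phi>s) auto

lemma sat_Ex_funpow:
  "sat M e ((Ex ^^ d) \<phi>) \<longleftrightarrow> (\<exists>xs\<in>tuples M d. sat M (\<lambda>v. if v < d then xs ! v else e (v - d)) \<phi>)"
proof (induction d arbitrary: \<phi>)
  case 0
  then show ?case by (simp add: tuples_def)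
next
  case (Suc d)
  \<comment> \<open>\<open>funpow_Suc_right\<close> peels off the innermost quantifier, whose
    witness has index 0 and so goes to the front of the tuple.\<close>
  have env: "case_nat a (\<lambda>v. if v < d then xs ! v else e (v - d))
    = (\<lambda>v. if v < Suc d then (a # xs) ! v else e (v - Suc d))" for a xs
    by (auto simp: fun_eq_iff split: nat.splits)
  have "(\<exists>xs\<in>tuples M d. \<exists>a\<in>univ M. Q (a # xs)) \<longleftrightarrow> (\<exists>ys\<in>tuples M (Suc d). Q ys)" for Q
    by (auto simp: tuples_def length_Suc_conv) (metis list.set_intros insert_subset list.simps(15))+
  from this[of "\<lambda>ys. sat M (\<lambda>v. if v < Suc d then ys ! v else e (v - Suc d)) \<phi>"]
  show ?case by (simp only: funpow_Suc_right comp_def Suc sat.simps env)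
qed

definition block :: "('f, 'g) code \<Rightarrow> (nat \<Rightarrow> 'a) \<Rightarrow> nat \<Rightarrow> 'a list" where
  "block \<Delta> e i = map (\<lambda>j. e (cpar \<Delta> + cdim \<Delta> * i + j)) [0..<cdim \<Delta>]"

text \<open>The assignment under which the body of \<open>ex_block\<close> is evaluated:
  \<open>x\<close> enters as block 0 behind the untouched parameters.\<close>

definition push :: "('f, 'g) code \<Rightarrow> 'a list \<Rightarrow> (nat \<Rightarrow> 'a) \<Rightarrow> nat \<Rightarrow> 'a" where
  "push \<Delta> x e v = (if v < cpar \<Delta> then e v
     else if v < cpar \<Delta> + cdim \<Delta> then x ! (v - cpar \<Delta>) else e (v - cdim \<Delta>))"

lemma length_block [simp]: "length (block \<Delta> e i) = cdim \<Delta>"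
  by (simp add: block_def)

lemma block_push:
  assumes "length x = cdim \<Delta>"
  shows "block \<Delta> (push \<Delta> x e) i = (case i of 0 \<Rightarrow> x | Suc j \<Rightarrow> block \<Delta> e j)"
  using assms by (auto simp: block_def push_def algebra_simps intro!: nth_equalityI split: nat.splits)

lemma push_par: "v < cpar \<Delta> \<Longrightarrow> push \<Delta> x e v = e v"
  by (simp add: push_def)

lemma block_pushes:
  assumes "\<And>y. y \<in> set ys \<Longrightarrow> length y = cdim \<Delta>"
  shows "block \<Delta> (foldr (push \<Delta>) ys e) i =
    (if i < length ys then ys ! i else block \<Delta> e (i - length ys))"
  using assms by (induction ys arbitrary: i) (auto simp: block_push split: nat.splits)

lemma pushes_par: "v < cpar \<Delta> \<Longrightarrow> foldr (push \<Delta>) ys e v = e v"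
  by (induction ys) (auto simp: push_par)

lemma map_env_blocks:
  "map e [cpar \<Delta>..<cpar \<Delta> + cdim \<Delta> * n] = concat (map (block \<Delta> e) [0..<n])"
proof (induction n)
  case (Suc n)
  have "map e [cpar \<Delta> + cdim \<Delta> * n..<cpar \<Delta> + cdim \<Delta> * n + cdim \<Delta>] = block \<Delta> e n"
    by (auto simp: block_def intro!: nth_equalityI)
  moreover have "[cpar \<Delta>..<cpar \<Delta> + cdim \<Delta> * Suc n] =
    [cpar \<Delta>..<cpar \<Delta> + cdim \<Delta> * n] @ [cpar \<Delta> + cdim \<Delta> * n..<cpar \<Delta> + cdim \<Delta> * n + cdim \<Delta>]"
    using upt_add_eq_append[of "cpar \<Delta>" "cpar \<Delta> + cdim \<Delta> * n" "cdim \<Delta>"] by (simp add: ac_simps)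
  ultimately show ?case using Suc by simp
qed simp

lemma block_concat:
  assumes "length p = cpar \<Delta>" "\<And>x. x \<in> set xs \<Longrightarrow> length x = cdim \<Delta>" "i < length xs"
  shows "block \<Delta> ((!) (p @ concat xs)) i = xs ! i"
proof (rule nth_equalityI)
  fix j assume "j < length (block \<Delta> ((!) (p @ concat xs)) i)"
  then have j: "j < cdim \<Delta>" by simp
  then have "block \<Delta> ((!) (p @ concat xs)) i ! j = (p @ concat xs) ! (length p + (cdim \<Delta> * i + j))"
    using assms(1) by (simp add: block_def add.assoc)
  also have "\<dots> = xs ! i ! j"
    using concat_nth_uniform[of xs "cdim \<Delta>" i j] assms(2,3) j by (simp only: nth_append_length_plus)
  finally show "block \<Delta> ((!) (p @ concat xs)) i ! j = xs ! i ! j" .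
qed (use assms in simp)

text \<open>Hides the arithmetic with \<open>div\<close> and \<open>mod\<close> in
  \<open>on_blocks\<close>: afterwards an assignment is known only by its parameters and its
  blocks.\<close>

lemma sat_on_blocks:
  assumes "cdim \<Delta> > 0"
  obtains e' where "sat M e (on_blocks \<Delta> g \<phi>) \<longleftrightarrow> sat M e' \<phi>"
    "\<And>i. block \<Delta> e' i = block \<Delta> e (g i)" "\<And>v. v < cpar \<Delta> \<Longrightarrow> e' v = e v"
proof (rule that)
  show "sat M e (on_blocks \<Delta> g \<phi>) \<longleftrightarrow> sat M (e \<circ> (\<lambda>v. if v < cpar \<Delta> then v else
     cpar \<Delta> + cdim \<Delta> * g ((v - cpar \<Delta>) div cdim \<Delta>) + (v - cpar \<Delta>) mod cdim \<Delta>)) \<phi>"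
    unfolding on_blocks_def by (rule sat_rename)
qed (use assms in \<open>auto simp: block_def add.assoc\<close>)

locale code_in_struct =
  fixes \<Delta> :: "('f::language, 'g::language) code" and C :: "('g, 'c) struct" and p :: "'c list"
    and B :: "('f, 'b) struct" and \<mu> :: "'c list \<Rightarrow> 'b"
  assumes wf: "wf_code \<Delta>" and coord: "coordinate_map \<Delta> C p B \<mu>"
    and closed: "closed_struct B" and len_p: "length p = cpar \<Delta>"
begin

abbreviation "D \<equiv> code_dom \<Delta> C p"

definition agrees :: "(nat \<Rightarrow> 'c) \<Rightarrow> bool" where
  "agrees e \<longleftrightarrow> (\<forall>v<cpar \<Delta>. e v = p ! v)"

lemma cdim_pos: "cdim \<Delta> > 0"
  using wf by (simp add: wf_code_def)

lemma length_D: "x \<in> D \<Longrightarrow> length x = cdim \<Delta>"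
  by (simp add: code_dom_def tuples_def)

lemma sat_blocks:
  assumes "agrees e" "fm_in (cpar \<Delta> + cdim \<Delta> * n) \<phi>"
  shows "sat C e \<phi> \<longleftrightarrow> holds C \<phi> (p @ concat (map (block \<Delta> e) [0..<n]))"
proof -
  have "map e [0..<cpar \<Delta>] = p"
    using assms(1) len_p by (auto simp: agrees_def intro: nth_equalityI)
  then have "p @ concat (map (block \<Delta> e) [0..<n]) = map e [0..<cpar \<Delta> + cdim \<Delta> * n]"
    using upt_add_eq_append[of 0 "cpar \<Delta>" "cdim \<Delta> * n"] by (simp add: map_env_blocks)
  then show ?thesis
    unfolding holds_def by (simp only:) (rule sat_cong[OF assms(2)], simp)
qed

lemma sat_dom_block:
  assumes "agrees e"
  shows "sat C e (dom_block \<Delta> i) \<longleftrightarrow> holds C (cdom \<Delta>) (p @ block \<Delta> e i)"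
proof -
  obtain e' where e': "sat C e (dom_block \<Delta> i) \<longleftrightarrow> sat C e' (cdom \<Delta>)"
    "\<And>j. block \<Delta> e' j = block \<Delta> e i" "\<And>v. v < cpar \<Delta> \<Longrightarrow> e' v = e v"
    by (rule sat_on_blocks[OF cdim_pos, of C e "\<lambda>_. i" "cdom \<Delta>", folded dom_block_def]) (rule that)
  have "sat C e' (cdom \<Delta>) \<longleftrightarrow> holds C (cdom \<Delta>) (p @ concat (map (block \<Delta> e') [0..<1]))"
    by (rule sat_blocks) (use assms e'(3) wf in \<open>auto simp: agrees_def wf_code_def\<close>)
  then show ?thesis using e' by simp
qed

lemma sat_ex_block:
  assumes e: "agrees e"
  shows "sat C e (ex_block \<Delta> \<phi>) \<longleftrightarrow> (\<exists>x\<in>D. sat C (push \<Delta> x e) \<phi>)"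
proof -
  have "(\<lambda>v. if v < cdim \<Delta> then xs ! v else e (v - cdim \<Delta>)) \<circ>
      (\<lambda>v. if v < cpar \<Delta> then v + cdim \<Delta> else if v < cpar \<Delta> + cdim \<Delta> then v - cpar \<Delta> else v)
    = push \<Delta> xs e" for xs
    by (auto simp: push_def fun_eq_iff)
  then have "sat C e (ex_block \<Delta> \<phi>) \<longleftrightarrow>
    (\<exists>xs\<in>tuples C (cdim \<Delta>). sat C (push \<Delta> xs e) (And (dom_block \<Delta> 0) \<phi>))"
    unfolding ex_block_def sat_Ex_funpow sat_rename by simp
  also have "\<dots> \<longleftrightarrow> (\<exists>xs\<in>tuples C (cdim \<Delta>). holds C (cdom \<Delta>) (p @ xs) \<and> sat C (push \<Delta> xs e) \<phi>)"
  proof (rule bex_cong[OF refl])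
    fix xs assume "xs \<in> tuples C (cdim \<Delta>)"
    then have "block \<Delta> (push \<Delta> xs e) 0 = xs" by (simp add: block_push tuples_def)
    moreover have "agrees (push \<Delta> xs e)" using e by (simp add: agrees_def push_par)
    ultimately show "sat C (push \<Delta> xs e) (And (dom_block \<Delta> 0) \<phi>) \<longleftrightarrow>
      holds C (cdom \<Delta>) (p @ xs) \<and> sat C (push \<Delta> xs e) \<phi>"
      by (simp add: sat_dom_block)
  qed
  finally show ?thesis by (auto simp: code_dom_def)
qed

lemma sat_ex_blocks:
  assumes e: "agrees e"
  shows "sat C e ((ex_block \<Delta> ^^ k) \<phi>) \<longleftrightarrow>
    (\<exists>ys\<in>lists D. length ys = k \<and> sat C (foldr (push \<Delta>) ys e) \<phi>)"
proof (induction k arbitrary: \<phi>)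
  case 0
  then show ?case by simp
next
  case (Suc k)
  have "agrees (foldr (push \<Delta>) ys e)" for ys
    using e by (simp add: agrees_def pushes_par)
  then have "sat C e ((ex_block \<Delta> ^^ Suc k) \<phi>) \<longleftrightarrow>
    (\<exists>ys\<in>lists D. length ys = k \<and> (\<exists>y\<in>D. sat C (push \<Delta> y (foldr (push \<Delta>) ys e)) \<phi>))"
    by (simp only: funpow_Suc_right comp_def Suc sat_ex_block)
  also have "\<dots> \<longleftrightarrow> (\<exists>ys\<in>lists D. length ys = Suc k \<and> sat C (foldr (push \<Delta>) ys e) \<phi>)"
  proof
    assume "\<exists>ys\<in>lists D. length ys = k \<and> (\<exists>y\<in>D. sat C (push \<Delta> y (foldr (push \<Delta>) ys e)) \<phi>)"
    then obtain ys y where "ys \<in> lists D" "length ys = k" "y \<in> D"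
      "sat C (push \<Delta> y (foldr (push \<Delta>) ys e)) \<phi>" by blast
    then show "\<exists>zs\<in>lists D. length zs = Suc k \<and> sat C (foldr (push \<Delta>) zs e) \<phi>"
      by (intro bexI[of _ "y # ys"]) auto
  next
    assume "\<exists>zs\<in>lists D. length zs = Suc k \<and> sat C (foldr (push \<Delta>) zs e) \<phi>"
    then obtain zs where "zs \<in> lists D" "length zs = Suc k" "sat C (foldr (push \<Delta>) zs e) \<phi>" by blast
    then show "\<exists>ys\<in>lists D. length ys = k \<and> (\<exists>y\<in>D. sat C (push \<Delta> y (foldr (push \<Delta>) ys e)) \<phi>)"
      by (cases zs) auto
  qed
  finally show ?case .
qed

text \<open>The graph formulas see argument blocks only through \<open>\<mu>\<close>, so any
  representatives of the argument values will do; they exist because \<open>\<mu>\<close> is onto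
  and \<open>B\<close> is closed under its operations.\<close>

lemma sat_tr_tm:
  "tm_in n t \<Longrightarrow> agrees e \<Longrightarrow> block \<Delta> e 0 \<in> D \<Longrightarrow> (\<And>i. i < n \<Longrightarrow> block \<Delta> e (Suc i) \<in> D) \<Longrightarrow>
    sat C e (tr_tm \<Delta> t) \<longleftrightarrow> \<mu> (block \<Delta> e 0) = eval_tm B (\<lambda>i. \<mu> (block \<Delta> e (Suc i))) t"
proof (induction t arbitrary: e)
  case (Var i)
  obtain e' where e': "sat C e (tr_tm \<Delta> (Var i)) \<longleftrightarrow> sat C e' (ceqv \<Delta>)"
    "\<And>b. block \<Delta> e' b = block \<Delta> e (if b = 0 then Suc i else 0)" "\<And>v. v < cpar \<Delta> \<Longrightarrow> e' v = e v"
    by (rule sat_on_blocks[OF cdim_pos, of C e "\<lambda>b. if b = 0 then Suc i else 0" "ceqv \<Delta>",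
          folded tr_tm.simps]) (rule that)
  have "sat C e' (ceqv \<Delta>) \<longleftrightarrow> holds C (ceqv \<Delta>) (p @ concat (map (block \<Delta> e') [0..<2]))"
    by (rule sat_blocks) (use Var e'(3) wf in \<open>auto simp: agrees_def wf_code_def\<close>)
  also have "\<dots> \<longleftrightarrow> \<mu> (block \<Delta> e (Suc i)) = \<mu> (block \<Delta> e 0)"
    using coordinate_map_eqv[OF coord, of "block \<Delta> e (Suc i)" "block \<Delta> e 0"] Var
    by (simp add: numeral_2_eq_2 e')
  finally show ?case using e'(1) by auto
next
  case (Fun f ts)
  define k where "k = length ts"
  define E where "E = (\<lambda>i. \<mu> (block \<Delta> e (Suc i)))"
  have k: "k = arity f" and ts: "\<And>i. i < k \<Longrightarrow> tm_in n (ts ! i)"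
    using Fun.prems(1) by (auto simp: k_def list_all_iff)
  have univ: "\<mu> x \<in> univ B" if "x \<in> D" for x
    using coordinate_map_surj[OF coord] that by blast
  have E: "eval_tm B E (ts ! i) \<in> univ B" if "i < k" for i
    by (rule eval_tm_in_univ[OF closed ts[OF that]]) (use Fun.prems(4) univ in \<open>simp add: E_def\<close>)
  have step: "sat C (foldr (push \<Delta>) ys e)
      (And (conj_list (map (\<lambda>(i, \<phi>). on_blocks \<Delta> (case_nat i (\<lambda>b. Suc k + b)) \<phi>)
         (List.enumerate 0 (map (tr_tm \<Delta>) ts)))) (cop \<Delta> f)) \<longleftrightarrow>
      (\<forall>i<k. \<mu> (ys ! i) = eval_tm B E (ts ! i)) \<and> \<mu> (block \<Delta> e 0) = interp B f (map \<mu> ys)"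
    if ys: "ys \<in> lists D" "length ys = k" for ys
  proof -
    define e1 where "e1 = foldr (push \<Delta>) ys e"
    have len: "\<And>y. y \<in> set ys \<Longrightarrow> length y = cdim \<Delta>" using ys length_D by blast
    have e1: "agrees e1" using Fun.prems(2) by (simp add: agrees_def pushes_par e1_def)
    have blk: "block \<Delta> e1 i = (if i < k then ys ! i else block \<Delta> e (i - k))" for i
      unfolding e1_def using block_pushes[of ys \<Delta>, OF len] ys(2) by simp
    have arg: "sat C e1 (on_blocks \<Delta> (case_nat i (\<lambda>b. Suc k + b)) (tr_tm \<Delta> (ts ! i))) \<longleftrightarrow>
        \<mu> (ys ! i) = eval_tm B E (ts ! i)" if i: "i < k" for i
    proof -
      obtain e' where e': "sat C e1 (on_blocks \<Delta> (case_nat i (\<lambda>b. Suc k + b)) (tr_tm \<Delta> (ts ! i))) \<longleftrightarrow>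
          sat C e' (tr_tm \<Delta> (ts ! i))"
        "\<And>b. block \<Delta> e' b = block \<Delta> e1 (case_nat i (\<lambda>b. Suc k + b) b)" "\<And>v. v < cpar \<Delta> \<Longrightarrow> e' v = e1 v"
        by (rule sat_on_blocks[OF cdim_pos]) (rule that)
      have b0: "block \<Delta> e' 0 = ys ! i" and bS: "\<And>b. block \<Delta> e' (Suc b) = block \<Delta> e (Suc b)"
        using i by (simp_all add: e'(2) blk Suc_diff_le)
      have "sat C e' (tr_tm \<Delta> (ts ! i)) \<longleftrightarrow>
        \<mu> (block \<Delta> e' 0) = eval_tm B (\<lambda>i. \<mu> (block \<Delta> e' (Suc i))) (ts ! i)"
      proof (rule Fun.IH)
        show "ts ! i \<in> set ts" using i by (simp add: k_def)
        show "agrees e'" using e1 e'(3) by (simp add: agrees_def)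
        show "block \<Delta> e' 0 \<in> D" using b0 ys i by auto
      qed (use ts i bS Fun.prems(4) in auto)
      then show ?thesis using e'(1) b0 bS by (simp add: E_def)
    qed
    have "sat C e1 (conj_list (map (\<lambda>(i, \<phi>). on_blocks \<Delta> (case_nat i (\<lambda>b. Suc k + b)) \<phi>)
         (List.enumerate 0 (map (tr_tm \<Delta>) ts)))) \<longleftrightarrow>
       (\<forall>i<k. sat C e1 (on_blocks \<Delta> (case_nat i (\<lambda>b. Suc k + b)) (tr_tm \<Delta> (ts ! i))))"
    proof -
      have "map (\<lambda>(i, \<phi>). on_blocks \<Delta> (case_nat i (\<lambda>b. Suc k + b)) \<phi>)
          (List.enumerate 0 (map (tr_tm \<Delta>) ts)) =
        map (\<lambda>i. on_blocks \<Delta> (case_nat i (\<lambda>b. Suc k + b)) (tr_tm \<Delta> (ts ! i))) [0..<k]"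
        by (auto simp: enumerate_eq_zip k_def intro!: nth_equalityI)
      then show ?thesis by (auto simp: sat_conj_list)
    qed
    also have "\<dots> \<longleftrightarrow> (\<forall>i<k. \<mu> (ys ! i) = eval_tm B E (ts ! i))" using arg by simp
    finally have args: "sat C e1 (conj_list (map (\<lambda>(i, \<phi>). on_blocks \<Delta> (case_nat i (\<lambda>b. Suc k + b)) \<phi>)
         (List.enumerate 0 (map (tr_tm \<Delta>) ts)))) \<longleftrightarrow> (\<forall>i<k. \<mu> (ys ! i) = eval_tm B E (ts ! i))" .
    have "map (block \<Delta> e1) [0..<Suc k] = ys @ [block \<Delta> e 0]"
      using ys(2) by (auto simp: blk intro!: nth_equalityI)
    then have "sat C e1 (cop \<Delta> f) \<longleftrightarrow> code_graph \<Delta> C p f ys (block \<Delta> e 0)"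
      using sat_blocks[OF e1, of "Suc k" "cop \<Delta> f"] wf k
      by (simp add: wf_code_def code_graph_def del: upt_Suc)
    also have "\<dots> \<longleftrightarrow> \<mu> (block \<Delta> e 0) = interp B f (map \<mu> ys)"
      using coordinate_map_graph[OF coord, of ys f "block \<Delta> e 0"] ys k Fun.prems(3) by auto
    finally show ?thesis using args unfolding e1_def[symmetric] by simp
  qed
  have "sat C e (tr_tm \<Delta> (Fun f ts)) \<longleftrightarrow> (\<exists>ys\<in>lists D. length ys = k \<and>
      (\<forall>i<k. \<mu> (ys ! i) = eval_tm B E (ts ! i)) \<and> \<mu> (block \<Delta> e 0) = interp B f (map \<mu> ys))"
    unfolding tr_tm.simps Let_def k_def[symmetric] sat_ex_blocks[OF Fun.prems(2)]
    using step by blast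
  also have "\<dots> \<longleftrightarrow> \<mu> (block \<Delta> e 0) = interp B f (map (eval_tm B E) ts)"
  proof
    assume "\<exists>ys\<in>lists D. length ys = k \<and>
      (\<forall>i<k. \<mu> (ys ! i) = eval_tm B E (ts ! i)) \<and> \<mu> (block \<Delta> e 0) = interp B f (map \<mu> ys)"
    then obtain ys where ys: "length ys = k" "\<forall>i<k. \<mu> (ys ! i) = eval_tm B E (ts ! i)"
      "\<mu> (block \<Delta> e 0) = interp B f (map \<mu> ys)" by blast
    then have "map \<mu> ys = map (eval_tm B E) ts" by (auto simp: k_def intro!: nth_equalityI)
    with ys(3) show "\<mu> (block \<Delta> e 0) = interp B f (map (eval_tm B E) ts)" by simp
  next
    assume eq: "\<mu> (block \<Delta> e 0) = interp B f (map (eval_tm B E) ts)"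
    have "\<forall>i. i < k \<longrightarrow> (\<exists>y\<in>D. \<mu> y = eval_tm B E (ts ! i))"
      using E coordinate_map_surj[OF coord] by (metis imageE)
    then obtain y where y: "\<And>i. i < k \<Longrightarrow> y i \<in> D \<and> \<mu> (y i) = eval_tm B E (ts ! i)" by metis
    have "map \<mu> (map y [0..<k]) = map (eval_tm B E) ts"
      using y by (auto simp: k_def intro!: nth_equalityI)
    with eq y show "\<exists>ys\<in>lists D. length ys = k \<and>
      (\<forall>i<k. \<mu> (ys ! i) = eval_tm B E (ts ! i)) \<and> \<mu> (block \<Delta> e 0) = interp B f (map \<mu> ys)"
      by (intro bexI[of _ "map y [0..<k]"]) auto
  qed
  finally show ?case by (simp add: E_def comp_def)
qed

text \<open>Quantifiers over representatives become quantifiers over \<open>B\<close> because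
  \<open>\<mu>\<close> is onto. An equation between terms is translated through a block that
  represents the common value, and such a block exists for the same reason.\<close>

lemma sat_tr:
  "fm_in n \<phi> \<Longrightarrow> agrees e \<Longrightarrow> (\<And>i. i < n \<Longrightarrow> block \<Delta> e i \<in> D) \<Longrightarrow>
    sat C e (tr \<Delta> \<phi>) \<longleftrightarrow> sat B (\<lambda>i. \<mu> (block \<Delta> e i)) \<phi>"
proof (induction \<phi> arbitrary: n e)
  case Truth
  then show ?case by simp
next
  case (Eq s t)
  let ?E = "\<lambda>i. \<mu> (block \<Delta> e i)"
  have univ: "\<mu> x \<in> univ B" if "x \<in> D" for x
    using coordinate_map_surj[OF coord] that by blast
  have "sat C (push \<Delta> x e) (And (tr_tm \<Delta> s) (tr_tm \<Delta> t)) \<longleftrightarrow>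
    \<mu> x = eval_tm B ?E s \<and> \<mu> x = eval_tm B ?E t" if x: "x \<in> D" for x
  proof -
    have 1: "agrees (push \<Delta> x e)" using Eq.prems(2) by (simp add: agrees_def push_par)
    have 2: "block \<Delta> (push \<Delta> x e) i = (case i of 0 \<Rightarrow> x | Suc j \<Rightarrow> block \<Delta> e j)" for i
      by (rule block_push[OF length_D[OF x]])
    have "sat C (push \<Delta> x e) (tr_tm \<Delta> u) \<longleftrightarrow> \<mu> x = eval_tm B ?E u" if "tm_in n u" for u
      using sat_tr_tm[OF that 1] Eq.prems(3) x by (simp add: 2)
    then show ?thesis using Eq.prems(1) by simp
  qed
  then have "sat C e (tr \<Delta> (Eq s t)) \<longleftrightarrow> (\<exists>x\<in>D. \<mu> x = eval_tm B ?E s \<and> \<mu> x = eval_tm B ?E t)"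
    by (simp add: sat_ex_block[OF Eq.prems(2)] cong: bex_cong)
  also have "\<dots> \<longleftrightarrow> eval_tm B ?E s = eval_tm B ?E t"
  proof -
    have "eval_tm B ?E s \<in> univ B"
      by (rule eval_tm_in_univ[OF closed, of n]) (use Eq.prems univ in auto)
    then obtain x where "x \<in> D" "\<mu> x = eval_tm B ?E s" using coordinate_map_surj[OF coord] by force
    then show ?thesis by auto
  qed
  finally show ?case by simp
next
  case (Neg \<phi>)
  from Neg.IH[of n e] Neg.prems show ?case by simp
next
  case (And \<phi> \<chi>)
  from And.IH(1)[of n e] And.IH(2)[of n e] And.prems show ?case by simp
next
  case (Ex \<phi>)
  have "sat C (push \<Delta> x e) (tr \<Delta> \<phi>) \<longleftrightarrow> sat B (case_nat (\<mu> x) (\<lambda>i. \<mu> (block \<Delta> e i))) \<phi>"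
    if x: "x \<in> D" for x
  proof -
    have blk: "block \<Delta> (push \<Delta> x e) i = (case i of 0 \<Rightarrow> x | Suc j \<Rightarrow> block \<Delta> e j)" for i
      by (rule block_push[OF length_D[OF x]])
    have "sat C (push \<Delta> x e) (tr \<Delta> \<phi>) \<longleftrightarrow> sat B (\<lambda>i. \<mu> (block \<Delta> (push \<Delta> x e) i)) \<phi>"
    proof (rule Ex.IH[of "Suc n"])
      show "agrees (push \<Delta> x e)" using Ex.prems(2) by (simp add: agrees_def push_par)
      show "block \<Delta> (push \<Delta> x e) i \<in> D" if "i < Suc n" for i
        using that x Ex.prems(3) by (auto simp: blk split: nat.splits)
    qed (use Ex.prems in simp)
    also have "(\<lambda>i. \<mu> (block \<Delta> (push \<Delta> x e) i)) = case_nat (\<mu> x) (\<lambda>i. \<mu> (block \<Delta> e i))"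
      by (auto simp: fun_eq_iff blk split: nat.splits)
    finally show ?thesis .
  qed
  then have "sat C e (tr \<Delta> (Ex \<phi>)) \<longleftrightarrow> (\<exists>x\<in>D. sat B (case_nat (\<mu> x) (\<lambda>i. \<mu> (block \<Delta> e i))) \<phi>)"
    by (simp add: sat_ex_block[OF Ex.prems(2)] cong: bex_cong)
  also have "\<dots> \<longleftrightarrow> sat B (\<lambda>i. \<mu> (block \<Delta> e i)) (Ex \<phi>)"
    unfolding sat.simps coordinate_map_surj[OF coord, symmetric] by auto
  finally show ?case .
qed

section \<open>Translated formulas at concrete tuples, and composite codes\<close>

lemma agrees_append: "agrees ((!) (p @ xs))"
  by (simp add: agrees_def nth_append len_p)

lemma holds_tr:
  assumes "fm_in (length xs) \<phi>" "xs \<in> lists D"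
  shows "holds C (tr \<Delta> \<phi>) (p @ concat xs) \<longleftrightarrow> holds B \<phi> (map \<mu> xs)"
proof -
  have blk: "block \<Delta> ((!) (p @ concat xs)) i = xs ! i" if "i < length xs" for i
    by (rule block_concat) (use assms length_D len_p that in auto)
  have "holds C (tr \<Delta> \<phi>) (p @ concat xs) \<longleftrightarrow>
    sat B (\<lambda>i. \<mu> (block \<Delta> ((!) (p @ concat xs)) i)) \<phi>"
    unfolding holds_def by (rule sat_tr[OF assms(1) agrees_append]) (use assms(2) blk in auto)
  also have "\<dots> \<longleftrightarrow> holds B \<phi> (map \<mu> xs)"
    unfolding holds_def by (rule sat_cong[OF assms(1)]) (simp add: blk)
  finally show ?thesis .
qed

lemma holds_dom_block:
  assumes "i < length xs" "\<And>x. x \<in> set xs \<Longrightarrow> length x = cdim \<Delta>"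
  shows "holds C (dom_block \<Delta> i) (p @ concat xs) \<longleftrightarrow> holds C (cdom \<Delta>) (p @ xs ! i)"
  unfolding holds_def sat_dom_block[OF agrees_append]
  using block_concat[of p \<Delta> xs i] assms len_p by simp

lemma blocks_in_D:
  assumes "u \<in> tuples C (cdim \<Delta> * n)"
    "\<And>i. i < n \<Longrightarrow> holds C (cdom \<Delta>) (p @ chunks (cdim \<Delta>) n u ! i)"
  shows "chunks (cdim \<Delta>) n u \<in> lists D"
proof -
  have "x \<in> D" if x: "x \<in> set (chunks (cdim \<Delta>) n u)" for x
  proof -
    obtain i where "i < n" "x = chunks (cdim \<Delta>) n u ! i"
      using x by (metis in_set_conv_nth length_chunks)
    moreover have "length x = cdim \<Delta>" using x assms(1) length_in_chunks by (auto simp: tuples_def)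
    moreover have "set x \<subseteq> univ C"
      using x assms(1) by (auto simp: tuples_def chunks_def dest!: in_set_takeD in_set_dropD)
    ultimately show ?thesis using assms(2) by (auto simp: code_dom_def tuples_def)
  qed
  then show ?thesis by blast
qed

lemma concat_in_tuples: "xs \<in> lists D \<Longrightarrow> concat xs \<in> tuples C (cdim \<Delta> * length xs)"
  using length_concat_uniform[of xs "cdim \<Delta>"] length_D
  by (fastforce simp: tuples_def code_dom_def)

text \<open>\<open>holds_tr\<close> can be applied only to blocks known to lie in \<open>D\<close>.
  The conjuncts \<open>dom_block\<close> of the composite domain formula provide this, so they are
  evaluated before the translated part.\<close>

lemma code_dom_comp:
  fixes \<Gamma> :: "('h::language, 'f) code"
  assumes \<Gamma>: "wf_code \<Gamma>" and qs: "qs \<in> lists D" "length qs = cpar \<Gamma>"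
  shows "u \<in> code_dom (comp_code \<Gamma> \<Delta>) C (p @ concat qs) \<longleftrightarrow>
    (\<exists>ys\<in>lists D. u = concat ys \<and> map \<mu> ys \<in> code_dom \<Gamma> B (map \<mu> qs))"
proof
  assume "u \<in> code_dom (comp_code \<Gamma> \<Delta>) C (p @ concat qs)"
  then have u: "u \<in> tuples C (cdim \<Delta> * cdim \<Gamma>)"
    and dom: "\<And>i. i \<in> {cpar \<Gamma>..<cpar \<Gamma> + cdim \<Gamma>} \<Longrightarrow> holds C (dom_block \<Delta> i) (p @ concat qs @ u)"
    and tr: "holds C (tr \<Delta> (cdom \<Gamma>)) (p @ concat qs @ u)"
    by (auto simp: code_dom_def comp_code_def holds_def sat_conj_list mult.commute)
  define ys where "ys = chunks (cdim \<Delta>) (cdim \<Gamma>) u"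
  have u_eq: "u = concat ys" and len: "length ys = cdim \<Gamma>"
    using u concat_chunks[of u] by (auto simp: ys_def tuples_def)
  have lens: "\<And>x. x \<in> set (qs @ ys) \<Longrightarrow> length x = cdim \<Delta>"
    using qs(1) length_D u length_in_chunks[of u "cdim \<Delta>" "cdim \<Gamma>"] by (auto simp: ys_def tuples_def)
  have ys: "ys \<in> lists D"
    unfolding ys_def
  proof (rule blocks_in_D[OF u])
    fix i assume i: "i < cdim \<Gamma>"
    have "holds C (cdom \<Delta>) (p @ (qs @ ys) ! (cpar \<Gamma> + i))"
      using dom[of "cpar \<Gamma> + i"] i holds_dom_block[of "cpar \<Gamma> + i" "qs @ ys"] lens qs(2) len
      by (simp add: u_eq)
    then show "holds C (cdom \<Delta>) (p @ chunks (cdim \<Delta>) (cdim \<Gamma>) u ! i)"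
      using qs(2) by (simp add: nth_append ys_def)
  qed
  have "holds B (cdom \<Gamma>) (map \<mu> (qs @ ys))"
    using holds_tr[of "qs @ ys" "cdom \<Gamma>"] tr qs len ys \<Gamma> by (simp add: u_eq wf_code_def)
  moreover have "map \<mu> ys \<in> tuples B (cdim \<Gamma>)"
    using ys len coordinate_map_surj[OF coord] by (auto simp: tuples_def)
  ultimately show "\<exists>ys\<in>lists D. u = concat ys \<and> map \<mu> ys \<in> code_dom \<Gamma> B (map \<mu> qs)"
    using ys u_eq by (auto simp: code_dom_def)
next
  assume "\<exists>ys\<in>lists D. u = concat ys \<and> map \<mu> ys \<in> code_dom \<Gamma> B (map \<mu> qs)"
  then obtain ys where ys: "ys \<in> lists D" "u = concat ys" "map \<mu> ys \<in> code_dom \<Gamma> B (map \<mu> qs)"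
    by blast
  then have len: "length ys = cdim \<Gamma>" by (simp add: code_dom_def tuples_def)
  have "holds C (dom_block \<Delta> i) (p @ concat (qs @ ys))" if "i \<in> {cpar \<Gamma>..<cpar \<Gamma> + cdim \<Gamma>}" for i
  proof -
    have "i < length (qs @ ys)" using that qs(2) len by simp
    moreover from this have "(qs @ ys) ! i \<in> D"
      using qs ys by (metis append_in_lists_conv in_lists_conv_set nth_mem)
    ultimately show ?thesis
      using holds_dom_block[of i "qs @ ys"] qs(1) ys(1) length_D by (auto simp: code_dom_def)
  qed
  moreover have "holds C (tr \<Delta> (cdom \<Gamma>)) (p @ concat (qs @ ys))"
    using holds_tr[of "qs @ ys" "cdom \<Gamma>"] qs len ys \<Gamma> by (simp add: wf_code_def code_dom_def)
  moreover have "u \<in> tuples C (cdim \<Gamma> * cdim \<Delta>)"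
    using concat_in_tuples[OF ys(1)] ys(2) len by (simp add: mult.commute)
  ultimately show "u \<in> code_dom (comp_code \<Gamma> \<Delta>) C (p @ concat qs)"
    using ys(2) by (auto simp: code_dom_def comp_code_def holds_def sat_conj_list)
qed

text \<open>The two coordinate maps are applied one after the other, \<open>\<mu>\<close> to each
  block and \<open>\<nu>\<close> to the result. The equivalence and graph conditions of
  \<open>coordinate_mapI\<close> are moved by \<open>holds_tr\<close> from \<open>C\<close> to
  \<open>B\<close>, where they are properties of \<open>\<nu>\<close>.\<close>

lemma coordinate_map_comp:
  fixes \<Gamma> :: "('h::language, 'f) code"
  assumes \<Gamma>: "wf_code \<Gamma>" and qs: "qs \<in> lists D" "length qs = cpar \<Gamma>"
    and \<nu>: "coordinate_map \<Gamma> B (map \<mu> qs) A \<nu>" and A: "closed_struct A" "univ A \<noteq> {}"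
  shows "coordinate_map (comp_code \<Gamma> \<Delta>) C (p @ concat qs) A
    (\<lambda>u. \<nu> (map \<mu> (chunks (cdim \<Delta>) (cdim \<Gamma>) u)))"
proof -
  define D' where "D' = code_dom (comp_code \<Gamma> \<Delta>) C (p @ concat qs)"
  define Q where "Q = code_dom \<Gamma> B (map \<mu> qs)"
  define \<kappa> where "\<kappa> u = \<nu> (map \<mu> (chunks (cdim \<Delta>) (cdim \<Gamma>) u))" for u
  have D': "u \<in> D' \<longleftrightarrow> (\<exists>ys\<in>lists D. u = concat ys \<and> map \<mu> ys \<in> Q)" for u
    unfolding D'_def Q_def by (rule code_dom_comp[OF \<Gamma> qs])
  have len: "length ys = cdim \<Gamma>" if "map \<mu> ys \<in> Q" for ys
    using that by (simp add: Q_def code_dom_def tuples_def)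
  have \<kappa>: "\<kappa> (concat ys) = \<nu> (map \<mu> ys)" if "ys \<in> lists D" "map \<mu> ys \<in> Q" for ys
    using chunks_concat[of ys "cdim \<Delta>"] len that length_D by (auto simp: \<kappa>_def)
  have "coordinate_map (comp_code \<Gamma> \<Delta>) C (p @ concat qs) A \<kappa>"
  proof (rule coordinate_mapI[OF A], unfold D'_def[symmetric])
    have "\<kappa> ` D' = \<nu> ` Q"
    proof
      show "\<kappa> ` D' \<subseteq> \<nu> ` Q" using D' \<kappa> by fastforce
      show "\<nu> ` Q \<subseteq> \<kappa> ` D'"
      proof
        fix a assume "a \<in> \<nu> ` Q"
        then obtain zs where zs: "zs \<in> Q" "a = \<nu> zs" by blast
        then have "set zs \<subseteq> \<mu> ` D"
          using coordinate_map_surj[OF coord] by (simp add: Q_def code_dom_def tuples_def)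
        then have "\<exists>ys\<in>lists D. map \<mu> ys = zs"
          by (metis image_eqI lists_image in_lists_conv_set imageE subset_iff)
        then show "a \<in> \<kappa> ` D'" using zs D' \<kappa> by (metis image_eqI)
      qed
    qed
    then show "\<kappa> ` D' = univ A" using coordinate_map_surj[OF \<nu>] by (simp add: Q_def)
  next
    fix x y assume "x \<in> D'" "y \<in> D'"
    then obtain xs ys where xy: "xs \<in> lists D" "x = concat xs" "map \<mu> xs \<in> Q"
        "ys \<in> lists D" "y = concat ys" "map \<mu> ys \<in> Q"
      by (auto simp: D')
    have "fm_in (length (qs @ xs @ ys)) (ceqv \<Gamma>)"
      using \<Gamma> qs len xy by (simp add: wf_code_def mult_2_right)
    then have "holds C (tr \<Delta> (ceqv \<Gamma>)) (p @ concat (qs @ xs @ ys)) \<longleftrightarrow>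
      holds B (ceqv \<Gamma>) (map \<mu> (qs @ xs @ ys))"
      by (rule holds_tr) (use qs xy in simp)
    also have "\<dots> \<longleftrightarrow> \<nu> (map \<mu> xs) = \<nu> (map \<mu> ys)"
      using coordinate_map_eqv[OF \<nu>, of "map \<mu> xs" "map \<mu> ys"] xy by (simp add: Q_def)
    finally show "holds C (ceqv (comp_code \<Gamma> \<Delta>)) ((p @ concat qs) @ x @ y) \<longleftrightarrow> \<kappa> x = \<kappa> y"
      using xy by (simp add: comp_code_def \<kappa>)
  next
    fix f :: 'h and xs y assume xs: "xs \<in> lists D'" "length xs = arity f" and "y \<in> D'"
    then obtain ys where y: "ys \<in> lists D" "y = concat ys" "map \<mu> ys \<in> Q" by (auto simp: D')
    \<comment> \<open>Each argument is itself a concatenation of blocks from \<open>D\<close>; the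
      decompositions are collected argument by argument.\<close>
    have "\<exists>xss. xss \<in> lists (lists D) \<and> map concat xss = xs \<and> map (map \<mu>) xss \<in> lists Q"
      using xs(1)
    proof (induction xs)
      case (Cons x xs)
      then obtain xss where xss: "xss \<in> lists (lists D)" "map concat xss = xs" "map (map \<mu>) xss \<in> lists Q"
        by auto
      obtain z where "z \<in> lists D" "x = concat z" "map \<mu> z \<in> Q" using Cons.hyps by (auto simp: D')
      with xss show ?case by (intro exI[of _ "z # xss"]) auto
    qed auto
    then obtain xss where xss: "xss \<in> lists (lists D)" "map concat xss = xs" "map (map \<mu>) xss \<in> lists Q"
      by blast
    have lxss: "length xss = arity f" using xss(2) xs(2) by auto
    have len_xss: "length (concat xss) = cdim \<Gamma> * arity f"
      using length_concat_uniform[of xss "cdim \<Gamma>"] xss(3) lxss len by auto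
    have \<kappa>_xs: "map \<kappa> xs = map \<nu> (map (map \<mu>) xss)"
      using xss by (auto simp: \<kappa>)
    have "fm_in (length (qs @ concat xss @ ys)) (cop \<Gamma> f)"
      using \<Gamma> qs len_xss len[OF y(3)] by (simp add: wf_code_def add.commute)
    then have "holds C (tr \<Delta> (cop \<Gamma> f)) (p @ concat (qs @ concat xss @ ys)) \<longleftrightarrow>
      holds B (cop \<Gamma> f) (map \<mu> (qs @ concat xss @ ys))"
    proof (rule holds_tr)
      have "concat xss \<in> lists D" using xss(1) by (induction xss) auto
      then show "qs @ concat xss @ ys \<in> lists D" using qs(1) y(1) by simp
    qed
    also have "\<dots> \<longleftrightarrow> code_graph \<Gamma> B (map \<mu> qs) f (map (map \<mu>) xss) (map \<mu> ys)"
      by (simp add: code_graph_def map_concat)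
    also have "\<dots> \<longleftrightarrow> \<nu> (map \<mu> ys) = interp A f (map \<nu> (map (map \<mu>) xss))"
      by (rule coordinate_map_graph[OF \<nu>]) (use xss y lxss in \<open>auto simp: Q_def\<close>)
    finally show "code_graph (comp_code \<Gamma> \<Delta>) C (p @ concat qs) f xs y \<longleftrightarrow>
      \<kappa> y = interp A f (map \<kappa> xs)"
      unfolding \<kappa>_xs unfolding xss(2)[symmetric] using y
      by (simp add: code_graph_def comp_code_def \<kappa> concat_concat_eq)
  qed
  then show ?thesis by (simp add: \<kappa>_def[abs_def])
qed

end

text \<open>The prefix \<open>p\<close> is shown to be admissible first, since the rest of the
  composite condition contains a translated formula, which \<open>holds_tr\<close> can evaluate only
  once \<open>\<Delta>\<close> has a coordinate map at \<open>p\<close>.\<close>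

lemma solutions_comp_param:
  fixes \<Delta> :: "('f::language, 'g::language) code" and \<Gamma> :: "('h::language, 'f) code"
  assumes \<Delta>: "wf_code \<Delta>" and \<psi>: "fm_in (cpar \<Delta>) \<psi>" and \<phi>: "fm_in (cpar \<Gamma>) \<phi>"
    and coord: "\<And>p. p \<in> solutions C (cpar \<Delta>) \<psi> \<Longrightarrow> coordinate_map \<Delta> C p B (\<mu> p)"
    and closed: "closed_struct B"
    and r: "r \<in> solutions C (cpar (comp_code \<Gamma> \<Delta>)) (comp_param \<Gamma> \<phi> \<Delta> \<psi>)"
  obtains p qs where "r = p @ concat qs" "p \<in> solutions C (cpar \<Delta>) \<psi>" "qs \<in> lists (code_dom \<Delta> C p)"
    "length qs = cpar \<Gamma>" "map (\<mu> p) qs \<in> solutions B (cpar \<Gamma>) \<phi>"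
proof -
  define p where "p = take (cpar \<Delta>) r"
  define q where "q = drop (cpar \<Delta>) r"
  define qs where "qs = chunks (cdim \<Delta>) (cpar \<Gamma>) q"
  have r_tup: "r \<in> tuples C (cpar \<Delta> + cdim \<Delta> * cpar \<Gamma>)" and r_holds: "holds C (comp_param \<Gamma> \<phi> \<Delta> \<psi>) r"
    using r by (auto simp: solutions_def comp_code_def)
  have len: "length p = cpar \<Delta>" using r_tup by (simp add: p_def tuples_def)
  have q: "q \<in> tuples C (cdim \<Delta> * cpar \<Gamma>)"
    using r_tup by (auto simp: q_def tuples_def dest: in_set_dropD)
  have len_q: "length q = cdim \<Delta> * cpar \<Gamma>" using q by (simp add: tuples_def)
  have qs: "q = concat qs" "length qs = cpar \<Gamma>" "\<And>x. x \<in> set qs \<Longrightarrow> length x = cdim \<Delta>"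
    unfolding qs_def using concat_chunks[OF len_q] length_in_chunks[OF len_q] by auto
  have r_eq: "r = p @ concat qs" by (simp add: qs(1)[symmetric] p_def q_def)
  have "holds C \<psi> p"
  proof -
    have "sat C ((!) r) \<psi> \<longleftrightarrow> sat C ((!) p) \<psi>"
      by (rule sat_cong[OF \<psi>]) (simp add: p_def)
    with r_holds show ?thesis by (simp add: holds_def comp_param_def)
  qed
  moreover have "p \<in> tuples C (cpar \<Delta>)"
    using r_tup len by (auto simp: p_def tuples_def dest: in_set_takeD)
  ultimately have p: "p \<in> solutions C (cpar \<Delta>) \<psi>" by (simp add: solutions_def)
  interpret code_in_struct \<Delta> C p B "\<mu> p"
    using \<Delta> coord[OF p] closed len by unfold_locales
  have "holds C (dom_block \<Delta> i) (p @ concat qs)" if "i < cpar \<Gamma>" for i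
    using r_holds that unfolding r_eq holds_def comp_param_def by (simp add: sat_conj_list)
  then have "holds C (cdom \<Delta>) (p @ qs ! i)" if "i < cpar \<Gamma>" for i
    using holds_dom_block[of i qs] qs(2,3) that by simp
  then have in_D: "qs \<in> lists D"
    unfolding qs_def by (intro blocks_in_D q)
  have "holds B \<phi> (map (\<mu> p) qs)"
    using holds_tr[of qs \<phi>] in_D \<phi> qs(2) r_holds by (simp add: holds_def comp_param_def r_eq)
  moreover have "map (\<mu> p) qs \<in> tuples B (cpar \<Gamma>)"
    using in_D qs(2) coordinate_map_surj[OF coord] by (auto simp: tuples_def)
  ultimately show ?thesis
    using that[OF r_eq p in_D qs(2)] by (simp add: solutions_def)
qed

subsection \<open>Arithmetic definable in the integers\<close>

text \<open>With a square denominator allowed, a prime is reached from a smaller multiple of it by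
  multiplicativity alone, without the descent of Lagrange's theorem.\<close>

definition rat_sum4sq :: "int \<Rightarrow> bool" where
  "rat_sum4sq x \<longleftrightarrow> (\<exists>y a b c d. y \<noteq> 0 \<and> y * y * x = a * a + b * b + c * c + d * d)"

lemma rat_sum4sqI: "y \<noteq> 0 \<Longrightarrow> y * y * x = a * a + b * b + c * c + d * d \<Longrightarrow> rat_sum4sq x"
  unfolding rat_sum4sq_def by blast

text \<open>Euler's four-square identity; the denominators multiply.\<close>

lemma rat_sum4sq_mult:
  assumes "rat_sum4sq x" "rat_sum4sq x'"
  shows "rat_sum4sq (x * x')"
proof -
  obtain y a b c d where y: "y \<noteq> 0" "y * y * x = a * a + b * b + c * c + d * d"
    using assms(1) unfolding rat_sum4sq_def by blast
  obtain y' a' b' c' d' where y': "y' \<noteq> 0" "y' * y' * x' = a' * a' + b' * b' + c' * c' + d' * d'"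
    using assms(2) unfolding rat_sum4sq_def by blast
  have "(y * y') * (y * y') * (x * x') = (y * y * x) * (y' * y' * x')"
    by (simp add: algebra_simps)
  also have "\<dots> = (a * a' + b * b' + c * c' + d * d') * (a * a' + b * b' + c * c' + d * d')
      + (a * b' - b * a' + c * d' - d * c') * (a * b' - b * a' + c * d' - d * c')
      + (a * c' - c * a' + d * b' - b * d') * (a * c' - c * a' + d * b' - b * d')
      + (a * d' - d * a' + b * c' - c * b') * (a * d' - d * a' + b * c' - c * b')"
    unfolding y(2) y'(2) by (simp add: algebra_simps)
  finally show ?thesis by (rule rat_sum4sqI[rotated]) (use y y' in simp)
qed

text \<open>Multiplying \<open>m * x\<close> by \<open>m\<close> turns the factor into a square,
  which the denominator absorbs.\<close>

lemma rat_sum4sq_cancel: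
  assumes "rat_sum4sq (m * x)" "rat_sum4sq m" "m \<noteq> 0"
  shows "rat_sum4sq x"
proof -
  obtain y a b c d where y: "y \<noteq> 0" "y * y * (m * x * m) = a * a + b * b + c * c + d * d"
    using rat_sum4sq_mult[OF assms(1,2)] unfolding rat_sum4sq_def by blast
  then have "(y * m) * (y * m) * x = a * a + b * b + c * c + d * d" by (simp add: algebra_simps)
  then show ?thesis by (rule rat_sum4sqI[rotated]) (use y(1) assms(3) in simp)
qed

text \<open>Pigeonhole: the \<open>h + 1\<close> values \<open>a\<^sup>2\<close> and the \<open>h + 1\<close> values \<open>-1 - b\<^sup>2\<close> cannot all differ modulo \<open>2 h + 1\<close>.\<close>

lemma prime_dvd_sum_two_squares_plus_one:
  fixes p h :: int
  assumes p: "prime p" and h: "p = 2 * h + 1"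
  obtains a b where "0 \<le> a" "a \<le> h" "0 \<le> b" "b \<le> h" "p dvd a * a + b * b + 1"
proof -
  have "h > 0" using prime_gt_1_int[OF p] h by simp
  have inj: "a = b" if "a \<in> {0..h}" "b \<in> {0..h}" "p dvd a * a - b * b" for a b
  proof -
    have "p dvd (a - b) * (a + b)" using that(3) by (simp add: algebra_simps)
    then consider "p dvd a - b" | "p dvd a + b" using p prime_dvd_mult_iff by blast
    then show ?thesis
    proof cases
      case 1
      have "\<not> a < b"
        using zdvd_imp_le[of p "b - a"] 1 that h \<open>h > 0\<close> by (auto simp: dvd_diff_commute[of _ a])
      moreover have "\<not> b < a" using zdvd_imp_le[of p "a - b"] 1 that h \<open>h > 0\<close> by auto
      ultimately show ?thesis by simp
    next
      case 2
      have "a + b = 0"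
      proof (rule ccontr)
        assume "a + b \<noteq> 0"
        then have "p \<le> a + b" using 2 that by (intro zdvd_imp_le) auto
        then show False using that h by simp
      qed
      then show ?thesis using that by simp
    qed
  qed
  let ?f = "\<lambda>a. (a * a) mod p" and ?g = "\<lambda>b. (- 1 - b * b) mod p"
  have "inj_on ?f {0..h}"
    by (rule inj_onI) (use inj in \<open>simp add: mod_eq_dvd_iff\<close>)
  moreover have "inj_on ?g {0..h}"
  proof (rule inj_onI)
    fix a b assume "a \<in> {0..h}" "b \<in> {0..h}" "?g a = ?g b"
    moreover from this(3) have "p dvd b * b - a * a" by (simp add: mod_eq_dvd_iff)
    ultimately show "a = b" using inj[of b a] by simp
  qed
  ultimately have "card (?f ` {0..h}) + card (?g ` {0..h}) = nat (p + 1)"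
    using h \<open>h > 0\<close> by (simp add: card_image)
  moreover have "p > 0" using h \<open>h > 0\<close> by simp
  then have "?f ` {0..h} \<union> ?g ` {0..h} \<subseteq> {0..<p}" by auto
  then have "card (?f ` {0..h} \<union> ?g ` {0..h}) \<le> nat p"
    using card_mono[of "{0..<p}"] by fastforce
  ultimately have "?f ` {0..h} \<inter> ?g ` {0..h} \<noteq> {}"
    using card_Un_disjoint[of "?f ` {0..h}" "?g ` {0..h}"] h \<open>h > 0\<close> by auto
  then obtain a b where ab: "a \<in> {0..h}" "b \<in> {0..h}" "?f a = ?g b" by blast
  then have "p dvd a * a + b * b + 1" by (simp add: mod_eq_dvd_iff algebra_simps)
  with ab show ?thesis by (intro that) auto
qed

lemma rat_sum4sq_of_nat: "rat_sum4sq (int n)"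
proof (induction n rule: less_induct)
  case (less n)
  consider "n \<le> 2" | "n > 2" "prime n" | "n > 2" "\<not> prime n" by linarith
  then show ?case
  proof cases
    case 1
    then have "n = 0 \<or> n = 1 \<or> n = 2" by linarith
    then show ?thesis
      using rat_sum4sqI[of 1 0 0 0 0 0] rat_sum4sqI[of 1 1 1 0 0 0] rat_sum4sqI[of 1 2 1 1 0 0] by auto
  next
    case 2
    then have "odd n" using prime_odd_nat by simp
    then obtain h where "n = 2 * h + 1" by (metis oddE)
    then have h: "int n = 2 * int h + 1" by simp
    obtain a b where ab: "0 \<le> a" "a \<le> int h" "0 \<le> b" "b \<le> int h" "int n dvd a * a + b * b + 1"
      using prime_dvd_sum_two_squares_plus_one[OF _ h] 2 by auto
    then obtain m where m: "a * a + b * b + 1 = m * int n" by (metis dvdE mult.commute)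
    have "m * int n > 0" using m by (metis add_nonneg_pos add_nonneg_nonneg zero_le_square zero_less_one)
    then have "m > 0" using 2 by (simp add: zero_less_mult_iff)
    \<comment> \<open>Since \<open>a\<close> and \<open>b\<close> are at most \<open>h\<close>, the
      multiple \<open>m * int n\<close> is at most \<open>2 h^2 + 1 < n^2\<close>. Hence
      \<open>m < n\<close>, and the induction hypothesis covers \<open>m\<close>.\<close>
    have "a * a \<le> int h * int h" "b * b \<le> int h * int h" using ab by (auto intro: mult_mono)
    moreover have "2 * (int h * int h) + 1 < int n * int n"
      using 2 \<open>n = 2 * h + 1\<close> unfolding h by (auto simp: algebra_simps intro!: add_pos_nonneg)
    ultimately have "m * int n < int n * int n" using m by linarith
    then have "m < int n" using 2 by simp
    then have "rat_sum4sq m" using less.IH[of "nat m"] \<open>m > 0\<close> by simp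
    moreover have "rat_sum4sq (m * int n)"
      by (rule rat_sum4sqI[of 1 _ a b 1 0]) (use m in auto)
    ultimately show ?thesis using rat_sum4sq_cancel \<open>m > 0\<close> by blast
  next
    case 3
    then obtain a where "a dvd n" "a \<noteq> 1" "a \<noteq> n" unfolding prime_nat_iff by auto
    then obtain b where n: "n = a * b" by blast
    moreover have "a > 1" "b > 1" using n \<open>a \<noteq> 1\<close> \<open>a \<noteq> n\<close> 3 by (cases "a = 0"; cases "b = 0"; cases "b = 1"; simp)+
    ultimately have "n = a * b" "a < n" "b < n" by simp_all
    then show ?thesis using less.IH rat_sum4sq_mult by (metis of_nat_mult)
  qed
qed

text \<open>This is what the sums of four squares are for: nonnegativity, and with it the order,
  becomes expressible by ring operations alone.\<close>

lemma rat_sum4sq_iff: "rat_sum4sq x \<longleftrightarrow> 0 \<le> x"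
proof
  assume "rat_sum4sq x"
  then obtain y a b c d where y: "y \<noteq> 0" "y * y * x = a * a + b * b + c * c + d * d"
    unfolding rat_sum4sq_def by blast
  then have "0 \<le> y * y * x" by simp
  moreover have "0 < y * y" using y(1) by (simp add: zero_less_mult_iff neq_iff disj_commute)
  ultimately show "0 \<le> x" by (simp add: zero_le_mult_iff)
qed (metis rat_sum4sq_of_nat nat_0_le)

text \<open>Goedel's beta function \<open>c mod (1 + (i + 1) * d)\<close>, written out with a
  quotient and inequalities because only ring operations and the order are available. Using
  \<open>i + 1\<close> keeps the modulus at position 0 from being 1.\<close>

definition beta :: "int \<Rightarrow> int \<Rightarrow> int \<Rightarrow> int \<Rightarrow> bool" where
  "beta c d i s \<longleftrightarrow> 0 \<le> s \<and> s < 1 + (i + 1) * d \<and> (\<exists>q. c = q * (1 + (i + 1) * d) + s)"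

lemma beta_nonneg: "beta c d i s \<Longrightarrow> 0 \<le> s"
  by (simp add: beta_def)

lemma beta_unique: "beta c d i s \<Longrightarrow> beta c d i t \<Longrightarrow> s = t"
proof -
  have "s = c mod (1 + (i + 1) * d)" if "beta c d i s" for s
    using that unfolding beta_def by auto
  then show "beta c d i s \<Longrightarrow> beta c d i t \<Longrightarrow> s = t" by metis
qed

text \<open>With a factorial as \<open>d\<close> the moduli exceed all admissible values and are
  pairwise coprime: a common divisor of two of them is coprime to \<open>d\<close> and divides a
  difference of positions, which in turn divides \<open>d\<close>. As \<open>d\<close> depends only
  on the bounds, one \<open>d\<close> serves several sequences.\<close>

lemma beta_exists:
  obtains d where "\<And>s. (\<And>i. i \<le> n \<Longrightarrow> 0 \<le> s i \<and> s i < b) \<Longrightarrow> \<exists>c. \<forall>i\<le>n. beta c d (int i) (s i)"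
proof -
  define d :: nat where "d = fact (n + nat b)"
  define m where "m i = Suc (Suc i * d)" for i
  have coprime_d: "coprime (m i) d" for i
  proof (rule coprimeI)
    fix g assume g: "g dvd m i" "g dvd d"
    then have "g dvd Suc i * d" by simp
    then show "is_unit g" using g(1) dvd_add_right_iff[of g "Suc i * d" 1] by (simp add: m_def)
  qed
  have "coprime (m i) (m j)" if "i < j" "j \<le> n" for i j
  proof (rule coprimeI)
    fix g assume g: "g dvd m i" "g dvd m j"
    have "m j = m i + (j - i) * d"
    proof -
      have "Suc j = Suc i + (j - i)" using \<open>i < j\<close> by simp
      then have "Suc j * d = Suc i * d + (j - i) * d" by (metis add_mult_distrib)
      then show ?thesis unfolding m_def by (simp del: mult_Suc)
    qed
    then have "g dvd m i + (j - i) * d" using g(2) by simp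
    then have "g dvd (j - i) * d" using dvd_add_right_iff[OF g(1)] by blast
    moreover have "coprime g d" by (rule coprime_divisors[OF g(1) dvd_refl coprime_d])
    ultimately have "g dvd j - i" by (simp add: coprime_dvd_mult_left_iff)
    also have "j - i dvd d" unfolding d_def using that by (intro dvd_fact) auto
    finally show "is_unit g" using \<open>coprime g d\<close> coprime_absorb_left by blast
  qed
  then have coprime: "\<forall>i\<in>{..n}. \<forall>j\<in>{..n}. i \<noteq> j \<longrightarrow> coprime (m i) (m j)"
    by (metis atMost_iff coprime_commute linorder_neqE_nat)
  have "\<exists>c. \<forall>i\<le>n. beta c (int d) (int i) (s i)" if s: "\<And>i. i \<le> n \<Longrightarrow> 0 \<le> s i \<and> s i < b" for s
  proof -
    obtain x where x: "\<forall>i\<in>{..n}. [x = nat (s i)] (mod m i)"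
      using chinese_remainder_nat[OF finite_atMost coprime, of "\<lambda>i. nat (s i)"] by blast
    have "beta (int x) (int d) (int i) (s i)" if i: "i \<le> n" for i
    proof -
      have m: "int (m i) = 1 + (int i + 1) * int d" by (simp add: m_def algebra_simps)
      have "nat (s i) < m i"
      proof -
        have "nat (s i) < nat b" using s[OF i] by simp
        also have "nat b \<le> n + nat b" by simp
        also have "\<dots> \<le> d" unfolding d_def by (rule fact_ge_self)
        also have "\<dots> < m i" by (simp add: m_def)
        finally show ?thesis .
      qed
      then have "x mod m i = nat (s i)" using x i by (simp add: cong_def)
      then have "int x mod int (m i) = s i" using s[OF i] by (metis int_nat_eq of_nat_mod)
      moreover have "int x = int x div int (m i) * int (m i) + int x mod int (m i)" by simp
      moreover have "s i < int (m i)" using \<open>nat (s i) < m i\<close> by linarith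
      ultimately show ?thesis using s[OF i] unfolding beta_def m[symmetric] by metis
    qed
    then show ?thesis by blast
  qed
  then show ?thesis by (rule that)
qed

text \<open>Two powers of 2 agree modulo \<open>m\<close> by pigeonhole, and the smaller one cancels
  since \<open>m\<close> is odd. \<open>m\<close> may be negative, hence the symmetric
  interval.\<close>

lemma odd_dvd_power_two_minus_one:
  fixes m :: int
  assumes "odd m"
  obtains n where "n > 0" "m dvd 2 ^ n - 1"
proof -
  have "m \<noteq> 0" using assms by auto
  have "range (\<lambda>i::nat. 2 ^ i mod m) \<subseteq> {- \<bar>m\<bar>..\<bar>m\<bar>}"
  proof safe
    fix i :: nat
    have "\<bar>2 ^ i mod m\<bar> < \<bar>m\<bar>" using \<open>m \<noteq> 0\<close> by (rule abs_mod_less)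
    then show "2 ^ i mod m \<in> {- \<bar>m\<bar>..\<bar>m\<bar>}" by auto
  qed
  then have "finite (range (\<lambda>i::nat. 2 ^ i mod m))" by (rule finite_subset) simp
  then have "\<not> inj (\<lambda>i::nat. 2 ^ i mod m)" using finite_imageD infinite_UNIV_nat by blast
  then obtain i j :: nat where ij: "i < j" "2 ^ i mod m = 2 ^ j mod m"
    unfolding inj_def by (metis linorder_neqE_nat)
  then have "m dvd 2 ^ j - 2 ^ i" by (metis mod_eq_dvd_iff)
  also have "2 ^ j - 2 ^ i = 2 ^ i * (2 ^ (j - i) - (1::int))"
    using ij(1) by (simp add: algebra_simps flip: power_add)
  finally have "m dvd 2 ^ i * (2 ^ (j - i) - 1)" .
  moreover have "coprime m (2 ^ i)" using assms by (simp add: coprime_commute)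
  ultimately have "m dvd 2 ^ (j - i) - 1" by (simp add: coprime_dvd_mult_right_iff)
  with ij(1) show ?thesis by (intro that[of "j - i"]) auto
qed

section \<open>Definability over the integers\<close>

abbreviation int_ring :: "(ring_sym, int) struct" where
  "int_ring \<equiv> ring_struct UNIV"

lemma closed_int_ring: "closed_struct int_ring"
  by (rule closed_ring_struct) (simp add: ring_closed_def)

lemma definable_apply1:
  assumes "closed_struct M" "definable M 1 (\<lambda>e. P (e 0))" "definable_fun M n t"
  shows "definable M n (\<lambda>e. P (t e))"
  using definable_apply[of M 1 "\<lambda>xs. P (xs ! 0)" n "\<lambda>e. [t e]"] assms
  by (simp add: definable_list_def)

lemma definable_apply4:
  assumes "closed_struct M" "definable M 4 (\<lambda>e. P (e 0) (e 1) (e 2) (e 3))"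
    "definable_fun M n s" "definable_fun M n t" "definable_fun M n u" "definable_fun M n v"
  shows "definable M n (\<lambda>e. P (s e) (t e) (u e) (v e))"
proof -
  have "definable_list M n 4 (\<lambda>e. [s e, t e, u e, v e])"
    using assms(3-6) by (auto simp: definable_list_def less_Suc_eq numeral_eq_Suc)
  moreover have "definable M 4 (\<lambda>e. P (map e [0..<4] ! 0) (map e [0..<4] ! 1) (map e [0..<4] ! 2) (map e [0..<4] ! 3))"
    using assms(2) by (simp add: numeral_2_eq_2)
  ultimately show ?thesis
    using definable_apply[of M 4 "\<lambda>xs. P (xs ! 0) (xs ! 1) (xs ! 2) (xs ! 3)" n "\<lambda>e. [s e, t e, u e, v e]"] assms(1)
    by simp
qed

lemma definable_nonneg_var: "definable int_ring 1 (\<lambda>e. 0 \<le> e 0)"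
  unfolding rat_sum4sq_iff[symmetric] rat_sum4sq_def
  by (intro definable_ex_UNIV definable_intros definable_fun_intros) simp_all

lemma definable_le:
  assumes "definable_fun int_ring n s" "definable_fun int_ring n t"
  shows "definable int_ring n (\<lambda>e. s e \<le> t e)"
proof -
  \<comment> \<open>Four variables rather than two, so that \<open>definable_apply4\<close> can be
    reused with each argument given twice.\<close>
  have "definable int_ring 4 (\<lambda>e. \<exists>z. 0 \<le> z \<and> e 1 = e 0 + z)"
    by (intro definable_ex_UNIV definable_intros definable_fun_intros
        definable_apply1[OF closed_int_ring definable_nonneg_var]) simp_all
  moreover have "(\<exists>z\<ge>0. y = x + z) \<longleftrightarrow> x \<le> y" for x y :: int
    by (metis diff_add_cancel add.commute add_increasing2 diff_ge_0_iff_ge order_refl)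
  ultimately have "definable int_ring 4 (\<lambda>e. e 0 \<le> e 1)" by simp
  from definable_apply4[OF closed_int_ring, of "\<lambda>a b c d. a \<le> b", OF this assms assms] show ?thesis .
qed

lemma definable_less:
  assumes "definable_fun int_ring n s" "definable_fun int_ring n t"
  shows "definable int_ring n (\<lambda>e. s e < t e)"
  using definable_le[OF definable_fun_plus[OF assms(1) definable_fun_one] assms(2)]
  by (simp add: add1_zle_eq)

lemmas definable_int_intros =
  definable_ex_UNIV definable_all_UNIV definable_intros definable_fun_intros definable_le definable_less

lemma definable_beta:
  "definable_fun int_ring n s \<Longrightarrow> definable_fun int_ring n t \<Longrightarrow> definable_fun int_ring n u \<Longrightarrow>
    definable_fun int_ring n v \<Longrightarrow> definable int_ring n (\<lambda>e. beta (s e) (t e) (u e) (v e))"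
  by (rule definable_apply4[OF closed_int_ring])
    (unfold beta_def, (intro definable_int_intros; simp), assumption+)

text \<open>A program is a list \<open>[p, q, r, d, L]\<close>; step \<open>i\<close> computes \<open>x + y * z\<close> from the values at the
  positions stored in \<open>p, q, r\<close>, and the value at position \<open>L\<close> is the result. As \<open>beta\<close> stores only
  natural numbers, the values are shifted by \<open>b\<close>.\<close>

definition instr :: "int list \<Rightarrow> int \<Rightarrow> int \<Rightarrow> int \<Rightarrow> int \<Rightarrow> bool" where
  "instr u i a b c \<longleftrightarrow> beta (u ! 0) (u ! 3) i a \<and> beta (u ! 1) (u ! 3) i b \<and> beta (u ! 2) (u ! 3) i c \<and>
     a < i \<and> b < i \<and> c < i"

text \<open>Positions below \<open>k + 2\<close> hold the initial values, so instructions start at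
  \<open>k + 2\<close>; a result position \<open>u ! 4\<close> below that simply selects an initial
  value.\<close>

definition valid_code :: "nat \<Rightarrow> int list \<Rightarrow> bool" where
  "valid_code k u \<longleftrightarrow> 0 \<le> u ! 4 \<and>
     (\<forall>i. int (k + 2) \<le> i \<and> i \<le> u ! 4 \<longrightarrow> (\<exists>a b c. instr u i a b c))"

text \<open>\<open>w\<close> stands for -1, for which the language has no term. The initial values
  are required at all positions up to \<open>k + 1\<close>, even if the result position is smaller.
  The instruction clause can be universal in the operands because the values stored by
  \<open>beta\<close> are unique.\<close>

definition run :: "nat \<Rightarrow> int list \<Rightarrow> int list \<Rightarrow> int \<Rightarrow> bool" where
  "run k u as v \<longleftrightarrow> (\<exists>c d b.
     beta c d 0 (1 + b) \<and> (\<exists>w. w + 1 = 0 \<and> beta c d 1 (w + b)) \<and>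
     (\<forall>j<k. beta c d (int (j + 2)) (as ! j + b)) \<and>
     (\<forall>i. int (k + 2) \<le> i \<and> i \<le> u ! 4 \<longrightarrow> (\<forall>a1 a2 a3 x y z. instr u i a1 a2 a3 \<and>
        beta c d a1 (x + b) \<and> beta c d a2 (y + b) \<and> beta c d a3 (z + b) \<longrightarrow> beta c d i (x + y * z + b))) \<and>
     beta c d (u ! 4) (v + b))"

lemma definable_valid_code:
  assumes "definable_list int_ring n 5 u"
  shows "definable int_ring n (\<lambda>e. valid_code k (u e))"
proof -
  have "definable int_ring 5 (\<lambda>e. valid_code k (map e [0..<5]))"
    unfolding valid_code_def instr_def
    by (simp del: of_nat_add, intro definable_int_intros definable_beta; simp)
  then show ?thesis using assms by (rule definable_apply[OF closed_int_ring])
qed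

text \<open>\<open>run\<close> as a relation on one list, the form that
  \<open>definable_apply\<close> and the transfer to the polynomial ring by
  \<open>definable_of_int\<close> expect.\<close>

abbreviation run_list :: "nat \<Rightarrow> int list \<Rightarrow> bool" where
  "run_list k xs \<equiv> run k (take 5 xs) (take k (drop 5 xs)) (xs ! (5 + k))"

lemma definable_run_list:
  "definable int_ring (5 + (k + 1))
    (\<lambda>e. run_list k (map e [0..<5 + (k + 1)]))"
proof -
  have "definable int_ring (5 + (k + 1)) (\<lambda>e. run k (map e [0..<5]) (map e [5..<5 + k]) (e (5 + k)))"
    unfolding run_def instr_def
    by (simp del: of_nat_add, intro definable_int_intros definable_beta; simp)
  then show ?thesis by (simp add: take_map drop_map)
qed

lemma definable_list_run_args:
  "definable_list M n 5 u \<Longrightarrow> definable_list M n k as \<Longrightarrow> definable_fun M n v \<Longrightarrow>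
    definable_list M n (5 + (k + 1)) (\<lambda>e. u e @ as e @ [v e])"
  using definable_list_Cons[of M n v 0 "\<lambda>e. []"]
  by (intro definable_list_append) (simp_all add: definable_list_Nil)

lemma definable_run:
  assumes "definable_list int_ring n 5 u" "definable_list int_ring n k as" "definable_fun int_ring n v"
  shows "definable int_ring n (\<lambda>e. run k (u e) (as e) (v e))"
proof -
  have "definable int_ring n (\<lambda>e. run_list k (u e @ as e @ [v e]))"
    by (rule definable_apply[OF closed_int_ring definable_run_list definable_list_run_args[OF assms]])
  moreover have "length (u e) = 5" "length (as e) = k" for e
    using assms by (auto simp: definable_list_def)
  ultimately show ?thesis by (simp add: nth_append)
qed

subsection \<open>Integer polynomials and straight-line programs\<close>

type_synonym mpoly = "(nat \<Rightarrow>\<^sub>0 nat) \<Rightarrow>\<^sub>0 int"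

abbreviation "mpoly_ring k \<equiv> ring_struct (int_mpolys k)"
abbreviation "lookup \<equiv> Poly_Mapping.lookup"
abbreviation "keys \<equiv> Poly_Mapping.keys"
abbreviation "single \<equiv> Poly_Mapping.single"

definition indet :: "nat \<Rightarrow> mpoly" where
  "indet i = single (single i 1) 1"

definition eval_mon :: "(nat \<Rightarrow> 'a::comm_ring_1) \<Rightarrow> (nat \<Rightarrow>\<^sub>0 nat) \<Rightarrow> 'a" where
  "eval_mon a m = (\<Prod>i\<in>keys m. a i ^ lookup m i)"

text \<open>The target is an arbitrary commutative ring: \<open>int\<close> for integer points,
  \<open>mpoly\<close> for substituting generators, \<open>int poly\<close> for the Kronecker
  substitution.\<close>

definition peval :: "(nat \<Rightarrow> 'a::comm_ring_1) \<Rightarrow> mpoly \<Rightarrow> 'a" where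
  "peval a f = (\<Sum>m\<in>keys f. of_int (lookup f m) * eval_mon a m)"

lemma eval_mon_superset:
  "finite S \<Longrightarrow> keys m \<subseteq> S \<Longrightarrow> eval_mon a m = (\<Prod>i\<in>S. a i ^ lookup m i)"
  unfolding eval_mon_def by (rule prod.mono_neutral_left) (auto simp: in_keys_iff)

lemma peval_superset:
  "finite S \<Longrightarrow> keys f \<subseteq> S \<Longrightarrow> peval a f = (\<Sum>m\<in>S. of_int (lookup f m) * eval_mon a m)"
  unfolding peval_def by (rule sum.mono_neutral_left) (auto simp: in_keys_iff)

lemma eval_mon_0 [simp]: "eval_mon a 0 = 1"
  by (simp add: eval_mon_def)

lemma eval_mon_add: "eval_mon a (m + n) = eval_mon a m * eval_mon a n"
proof -
  let ?S = "keys m \<union> keys n"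
  have "keys (m + n) \<subseteq> ?S" by (rule Poly_Mapping.keys_add)
  then have "eval_mon a (m + n) = (\<Prod>i\<in>?S. a i ^ lookup (m + n) i)"
    by (intro eval_mon_superset) auto
  also have "\<dots> = (\<Prod>i\<in>?S. a i ^ lookup m i) * (\<Prod>i\<in>?S. a i ^ lookup n i)"
    by (simp add: lookup_add power_add prod.distrib)
  finally show ?thesis by (simp add: eval_mon_superset[of ?S])
qed

lemma peval_add: "peval a (f + g) = peval a f + peval a g"
proof -
  let ?S = "keys f \<union> keys g"
  have "keys (f + g) \<subseteq> ?S" by (rule Poly_Mapping.keys_add)
  then have "peval a (f + g) = (\<Sum>m\<in>?S. of_int (lookup (f + g) m) * eval_mon a m)"
    by (intro peval_superset) auto
  also have "\<dots> = peval a f + peval a g"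
    by (simp add: peval_superset[of ?S] lookup_add sum.distrib algebra_simps)
  finally show ?thesis .
qed

lemma peval_single: "peval a (single m c) = of_int c * eval_mon a m"
  by (simp add: peval_def)

lemma peval_0 [simp]: "peval a 0 = 0"
  by (simp add: peval_def)

lemma peval_sum: "peval a (\<Sum>x\<in>S. g x) = (\<Sum>x\<in>S. peval a (g x))"
  by (induction S rule: infinite_finite_induct) (auto simp: peval_add)

lemma poly_mapping_sum_single: "(\<Sum>m\<in>keys f. single m (lookup f m)) = f"
  by (rule poly_mapping_eqI) (auto simp: lookup_sum lookup_single when_def in_keys_iff)

lemma peval_mult: "peval a (f * g) = peval a f * peval a g"
proof -
  have "f * g = (\<Sum>m\<in>keys f. single m (lookup f m)) * (\<Sum>n\<in>keys g. single n (lookup g n))"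
    by (simp add: poly_mapping_sum_single)
  also have "\<dots> = (\<Sum>m\<in>keys f. \<Sum>n\<in>keys g. single (m + n) (lookup f m * lookup g n))"
    by (simp add: sum_product mult_single)
  finally have "peval a (f * g) = (\<Sum>m\<in>keys f. \<Sum>n\<in>keys g.
      of_int (lookup f m * lookup g n) * (eval_mon a m * eval_mon a n))"
    by (simp add: peval_sum peval_single eval_mon_add)
  also have "\<dots> = peval a f * peval a g"
    unfolding peval_def sum_product by (intro sum.cong refl) (simp add: algebra_simps)
  finally show ?thesis .
qed

lemma of_int_eq_single: "of_int c = (single 0 c :: mpoly)"
  by (simp add: single_of_int[symmetric] del: single_of_int)

lemma peval_of_int [simp]: "peval a (of_int c) = of_int c"
  by (simp add: of_int_eq_single peval_single)

lemma peval_1 [simp]: "peval a 1 = 1"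
  using peval_of_int[of a 1] by simp

lemma peval_minus: "peval a (- f) = - peval a f"
  using peval_add[of a f "- f"] by (simp add: eq_neg_iff_add_eq_0 add.commute)

lemma peval_indet [simp]: "peval a (indet i) = a i"
  by (simp add: indet_def peval_single eval_mon_def)

lemma poly_eval: "poly (peval a f) t = peval (\<lambda>i. poly (a i) t) f"
  by (simp add: peval_def eval_mon_def poly_sum poly_prod)

text \<open>A monomial is the product of the powers of indeterminates that it records. Structural
  induction on polynomials rests on this.\<close>

lemma peval_indet_id: "peval indet f = f"
proof -
  have power: "indet i ^ j = single (single i j) 1" for i j
    by (induction j) (auto simp: indet_def mult_single simp flip: single_add)
  have prod: "(\<Prod>i\<in>S. single (g i) (1::int)) = single (\<Sum>i\<in>S. g i) 1" for S and g :: "nat \<Rightarrow> nat \<Rightarrow>\<^sub>0 nat"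
    by (induction S rule: infinite_finite_induct) (auto simp: mult_single)
  have "eval_mon indet m = single m 1" for m
    using poly_mapping_sum_single[of m] by (simp add: eval_mon_def power prod)
  moreover have "of_int c * single m 1 = single m c" for c :: int and m :: "nat \<Rightarrow>\<^sub>0 nat"
    using mult_single[of 0 c m 1] by (simp add: of_int_eq_single)
  ultimately show ?thesis by (simp add: peval_def poly_mapping_sum_single)
qed

lemma int_mpolys_of_int [simp]: "of_int c \<in> int_mpolys k"
  by (simp add: int_mpolys_def of_int_eq_single)

lemma int_mpolys_0 [simp]: "0 \<in> int_mpolys k" and int_mpolys_1 [simp]: "1 \<in> int_mpolys k"
  using int_mpolys_of_int[of 0 k] int_mpolys_of_int[of 1 k] by simp_all

lemma int_mpolys_nonempty: "int_mpolys k \<noteq> {}"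
  using int_mpolys_0 by (metis empty_iff)

lemma int_mpolys_numeral [simp]: "numeral n \<in> int_mpolys k"
  using int_mpolys_of_int[of "numeral n" k] by simp

lemma int_mpolys_indet [simp]: "i < k \<Longrightarrow> indet i \<in> int_mpolys k"
  by (simp add: int_mpolys_def indet_def)

lemma int_mpolys_add [intro]: "f \<in> int_mpolys k \<Longrightarrow> g \<in> int_mpolys k \<Longrightarrow> f + g \<in> int_mpolys k"
  using Poly_Mapping.keys_add[of f g] by (fastforce simp: int_mpolys_def)

lemma int_mpolys_mult [intro]: "f \<in> int_mpolys k \<Longrightarrow> g \<in> int_mpolys k \<Longrightarrow> f * g \<in> int_mpolys k"
proof -
  assume f: "f \<in> int_mpolys k" and g: "g \<in> int_mpolys k"
  have "keys m \<subseteq> {..<k}" if "m \<in> keys (f * g)" for m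
  proof -
    have "m \<in> {a + b |a b. a \<in> keys f \<and> b \<in> keys g}" using keys_mult[of f g] that by (rule subsetD)
    then obtain a b where "m = a + b" "a \<in> keys f" "b \<in> keys g" by blast
    moreover have "keys a \<subseteq> {..<k}" "keys b \<subseteq> {..<k}" if "a \<in> keys f" "b \<in> keys g"
      using that f g by (auto simp: int_mpolys_def)
    ultimately show ?thesis using Poly_Mapping.keys_add[of a b] by blast
  qed
  then show ?thesis by (simp add: int_mpolys_def)
qed

lemma int_mpolys_minus [intro]: "f \<in> int_mpolys k \<Longrightarrow> - f \<in> int_mpolys k"
  by (simp add: int_mpolys_def)

lemma peval_cong_vars:
  assumes "f \<in> int_mpolys k" "\<And>i. i < k \<Longrightarrow> a i = b i"
  shows "peval a f = peval b f"
proof -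
  have "eval_mon a m = eval_mon b m" if "m \<in> keys f" for m
  proof -
    have "keys m \<subseteq> {..<k}" using assms(1) that by (simp add: int_mpolys_def)
    then show ?thesis using assms(2) unfolding eval_mon_def by (intro prod.cong refl) auto
  qed
  then show ?thesis by (simp add: peval_def)
qed

text \<open>The cases mirror a program: initial values and the single instruction
  \<open>f + g * h\<close>. This one operation suffices because 0 is \<open>1 + (- 1) * 1\<close>, a
  sum takes the factor 1 and a product takes the summand 0.\<close>

lemma int_mpolys_induct [consumes 1, case_names one minus_one indet add_mult]:
  assumes f: "f \<in> int_mpolys k" and one: "P 1" and minus_one: "P (- 1)"
    and indet: "\<And>i. i < k \<Longrightarrow> P (indet i)"
    and add_mult: "\<And>f g h. f \<in> int_mpolys k \<Longrightarrow> g \<in> int_mpolys k \<Longrightarrow> h \<in> int_mpolys k \<Longrightarrow>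
      P f \<Longrightarrow> P g \<Longrightarrow> P h \<Longrightarrow> P (f + g * h)"
  shows "P f"
proof -
  define Q where "Q f \<longleftrightarrow> f \<in> int_mpolys k \<and> P f" for f
  have Q1: "Q 1" and Qm1: "Q (- 1)" using one minus_one by (auto simp: Q_def)
  have Qam: "Q (f + g * h)" if "Q f" "Q g" "Q h" for f g h
    using that add_mult by (auto simp: Q_def)
  have Q0: "Q 0" using Qam[OF Q1 Qm1 Q1] by simp
  have Qadd: "Q (f + g)" if "Q f" "Q g" for f g using Qam[OF that(1) that(2) Q1] by simp
  have Qmult: "Q (f * g)" if "Q f" "Q g" for f g using Qam[OF Q0 that] by simp
  have Qpow: "Q (f ^ n)" if "Q f" for f n using that Q1 Qmult by (induction n) auto
  have Qnat: "Q (of_nat n)" for n using Q0 Q1 Qadd by (induction n) auto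
  have Qint: "Q (of_int c)" for c
    using Qnat[of "nat c"] Qmult[OF Qm1 Qnat[of "nat (- c)"]] by (cases "c \<ge> 0") auto
  have Qprod: "Q (\<Prod>i\<in>S. g i)" if "\<And>i. i \<in> S \<Longrightarrow> Q (g i)" for S :: "nat set" and g
    using that Q1 Qmult by (induction S rule: infinite_finite_induct) auto
  have Qsum: "Q (\<Sum>i\<in>S. g i)" if "\<And>i. i \<in> S \<Longrightarrow> Q (g i)" for S :: "(nat \<Rightarrow>\<^sub>0 nat) set" and g
    using that Q0 Qadd by (induction S rule: infinite_finite_induct) auto
  have "Q (peval indet f)"
    unfolding peval_def eval_mon_def
  proof (intro Qsum Qmult Qint Qprod Qpow)
    fix m i assume "m \<in> keys f" "i \<in> keys m"
    then have "i < k" using f by (auto simp: int_mpolys_def)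
    then show "Q (indet i)" using indet by (simp add: Q_def)
  qed
  then show ?thesis by (simp add: peval_indet_id Q_def)
qed

lemma peval_in_int_mpolys:
  assumes "f \<in> int_mpolys k" "\<And>i. i < k \<Longrightarrow> a i \<in> int_mpolys k"
  shows "peval a f \<in> int_mpolys k"
  using assms by (induction f rule: int_mpolys_induct) (auto simp: peval_add peval_mult peval_minus)

lemma Ints_mpoly_iff: "(f :: mpoly) \<in> \<int> \<longleftrightarrow> (\<forall>m. m \<noteq> 0 \<longrightarrow> lookup f m = 0)"
proof
  assume "f \<in> \<int>"
  then show "\<forall>m. m \<noteq> 0 \<longrightarrow> lookup f m = 0" by (auto elim!: Ints_cases simp: lookup_of_int)
next
  assume "\<forall>m. m \<noteq> 0 \<longrightarrow> lookup f m = 0"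
  then have "f = of_int (lookup f 0)"
    by (intro poly_mapping_eqI) (auto simp: lookup_of_int when_def)
  then show "f \<in> \<int>" by (metis Ints_of_int)
qed

section \<open>Kronecker substitution\<close>

definition kronecker_weight :: "nat \<Rightarrow> (nat \<Rightarrow>\<^sub>0 nat) \<Rightarrow> nat" where
  "kronecker_weight M m = (\<Sum>i\<in>keys m. lookup m i * M ^ i)"

text \<open>Substituting \<open>X ^ (M ^ i)\<close> for the \<open>i\<close>-th indeterminate sends
  a monomial to the power of \<open>X\<close> whose exponent has the exponents of the monomial as
  digits in base \<open>M\<close>. It makes degrees and the finiteness of root sets
  available.\<close>

definition kronecker :: "nat \<Rightarrow> mpoly \<Rightarrow> int poly" where
  "kronecker M f = peval (\<lambda>i. monom 1 (M ^ i)) f"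

lemma digits_unique:
  fixes a b :: "nat \<Rightarrow> nat"
  assumes "(\<Sum>i<n. a i * M ^ i) = (\<Sum>i<n. b i * M ^ i)" "\<And>i. a i < M" "\<And>i. b i < M" "i < n"
  shows "a i = b i"
  using assms
proof (induction n arbitrary: a b i)
  case (Suc n)
  have split: "(\<Sum>i<Suc n. c i * M ^ i) = c 0 + M * (\<Sum>i<n. c (Suc i) * M ^ i)" for c :: "nat \<Rightarrow> nat"
    unfolding sum.lessThan_Suc_shift by (simp add: sum_distrib_left algebra_simps)
  let ?A = "\<Sum>i<n. a (Suc i) * M ^ i" and ?B = "\<Sum>i<n. b (Suc i) * M ^ i"
  have eq: "a 0 + M * ?A = b 0 + M * ?B" using Suc.prems(1) by (simp only: split)
  have "(a 0 + M * ?A) mod M = a 0" "(b 0 + M * ?B) mod M = b 0"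
    using Suc.prems(2)[of 0] Suc.prems(3)[of 0] by simp_all
  with eq have 0: "a 0 = b 0" by metis
  moreover have "M > 0" using Suc.prems(2)[of 0] by simp
  ultimately have "?A = ?B" using eq by simp
  then have "a (Suc i) = b (Suc i)" if "i < n" for i
    using Suc.IH[of "\<lambda>i. a (Suc i)" "\<lambda>i. b (Suc i)" i] Suc.prems(2,3) that by blast
  with 0 Suc.prems(4) show ?case by (cases i) auto
qed simp

lemma kronecker_weight_inj:
  assumes eq: "kronecker_weight M m = kronecker_weight M n"
    and bound: "\<And>i. lookup m i < M" "\<And>i. lookup n i < M"
  shows "m = n"
proof -
  obtain N where N: "keys m \<union> keys n \<subseteq> {..<N}"
    using finite_nat_bounded[of "keys m \<union> keys n"] by auto
  have "kronecker_weight M p = (\<Sum>i<N. lookup p i * M ^ i)" if "keys p \<subseteq> {..<N}" for p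
    unfolding kronecker_weight_def using that by (intro sum.mono_neutral_left) (auto simp: in_keys_iff)
  then have sums: "(\<Sum>i<N. lookup m i * M ^ i) = (\<Sum>i<N. lookup n i * M ^ i)"
    using eq N by simp
  have "lookup m i = lookup n i" for i
  proof (cases "i < N")
    case True
    then show ?thesis using digits_unique[OF sums bound] by blast
  next
    case False
    then have "i \<notin> keys m" "i \<notin> keys n" using N by auto
    then show ?thesis by (simp add: in_keys_iff)
  qed
  then show ?thesis by (rule poly_mapping_eqI)
qed

lemma exponents_bounded:
  assumes "finite S"
  obtains M where "\<And>m i. m \<in> S \<Longrightarrow> lookup m i < (M::nat)"
proof -
  have fin: "finite (insert 0 (\<Union>m\<in>S. lookup m ` keys m))" using assms by auto
  have "lookup m i \<in> insert 0 (\<Union>m\<in>S. lookup m ` keys m)" if "m \<in> S" for m i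
    using that by (cases "i \<in> keys m") (blast, simp add: in_keys_iff)
  moreover obtain M where "insert 0 (\<Union>m\<in>S. lookup m ` keys m) \<subseteq> {..<M}"
    using finite_nat_bounded[OF fin] by blast
  ultimately show ?thesis by (intro that[of M]) blast
qed

text \<open>Exponents below \<open>M\<close> are digits, so no two monomials collide.
  \<open>m\<close> need not occur in \<open>f\<close>, hence the bound is required for it
  separately.\<close>

lemma coeff_kronecker:
  assumes bound: "\<And>n i. n \<in> insert m (keys f) \<Longrightarrow> lookup n i < M"
  shows "coeff (kronecker M f) (kronecker_weight M m) = lookup f m"
proof -
  have "eval_mon (\<lambda>i. monom (1::int) (M ^ i)) n = monom 1 (kronecker_weight M n)" for n
  proof -
    have prod: "(\<Prod>i\<in>S. monom (1::int) (g i)) = monom 1 (\<Sum>i\<in>S. g i)" for S :: "nat set" and g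
      by (induction S rule: infinite_finite_induct) (auto simp: mult_monom)
    show ?thesis
      by (simp add: eval_mon_def monom_power prod kronecker_weight_def mult.commute)
  qed
  then have "coeff (kronecker M f) (kronecker_weight M m) =
      (\<Sum>n\<in>keys f. if kronecker_weight M n = kronecker_weight M m then lookup f n else 0)"
    by (simp add: kronecker_def peval_def coeff_sum of_int_poly smult_monom) 
  also have "\<dots> = (\<Sum>n\<in>keys f. if n = m then lookup f n else 0)"
    using kronecker_weight_inj[of M _ m] bound by (intro sum.cong refl) auto
  also have "\<dots> = lookup f m" by (simp add: in_keys_iff)
  finally show ?thesis .
qed

text \<open>On the curve \<open>(t, t^M, t^(M^2), ...)\<close> the polynomial \<open>f\<close>
  becomes its Kronecker image, which vanishes at every \<open>t\<close> and is therefore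
  zero.\<close>

lemma peval_zero_imp_zero:
  assumes f: "f \<in> int_mpolys k" and zero: "\<And>as. length as = k \<Longrightarrow> peval ((!) as) f = (0::int)"
  shows "f = 0"
proof (rule ccontr)
  assume "f \<noteq> 0"
  then obtain m where m: "m \<in> keys f" by (metis keys_eq_empty all_not_in_conv)
  obtain M where M: "\<And>n i. n \<in> keys f \<Longrightarrow> lookup n i < M" using exponents_bounded[of "keys f"] by auto
  have "poly (kronecker M f) t = 0" for t
  proof -
    have "poly (kronecker M f) t = peval ((!) (map (\<lambda>i. t ^ (M ^ i)) [0..<k])) f"
      unfolding kronecker_def poly_eval by (rule peval_cong_vars[OF f]) (simp add: poly_monom)
    then show ?thesis by (simp add: zero)
  qed
  then have "kronecker M f = 0" using poly_all_0_iff_0 by blast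
  then have "lookup f m = 0" using coeff_kronecker[of m f M] M m by auto
  with m show False by (simp add: in_keys_iff)
qed

lemma peval_inj:
  assumes "f \<in> int_mpolys k" "g \<in> int_mpolys k"
    and eq: "\<And>as. length as = k \<Longrightarrow> peval ((!) as) f = (peval ((!) as) g :: int)"
  shows "f = g"
proof -
  have "f + - g = 0"
  proof (rule peval_zero_imp_zero)
    show "f + - g \<in> int_mpolys k" using assms(1,2) by blast
  qed (unfold peval_add peval_minus, simp add: eq)
  then show ?thesis by simp
qed

text \<open>The Kronecker substitution is multiplicative and lands in a domain with additive degree,
  so a factor of a nonzero constant has degree 0; among the monomials of \<open>f\<close>, only the
  constant one has weight 0.\<close>

lemma Ints_of_mult_Ints:
  assumes eq: "f * g = of_int c" and c: "c \<noteq> 0"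
  shows "(f :: mpoly) \<in> \<int>"
proof -
  obtain M where M: "\<And>m i. m \<in> insert 0 (keys f \<union> keys g) \<Longrightarrow> lookup m i < M"
    using exponents_bounded[of "insert 0 (keys f \<union> keys g)"] by auto
  have "kronecker M f * kronecker M g = of_int c"
    using eq unfolding kronecker_def by (metis peval_mult peval_of_int)
  then have "kronecker M f * kronecker M g = [:c:]" by (simp add: of_int_poly)
  then have "degree (kronecker M f) = 0"
    using c by (metis add_is_0 degree_mult_eq degree_pCons_0 mult_eq_0_iff pCons_eq_0_iff)
  then have "m = 0" if m: "m \<in> keys f" for m
  proof -
    have "coeff (kronecker M f) (kronecker_weight M m) \<noteq> 0"
    proof -
      have "n \<in> insert m (keys f) \<Longrightarrow> lookup n i < M" for n i using M m by blast
      then show ?thesis using coeff_kronecker[of m f M] m by (simp add: in_keys_iff)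
    qed
    then have "kronecker_weight M m = kronecker_weight M 0"
      using \<open>degree (kronecker M f) = 0\<close> le_degree by (fastforce simp: kronecker_weight_def)
    then show ?thesis using kronecker_weight_inj[of M m 0] M m by auto
  qed
  then show ?thesis unfolding Ints_mpoly_iff by (auto simp: in_keys_iff)
qed

text \<open>Every odd integer divides some \<open>2 ^ n - 1\<close> with \<open>n > 0\<close>, and in \<open>\<int>[x\<^sub>1, \<dots>, x\<^sub>k]\<close> all divisors
  of a nonzero integer are integers. The elements \<open>\<plusminus>2 ^ n\<close> are those all of whose divisors are even
  or units.\<close>

lemma Ints_int_mpolys_iff:
  assumes f: "f \<in> int_mpolys k"
  shows "f \<in> \<int> \<longleftrightarrow> (\<exists>c\<in>int_mpolys k.
    (\<forall>d\<in>int_mpolys k. (\<exists>e\<in>int_mpolys k. c = d * e) \<longrightarrow>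
       (\<exists>e\<in>int_mpolys k. 1 = d * e) \<or> (\<exists>e\<in>int_mpolys k. d = e + e)) \<and>
    \<not> (\<exists>e\<in>int_mpolys k. 1 = c * e) \<and> (\<exists>e\<in>int_mpolys k. c = 1 + (f + f + 1) * e))"
    (is "_ \<longleftrightarrow> (\<exists>c\<in>?A. ?power c \<and> \<not> ?unit c \<and> ?dvd c)")
proof
  assume "f \<in> \<int>"
  then obtain n where n: "f = of_int n" by (auto elim: Ints_cases)
  obtain N where N: "N > 0" "2 * n + 1 dvd 2 ^ N - 1"
    using odd_dvd_power_two_minus_one[of "2 * n + 1"] by auto
  then obtain t where t: "2 ^ N = 1 + (2 * n + 1) * t" by (metis add.commute diff_add_cancel dvdE)
  let ?c = "of_int (2 ^ N) :: mpoly"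
  have "?power ?c"
  proof (intro ballI impI)
    fix d assume "d \<in> ?A" "\<exists>e\<in>?A. ?c = d * e"
    then obtain e where e: "?c = d * e" by blast
    then have "d \<in> \<int>" "e \<in> \<int>"
      using Ints_of_mult_Ints[of d e "2 ^ N"] Ints_of_mult_Ints[of e d "2 ^ N"] by (simp_all add: mult.commute)
    then obtain d' e' where de: "d = of_int d'" "e = of_int e'" by (auto elim!: Ints_cases)
    then have "d' * e' = 2 ^ N" using e by (metis of_int_eq_iff of_int_mult)
    then have dvd: "d' dvd 2 ^ N" by (metis dvd_triv_left)
    show "?unit d \<or> (\<exists>e\<in>?A. d = e + e)"
    proof (cases "even d'")
      case True
      then obtain h where "d' = h + h" by (metis evenE mult_2)
      then show ?thesis using de by (intro disjI2 bexI[of _ "of_int h"]) auto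
    next
      case False
      then have "coprime d' (2 ^ N)" by (simp add: coprime_commute)
      then have "d' dvd 1" using dvd coprime_absorb_left by blast
      then obtain h where "1 = d' * h" unfolding dvd_def by blast
      then have "1 = d * of_int h" unfolding de by (metis of_int_1 of_int_mult)
      then show ?thesis by (intro disjI1 bexI[of _ "of_int h"]) auto
    qed
  qed
  moreover have "\<not> ?unit ?c"
  proof
    assume "?unit ?c"
    then obtain e where e: "1 = ?c * e" by blast
    then have "e \<in> \<int>" using Ints_of_mult_Ints[of e ?c 1] by (simp add: mult.commute)
    then obtain e' where "e = of_int e'" by (auto elim!: Ints_cases)
    then have "1 = 2 ^ N * e'" using e by (metis of_int_1 of_int_eq_iff of_int_mult)
    then have "even (1::int)" using N(1) by (metis dvd_mult2 dvd_power)
    then show False by simp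
  qed
  moreover have "?c = of_int (1 + (2 * n + 1) * t)" using t by (rule arg_cong)
  then have "?c = 1 + (f + f + 1) * of_int t"
    by (simp only: n of_int_add of_int_mult of_int_1 of_int_numeral mult_2)
  then have "?dvd ?c" using int_mpolys_of_int[of t k] by (rule bexI)
  ultimately have "?power ?c \<and> \<not> ?unit ?c \<and> ?dvd ?c" by (intro conjI)
  then show "\<exists>c\<in>?A. ?power c \<and> \<not> ?unit c \<and> ?dvd c" using int_mpolys_of_int by (rule bexI)
next
  assume "\<exists>c\<in>?A. ?power c \<and> \<not> ?unit c \<and> ?dvd c"
  then obtain c e where c: "c \<in> ?A" "?power c" "\<not> ?unit c" and e: "e \<in> ?A" "c = 1 + (f + f + 1) * e"
    by blast
  have unit_Ints: "d \<in> \<int>" if "?unit d" for d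
    using that Ints_of_mult_Ints[of d _ 1] by auto
  \<comment> \<open>Descent on the size of one nonzero coefficient. A nonunit \<open>c\<close>
    divides itself, so it is \<open>e + e\<close>, and \<open>e\<close> inherits the divisor
    condition with half the coefficient; the descent ends at a unit.\<close>
  have power_Ints: "c \<in> \<int>" if "c \<in> ?A" "?power c" "lookup c m \<noteq> 0" for c m
    using that
  proof (induction "nat \<bar>lookup c m\<bar>" arbitrary: c rule: less_induct)
    case less
    show ?case
    proof (cases "?unit c")
      case False
      moreover have "\<exists>e\<in>?A. c = c * e" by (rule bexI[of _ 1]) auto
      ultimately obtain e where e: "e \<in> ?A" "c = e + e" using less.prems by blast
      have "?power e"
      proof (intro ballI impI)
        fix d assume d: "d \<in> ?A" "\<exists>g\<in>?A. e = d * g"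
        then obtain g where "g \<in> ?A" "e = d * g" by blast
        then have "c = d * (g + g)" "g + g \<in> ?A" using e by (auto simp: algebra_simps)
        then show "?unit d \<or> (\<exists>e\<in>?A. d = e + e)" using less.prems(2) d(1) by blast
      qed
      moreover have "lookup c m = lookup e m + lookup e m" unfolding e(2) by (rule lookup_add)
      ultimately have "e \<in> \<int>" using less.hyps[of e] less.prems(3) e(1) by simp
      then show ?thesis using e(2) by simp
    qed (rule unit_Ints)
  qed
  \<comment> \<open>Everything divides 0, but 3 is neither a unit nor even.\<close>
  have "c \<noteq> 0"
  proof
    assume "c = 0"
    then have power_0: "?power 0" using c(2) by blast
    have "\<exists>e\<in>?A. 0 = 3 * e" by (rule bexI[of _ 0]) auto
    then have "?unit 3 \<or> (\<exists>e\<in>?A. 3 = e + e)"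
      by (rule mp[OF bspec[OF power_0 int_mpolys_numeral]])
    then consider e :: mpoly where "1 = 3 * e" | e :: mpoly where "3 = e + e" by blast
    then show False
    proof cases
      case 1
      then have "(1 :: mpoly) = e + e + e" by simp
      then have "lookup (1 :: mpoly) 0 = lookup e 0 + lookup e 0 + lookup e 0" by (metis lookup_add)
      then show ?thesis by simp presburger
    next
      case 2
      then have "lookup (3 :: mpoly) 0 = lookup e 0 + lookup e 0" by (metis lookup_add)
      then show ?thesis by (simp add: lookup_numeral) presburger
    qed
  qed
  then obtain m where "lookup c m \<noteq> 0" by (metis lookup_zero poly_mapping_eqI)
  with c power_Ints have "c \<in> \<int>" by blast
  then obtain n where n: "c = of_int n" by (auto elim: Ints_cases)
  \<comment> \<open>The nonunit clause excludes \<open>c = 1\<close>, for which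
    \<open>f + f + 1\<close> would only have to divide 0.\<close>
  have "n \<noteq> 1"
  proof
    assume "n = 1"
    then have "1 = c * 1" using n by simp
    with c(3) show False using int_mpolys_1 by blast
  qed
  moreover have "(f + f + 1) * e = of_int (n - 1)" using e(2) n by simp
  ultimately have "f + f + 1 \<in> \<int>" using Ints_of_mult_Ints by (metis diff_eq_diff_eq diff_self eq_iff_diff_eq_0)
  then have "f + f \<in> \<int>" using Ints_diff[of "f + f + 1" 1] by simp
  then show "f \<in> \<int>" unfolding Ints_mpoly_iff lookup_add by simp
qed

section \<open>Programs and the polynomials they compute\<close>

lemma run_iff_eval:
  fixes F :: "nat \<Rightarrow> mpoly"
  assumes u: "u ! 4 = int L"
    and instr: "\<And>i. k + 2 \<le> i \<Longrightarrow> i \<le> L \<Longrightarrow> instr u (int i) (int (p i)) (int (q i)) (int (r i))"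
    and F: "F 0 = 1" "F 1 = - 1" "\<And>j. j < k \<Longrightarrow> F (j + 2) = indet j"
    and step: "\<And>i. k + 2 \<le> i \<Longrightarrow> i \<le> L \<Longrightarrow> F i = F (p i) + F (q i) * F (r i)"
    and as: "length as = k"
  shows "run k u as v \<longleftrightarrow> v = peval ((!) as) (F L)"
proof -
  define G where "G i = peval ((!) as) (F i)" for i
  have G: "G 0 = 1" "G 1 = - 1" "\<And>j. j < k \<Longrightarrow> G (j + 2) = as ! j"
    by (simp_all only: G_def F peval_minus peval_1 peval_indet)
  have G_step: "G i = G (p i) + G (q i) * G (r i)" if "k + 2 \<le> i" "i \<le> L" for i
    using step[OF that] by (simp add: G_def peval_add peval_mult)
  have smaller: "p i < i" "q i < i" "r i < i" if "k + 2 \<le> i" "i \<le> L" for i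
    using instr[OF that] by (auto simp: instr_def)
  show ?thesis
  proof
    assume "run k u as v"
    then obtain c d b where b0: "beta c d 0 (1 + b)" and b1: "\<exists>w. w + 1 = 0 \<and> beta c d 1 (w + b)"
      and bj: "\<And>j. j < k \<Longrightarrow> beta c d (int (j + 2)) (as ! j + b)"
      and bi: "\<And>i a1 a2 a3 x y z. int (k + 2) \<le> i \<Longrightarrow> i \<le> u ! 4 \<Longrightarrow> instr u i a1 a2 a3 \<Longrightarrow>
        beta c d a1 (x + b) \<Longrightarrow> beta c d a2 (y + b) \<Longrightarrow> beta c d a3 (z + b) \<Longrightarrow> beta c d i (x + y * z + b)"
      and v: "beta c d (u ! 4) (v + b)"
      unfolding run_def by blast
    \<comment> \<open>The initial clauses and the instruction clause propagate the values of the
      polynomials \<open>F i\<close> along the sequence; uniqueness of \<open>beta\<close> enters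
      only at the result.\<close>
    have "beta c d (int i) (G i + b)" if "i < k + 2 \<or> i \<le> L" for i
      using that
    proof (induction i rule: less_induct)
      case (less i)
      show ?case
      proof (cases "i < k + 2")
        case True
        then have "i = 0 \<or> i = 1 \<or> (i = i - 2 + 2 \<and> i - 2 < k)" by linarith
        then consider "i = 0" | "i = 1" | j where "i = j + 2" "j < k" by blast
        then show ?thesis
        proof cases
          case 1
          then show ?thesis using b0 G by simp
        next
          case 2
          from b1 have "beta c d 1 (- 1 + b)" by (metis eq_neg_iff_add_eq_0)
          then show ?thesis using 2 G by simp
        next
          case 3
          then show ?thesis using bj[of j] G(3) by simp
        qed
      next
        case False
        then have i: "k + 2 \<le> i" "i \<le> L" using less.prems by auto
        show ?thesis
          unfolding G_step[OF i]
          by (rule bi[OF _ _ instr[OF i]]) (use i u less.IH smaller[OF i] in auto)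
      qed
    qed
    from this[of L] have "beta c d (u ! 4) (G L + b)" by (simp add: u)
    then have "v + b = G L + b" using v beta_unique by blast
    then show "v = peval ((!) as) (F L)" by (simp add: G_def)
  next
    assume v: "v = peval ((!) as) (F L)"
    \<comment> \<open>Long enough for the result position \<open>L\<close> and for all initial
      positions; \<open>b\<close> then bounds every value, so that the shifted values are
      nonnegative.\<close>
    define n where "n = L + k + 2"
    define b where "b = (\<Sum>i\<le>n. \<bar>G i\<bar>)"
    have b: "0 \<le> G i + b \<and> G i + b < 2 * b + 1" if "i \<le> n" for i
    proof -
      have "\<bar>G i\<bar> \<le> b" unfolding b_def by (rule member_le_sum) (use that in auto)
      then show ?thesis by linarith
    qed
    obtain d where d: "\<And>s. (\<And>i. i \<le> n \<Longrightarrow> 0 \<le> s i \<and> s i < 2 * b + 1) \<Longrightarrow> \<exists>c. \<forall>i\<le>n. beta c d (int i) (s i)"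
      using beta_exists[of n "2 * b + 1"] by blast
    obtain c where c: "\<And>i. i \<le> n \<Longrightarrow> beta c d (int i) (G i + b)"
      using d[of "\<lambda>i. G i + b"] b by blast
    have "beta c d i (x + y * z + b)"
      if i: "int (k + 2) \<le> i" "i \<le> u ! 4" and ins: "instr u i a1 a2 a3"
        and x: "beta c d a1 (x + b)" and y: "beta c d a2 (y + b)" and z: "beta c d a3 (z + b)"
      for i a1 a2 a3 x y z
    proof -
      obtain j where j: "i = int j" using i by (metis nonneg_int_cases of_nat_0_le_iff order_trans)
      then have jL: "k + 2 \<le> j" "j \<le> L" using i u by auto
      have a: "a1 = int (p j)" "a2 = int (q j)" "a3 = int (r j)"
        using ins instr[OF jL] beta_unique unfolding j instr_def by blast+
      have "p j \<le> n" "q j \<le> n" "r j \<le> n" using smaller[OF jL] jL by (simp_all add: n_def)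
      then have "x + b = G (p j) + b" "y + b = G (q j) + b" "z + b = G (r j) + b"
        using x y z c beta_unique unfolding a by blast+
      then have "x + y * z = G j" using G_step[OF jL] by simp
      then show ?thesis using c[of j] jL by (simp add: j n_def)
    qed
    moreover have "beta c d 0 (1 + b)" using c[of 0] G by simp
    moreover have "\<exists>w. w + 1 = 0 \<and> beta c d 1 (w + b)"
      using c[of 1] G by (intro exI[of _ "- 1"]) (simp add: n_def)
    moreover have "\<forall>j<k. beta c d (int (j + 2)) (as ! j + b)"
    proof (intro allI impI)
      fix j assume "j < k"
      then show "beta c d (int (j + 2)) (as ! j + b)" using c[of "j + 2"] G(3)[of j] by (simp add: n_def)
    qed
    moreover have "beta c d (u ! 4) (v + b)" using c[of L] u v by (simp add: n_def G_def)
    ultimately show "run k u as v" unfolding run_def by blast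
  qed
qed

text \<open>The polynomials at the positions are built up one position at a time. Setting a new
  position cannot disturb an earlier equation because operands precede their instruction.\<close>

lemma valid_code_run:
  assumes "valid_code k u"
  shows "\<exists>f\<in>int_mpolys k. \<forall>as v. length as = k \<longrightarrow> (run k u as v \<longleftrightarrow> v = peval ((!) as) f)"
proof -
  define L where "L = nat (u ! 4)"
  have L: "u ! 4 = int L" using assms by (simp add: valid_code_def L_def)
  have "\<exists>a b c. instr u (int i) (int a) (int b) (int c)" if i: "k + 2 \<le> i" "i \<le> L" for i
  proof -
    have "int (k + 2) \<le> int i" "int i \<le> u ! 4" using i L by auto
    then obtain a b c where ins: "instr u (int i) a b c" using assms unfolding valid_code_def by blast
    then have "0 \<le> a" "0 \<le> b" "0 \<le> c" using beta_nonneg by (auto simp: instr_def)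
    then show ?thesis using ins by (metis nonneg_int_cases)
  qed
  then obtain p q r where instr:
    "\<And>i. k + 2 \<le> i \<Longrightarrow> i \<le> L \<Longrightarrow> instr u (int i) (int (p i)) (int (q i)) (int (r i))"
    by metis
  have less: "p i < i" "q i < i" "r i < i" if "k + 2 \<le> i" "i \<le> L" for i
    using instr[OF that] by (auto simp: instr_def)
  define init :: "(nat \<Rightarrow> mpoly) \<Rightarrow> bool" where
    "init F \<longleftrightarrow> F 0 = 1 \<and> F 1 = - 1 \<and> (\<forall>j<k. F (j + 2) = indet j) \<and> (\<forall>i. F i \<in> int_mpolys k)" for F
  have "\<exists>F. init F \<and> (\<forall>i. k + 2 \<le> i \<and> i \<le> L \<and> i < k + 2 + n \<longrightarrow> F i = F (p i) + F (q i) * F (r i))" for n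
  proof (induction n)
    case 0
    have "init (\<lambda>i. if i = 0 then 1 else if i = 1 then - 1 else if i - 2 < k then indet (i - 2) else 0)"
      by (auto simp: init_def)
    then show ?case by (intro exI conjI, assumption) auto
  next
    case (Suc n)
    then obtain F where F: "init F"
      "\<And>i. k + 2 \<le> i \<Longrightarrow> i \<le> L \<Longrightarrow> i < k + 2 + n \<Longrightarrow> F i = F (p i) + F (q i) * F (r i)" by blast
    let ?i = "k + 2 + n"
    let ?F = "F(?i := F (p ?i) + F (q ?i) * F (r ?i))"
    have "init ?F" using F(1) by (auto simp: init_def)
    moreover have "?F i = ?F (p i) + ?F (q i) * ?F (r i)" if i: "k + 2 \<le> i" "i \<le> L" "i < k + 2 + Suc n" for i
    proof -
      have "p i < ?i" "q i < ?i" "r i < ?i" using less[OF i(1,2)] i(3) by linarith+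
      then show ?thesis using F(2)[OF i(1,2)] i(3) by (cases "i = ?i") auto
    qed
    ultimately show ?case by blast
  qed
  from this[of "Suc L"] obtain F where F: "init F"
    "\<And>i. k + 2 \<le> i \<Longrightarrow> i \<le> L \<Longrightarrow> F i = F (p i) + F (q i) * F (r i)" by auto
  have "run k u as v \<longleftrightarrow> v = peval ((!) as) (F L)" if "length as = k" for as v
    by (rule run_iff_eval[OF L instr]) (use F that in \<open>auto simp: init_def\<close>)
  moreover have "F L \<in> int_mpolys k" using F(1) by (simp add: init_def)
  ultimately show ?thesis by blast
qed

text \<open>A program before coding, recorded by the polynomials it computes. Operand positions stay
  existential, so a chain can be lengthened without choosing them.\<close>

definition chain :: "nat \<Rightarrow> mpoly list \<Rightarrow> bool" where
  "chain k w \<longleftrightarrow> k + 2 \<le> length w \<and> w ! 0 = 1 \<and> w ! 1 = - 1 \<and> (\<forall>j<k. w ! (j + 2) = indet j) \<and>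
     (\<forall>i. k + 2 \<le> i \<and> i < length w \<longrightarrow> (\<exists>a b c. a < i \<and> b < i \<and> c < i \<and> w ! i = w ! a + w ! b * w ! c))"

lemma chain_snoc:
  assumes "chain k w" "x \<in> set w" "y \<in> set w" "z \<in> set w"
  shows "chain k (w @ [x + y * z])"
proof -
  obtain a b c where abc: "a < length w" "b < length w" "c < length w" "x = w ! a" "y = w ! b" "z = w ! c"
    using assms by (metis in_set_conv_nth)
  have "\<exists>a b c. a < i \<and> b < i \<and> c < i \<and> (w @ [x + y * z]) ! i =
      (w @ [x + y * z]) ! a + (w @ [x + y * z]) ! b * (w @ [x + y * z]) ! c"
    if i: "k + 2 \<le> i" "i < length (w @ [x + y * z])" for i
  proof (cases "i < length w")
    case True
    then obtain a b c where "a < i" "b < i" "c < i" "w ! i = w ! a + w ! b * w ! c"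
      using assms(1) i unfolding chain_def by blast
    then show ?thesis using True by (intro exI[of _ a] exI[of _ b] exI[of _ c]) (simp add: nth_append)
  next
    case False
    then show ?thesis using i abc by (intro exI[of _ a] exI[of _ b] exI[of _ c]) (simp add: nth_append)
  qed
  then show ?thesis using assms(1) by (auto simp: chain_def nth_append)
qed

text \<open>Generalized to extending an arbitrary chain: for \<open>f + g * h\<close> the chain is
  grown for the three operands in turn, and the earlier results remain available.\<close>

lemma chain_extend:
  assumes "f \<in> int_mpolys k" "chain k w"
  shows "\<exists>w'. chain k w' \<and> set w \<subseteq> set w' \<and> f \<in> set w'"
  using assms
proof (induction f arbitrary: w rule: int_mpolys_induct)
  case one
  then have "w ! 0 = 1" "0 < length w" by (auto simp: chain_def)
  then have "1 \<in> set w" by (metis nth_mem)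
  with one show ?case by blast
next
  case minus_one
  then have "w ! 1 = - 1" "1 < length w" by (auto simp: chain_def)
  then have "- 1 \<in> set w" by (metis nth_mem)
  with minus_one show ?case by blast
next
  case (indet i)
  then have "w ! (i + 2) = indet i" "i + 2 < length w" by (auto simp: chain_def)
  then have "indet i \<in> set w" by (metis nth_mem)
  with indet show ?case by blast
next
  case (add_mult f g h)
  obtain w1 where w1: "chain k w1" "set w \<subseteq> set w1" "f \<in> set w1" using add_mult by blast
  obtain w2 where w2: "chain k w2" "set w1 \<subseteq> set w2" "g \<in> set w2" using add_mult w1 by blast
  obtain w3 where w3: "chain k w3" "set w2 \<subseteq> set w3" "h \<in> set w3" using add_mult w2 by blast
  have "chain k (w3 @ [f + g * h])" using w1 w2 w3 by (intro chain_snoc) auto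
  moreover have "set w \<subseteq> set (w3 @ [f + g * h])" using w1 w2 w3 by auto
  ultimately show ?case by (intro exI[of _ "w3 @ [f + g * h]"]) auto
qed

lemma int_mpolys_code:
  assumes f: "f \<in> int_mpolys k"
  shows "\<exists>u. length u = 5 \<and> valid_code k u \<and>
    (\<forall>as v. length as = k \<longrightarrow> (run k u as v \<longleftrightarrow> v = peval ((!) as) f))"
proof -
  have "chain k (1 # - 1 # map indet [0..<k])" by (auto simp: chain_def nth_Cons')
  then obtain w where w: "chain k w" "f \<in> set w" using chain_extend[OF f] by blast
  then obtain L where L: "L < length w" "w ! L = f" by (auto simp: in_set_conv_nth)
  define n where "n = length w"
  have "\<forall>i. \<exists>a b c. k + 2 \<le> i \<and> i < n \<longrightarrow> a < i \<and> b < i \<and> c < i \<and> w ! i = w ! a + w ! b * w ! c"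
    using w(1) unfolding chain_def n_def by blast
  then obtain p q r where pqr: "\<And>i. k + 2 \<le> i \<Longrightarrow> i < n \<Longrightarrow>
      p i < i \<and> q i < i \<and> r i < i \<and> w ! i = w ! p i + w ! q i * w ! r i"
    by metis
  \<comment> \<open>All operand positions are below \<open>n\<close>, so this single
    \<open>d\<close> serves the three sequences of operands.\<close>
  obtain d where d: "\<And>s. (\<And>i. i \<le> n \<Longrightarrow> 0 \<le> s i \<and> s i < int n + 1) \<Longrightarrow> \<exists>c. \<forall>i\<le>n. beta c d (int i) (s i)"
    using beta_exists[of n "int n + 1"] by blast
  have "\<exists>c. \<forall>i. k + 2 \<le> i \<and> i < n \<longrightarrow> beta c d (int i) (int (p i))"
    if "\<And>i. k + 2 \<le> i \<Longrightarrow> i < n \<Longrightarrow> p i < i" for p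
  proof -
    \<comment> \<open>Positions without an instruction get the dummy entry 0.\<close>
    have "\<exists>c. \<forall>i\<le>n. beta c d (int i) (if k + 2 \<le> i \<and> i < n then int (p i) else 0)"
      by (rule d) (use that in fastforce)
    then show ?thesis by (metis less_imp_le)
  qed
  then obtain cp cq cr where
    c: "\<And>i. k + 2 \<le> i \<Longrightarrow> i < n \<Longrightarrow> beta cp d (int i) (int (p i))"
       "\<And>i. k + 2 \<le> i \<Longrightarrow> i < n \<Longrightarrow> beta cq d (int i) (int (q i))"
       "\<And>i. k + 2 \<le> i \<Longrightarrow> i < n \<Longrightarrow> beta cr d (int i) (int (r i))"
    using pqr by metis
  define u where "u = [cp, cq, cr, d, int L]"
  have u4: "u ! 4 = int L" by (simp add: u_def)
  have instr: "instr u (int i) (int (p i)) (int (q i)) (int (r i))" if "k + 2 \<le> i" "i \<le> L" for i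
    using that c[of i] pqr[of i] L(1) by (simp add: instr_def u_def n_def)
  have "run k u as v \<longleftrightarrow> v = peval ((!) as) (w ! L)" if "length as = k" for as v
    by (rule run_iff_eval[OF u4 instr]) (use w(1) pqr L(1) that in \<open>auto simp: chain_def n_def\<close>)
  moreover have "valid_code k u"
    unfolding valid_code_def u4
  proof (intro conjI allI impI)
    fix i assume i: "int (k + 2) \<le> i \<and> i \<le> int L"
    then obtain j where "i = int j" by (metis nonneg_int_cases of_nat_0_le_iff order_trans)
    with i instr[of j] show "\<exists>a b c. instr u i a b c" by auto
  qed simp
  moreover have "length u = 5" by (simp add: u_def)
  ultimately show ?thesis using L(2) by blast
qed

text \<open>For a valid code exactly one polynomial qualifies, by \<open>valid_code_run\<close> and
  \<open>peval_inj\<close>, so the choice is unambiguous.\<close>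

definition decode :: "nat \<Rightarrow> int list \<Rightarrow> mpoly" where
  "decode k u = (SOME f. f \<in> int_mpolys k \<and>
     (\<forall>as v. length as = k \<longrightarrow> (run k u as v \<longleftrightarrow> v = peval ((!) as) f)))"

lemma
  assumes "valid_code k u"
  shows decode_in: "decode k u \<in> int_mpolys k"
    and run_iff_decode: "\<And>as v. length as = k \<Longrightarrow> run k u as v \<longleftrightarrow> v = peval ((!) as) (decode k u)"
proof -
  have "decode k u \<in> int_mpolys k \<and>
     (\<forall>as v. length as = k \<longrightarrow> (run k u as v \<longleftrightarrow> v = peval ((!) as) (decode k u)))"
    unfolding decode_def by (rule someI_ex) (use valid_code_run[OF assms] in blast)
  then show "decode k u \<in> int_mpolys k"
    and "\<And>as v. length as = k \<Longrightarrow> run k u as v \<longleftrightarrow> v = peval ((!) as) (decode k u)" by blast+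
qed

lemma decode_surj:
  assumes f: "f \<in> int_mpolys k"
  obtains u where "length u = 5" "valid_code k u" "decode k u = f"
proof -
  obtain u where u: "length u = 5" "valid_code k u"
    "\<And>as v. length as = k \<Longrightarrow> run k u as v \<longleftrightarrow> v = peval ((!) as) f"
    using int_mpolys_code[OF f] by blast
  have "decode k u = f"
    by (rule peval_inj[OF decode_in[OF u(2)] f]) (use run_iff_decode[OF u(2)] u(3) in metis)
  with u show ?thesis by (intro that)
qed

subsection \<open>The bi-interpretation\<close>

lemma closed_int_mpolys: "closed_struct (mpoly_ring k)"
  by (rule closed_ring_struct) (auto simp: ring_closed_def)

lemma definable_Ints:
  assumes "definable_fun (mpoly_ring k) n t"
  shows "definable (mpoly_ring k) n (\<lambda>e. t e \<in> \<int>)"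
proof -
  have "definable (mpoly_ring k) 1 (\<lambda>e. \<exists>c\<in>int_mpolys k.
    (\<forall>d\<in>int_mpolys k. (\<exists>a\<in>int_mpolys k. c = d * a) \<longrightarrow>
       (\<exists>a\<in>int_mpolys k. 1 = d * a) \<or> (\<exists>a\<in>int_mpolys k. d = a + a)) \<and>
    \<not> (\<exists>a\<in>int_mpolys k. 1 = c * a) \<and> (\<exists>a\<in>int_mpolys k. c = 1 + (e 0 + e 0 + 1) * a))"
    by (intro definable_ex_ring definable_all_ring definable_intros definable_fun_intros) simp_all
  then have "definable (mpoly_ring k) 1 (\<lambda>e. e 0 \<in> \<int>)"
    by (rule definable_cong) (rule Ints_int_mpolys_iff[symmetric], simp)
  then show ?thesis by (rule definable_apply1[OF closed_int_mpolys _ assms])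
qed

section \<open>Relativization to the integers inside the polynomial ring\<close>

lemma eval_tm_of_int:
  "tm_in n t \<Longrightarrow> eval_tm (ring_struct S) (\<lambda>i. of_int (e i)) t = of_int (eval_tm int_ring e t)"
proof (induction t)
  case (Fun f ts)
  then have "map (eval_tm (ring_struct S) (\<lambda>i. of_int (e i))) ts = map (\<lambda>t. of_int (eval_tm int_ring e t)) ts"
    by (auto simp: list_all_iff)
  moreover have "length ts = arity f" using Fun.prems by simp
  ultimately show ?case by (cases f) (auto simp: numeral_2_eq_2)
qed simp

text \<open>Terms have the same values in both rings, so only quantifiers change: each is restricted
  by the formula \<open>\<delta>\<close> that defines the integers.\<close>

lemma relativize_Ints:
  "fm_in n \<phi> \<Longrightarrow> \<exists>\<phi>'. fm_in n \<phi>' \<and>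
    (\<forall>e. sat (mpoly_ring k) (\<lambda>i. of_int (e i)) \<phi>' \<longleftrightarrow> sat int_ring e \<phi>)"
proof (induction \<phi> arbitrary: n)
  case Truth
  show ?case by (rule exI[of _ Truth]) simp
next
  case (Eq s t)
  then show ?case
    using eval_tm_of_int[of n s "int_mpolys k"] eval_tm_of_int[of n t "int_mpolys k"]
    by (intro exI[of _ "Eq s t"]) (simp del: of_int_eq_iff add: of_int_eq_iff[where ?'a = mpoly])
next
  case (Neg \<phi>)
  then obtain \<phi>' where "fm_in n \<phi>'"
    "\<forall>e. sat (mpoly_ring k) (\<lambda>i. of_int (e i)) \<phi>' \<longleftrightarrow> sat int_ring e \<phi>"
    by fastforce
  then show ?case by (intro exI[of _ "Neg \<phi>'"]) simp
next
  case (And \<phi> \<chi>)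
  then obtain \<phi>' \<chi>' where "fm_in n \<phi>'" "fm_in n \<chi>'"
    "\<forall>e. sat (mpoly_ring k) (\<lambda>i. of_int (e i)) \<phi>' \<longleftrightarrow> sat int_ring e \<phi>"
    "\<forall>e. sat (mpoly_ring k) (\<lambda>i. of_int (e i)) \<chi>' \<longleftrightarrow> sat int_ring e \<chi>"
    by (metis fm_in.simps(4))
  then show ?case by (intro exI[of _ "And \<phi>' \<chi>'"]) simp
next
  case (Ex \<phi>)
  then obtain \<phi>' where \<phi>': "fm_in (Suc n) \<phi>'"
    "\<And>e. sat (mpoly_ring k) (\<lambda>i. of_int (e i)) \<phi>' \<longleftrightarrow> sat int_ring e \<phi>"
    by (metis fm_in.simps(5))
  obtain \<delta> where \<delta>: "fm_in (Suc n) \<delta>"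
    "\<And>e. \<forall>i<Suc n. e i \<in> int_mpolys k \<Longrightarrow> sat (mpoly_ring k) e \<delta> \<longleftrightarrow> e 0 \<in> \<int>"
    using definable_Ints[OF definable_fun_var[of 0 "Suc n" "mpoly_ring k"]]
    unfolding definable_def by auto
  have "sat (mpoly_ring k) (\<lambda>i. of_int (e i)) (Ex (And \<delta> \<phi>')) \<longleftrightarrow> sat int_ring e (Ex \<phi>)"
    for e
  proof -
    have env: "case_nat (of_int z) (\<lambda>i. of_int (e i)) = (\<lambda>i. of_int (case_nat z e i) :: mpoly)" for z
      by (auto simp: fun_eq_iff split: nat.splits)
    have "sat (mpoly_ring k) (case_nat a (\<lambda>i. of_int (e i))) \<delta> \<longleftrightarrow> a \<in> \<int>"
      if "a \<in> int_mpolys k" for a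
      using that by (subst \<delta>(2)) (auto split: nat.splits)
    then have "sat (mpoly_ring k) (\<lambda>i. of_int (e i)) (Ex (And \<delta> \<phi>')) \<longleftrightarrow>
      (\<exists>a\<in>int_mpolys k. a \<in> \<int> \<and> sat (mpoly_ring k) (case_nat a (\<lambda>i. of_int (e i))) \<phi>')"
      by auto
    also have "\<dots> \<longleftrightarrow> (\<exists>z. sat (mpoly_ring k) (case_nat (of_int z) (\<lambda>i. of_int (e i))) \<phi>')"
      by (metis Ints_cases Ints_of_int int_mpolys_of_int)
    also have "\<dots> \<longleftrightarrow> sat int_ring e (Ex \<phi>)"
      unfolding env \<phi>'(2) by simp
    finally show ?thesis .
  qed
  then show ?case using \<phi>'(1) \<delta>(1) by (intro exI[of _ "Ex (And \<delta> \<phi>')"]) auto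
qed

lemma map_of_int_eq_iff:
  "map (of_int :: int \<Rightarrow> mpoly) xs = map of_int ys \<longleftrightarrow> xs = ys"
  by (rule inj_map_eq_map) (simp add: inj_on_def)

text \<open>Programs need not be described anew over the polynomial ring: the formula found over the
  integers is relativized. The existential \<open>xs\<close> makes the new relation assert that all
  entries of \<open>l e\<close> are integers.\<close>

lemma definable_of_int:
  assumes R: "definable int_ring m (\<lambda>e. R (map e [0..<m]))"
    and l: "definable_list (mpoly_ring k) n m l"
  shows "definable (mpoly_ring k) n (\<lambda>e. \<exists>xs. l e = map of_int xs \<and> R xs)"
proof -
  let ?A = "mpoly_ring k"
  obtain \<phi> where \<phi>: "fm_in m \<phi>" "\<And>e. sat int_ring e \<phi> \<longleftrightarrow> R (map e [0..<m])"
    using R unfolding definable_def by auto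
  obtain \<phi>' where \<phi>': "fm_in m \<phi>'" "\<And>e. sat ?A (\<lambda>i. of_int (e i)) \<phi>' \<longleftrightarrow> sat int_ring e \<phi>"
    using relativize_Ints[OF \<phi>(1), of k] by blast
  have "definable ?A m (\<lambda>e. sat ?A e \<phi>')" using \<phi>'(1) unfolding definable_def by blast
  then have "definable ?A m (\<lambda>e. (\<forall>i<m. e i \<in> \<int>) \<and> sat ?A e \<phi>')"
    by (intro definable_conj definable_all_less definable_Ints definable_fun_var)
  then have "definable ?A m (\<lambda>e. \<exists>xs. map e [0..<m] = map of_int xs \<and> R xs)"
  proof (rule definable_cong)
    fix e
    show "(\<forall>i<m. e i \<in> \<int>) \<and> sat ?A e \<phi>' \<longleftrightarrow> (\<exists>xs. map e [0..<m] = map of_int xs \<and> R xs)"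
    proof (cases "\<forall>i<m. e i \<in> \<int>")
      case True
      then have "\<forall>i. \<exists>z. i < m \<longrightarrow> e i = of_int z" by (metis Ints_cases)
      then obtain z where z: "\<And>i. i < m \<Longrightarrow> e i = of_int (z i)" by metis
      have "sat ?A e \<phi>' \<longleftrightarrow> sat ?A (\<lambda>i. of_int (z i)) \<phi>'" by (rule sat_cong[OF \<phi>'(1) z])
      then have "sat ?A e \<phi>' \<longleftrightarrow> R (map z [0..<m])" by (simp add: \<phi>(2) \<phi>'(2))
      moreover have "map e [0..<m] = map of_int (map z [0..<m])" using z by simp
      ultimately show ?thesis using True map_of_int_eq_iff by metis
    next
      case False
      then obtain i where "i < m" "e i \<notin> \<int>" by blast
      have "map e [0..<m] \<noteq> map of_int xs" for xs :: "int list"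
      proof
        assume eq: "map e [0..<m] = map of_int xs"
        then have "length xs = m" by (metis length_map length_upt diff_zero)
        then have "e i = of_int (xs ! i)" using arg_cong[OF eq, of "\<lambda>l. l ! i"] \<open>i < m\<close> by simp
        then show False using \<open>e i \<notin> \<int>\<close> by simp
      qed
      then show ?thesis using False by blast
    qed
  qed
  then show ?thesis using l by (rule definable_apply[OF closed_int_mpolys])
qed

section \<open>Ideals of integer points\<close>

definition point_ideal :: "nat \<Rightarrow> mpoly list \<Rightarrow> int list \<Rightarrow> mpoly set" where
  "point_ideal k r as = {\<Sum>j<k. h j * (r ! j - of_int (as ! j)) | h. \<forall>j<k. h j \<in> int_mpolys k}"

lemma point_ideal_0: "0 \<in> point_ideal k r as"
  unfolding point_ideal_def by (rule CollectI, rule exI[of _ "\<lambda>j. 0"]) simp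

lemma point_ideal_add:
  assumes "f \<in> point_ideal k r as" "g \<in> point_ideal k r as"
  shows "f + g \<in> point_ideal k r as"
proof -
  obtain h h' where "f = (\<Sum>j<k. h j * (r ! j - of_int (as ! j)))" "\<forall>j<k. h j \<in> int_mpolys k"
    "g = (\<Sum>j<k. h' j * (r ! j - of_int (as ! j)))" "\<forall>j<k. h' j \<in> int_mpolys k"
    using assms unfolding point_ideal_def by blast
  then show ?thesis unfolding point_ideal_def
    by (intro CollectI exI[of _ "\<lambda>j. h j + h' j"]) (auto simp: distrib_right sum.distrib)
qed

lemma point_ideal_mult:
  assumes "f \<in> point_ideal k r as" "g \<in> int_mpolys k"
  shows "g * f \<in> point_ideal k r as"
proof -
  obtain h where "f = (\<Sum>j<k. h j * (r ! j - of_int (as ! j)))" "\<forall>j<k. h j \<in> int_mpolys k"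
    using assms unfolding point_ideal_def by blast
  then show ?thesis unfolding point_ideal_def using assms(2)
    by (intro CollectI exI[of _ "\<lambda>j. g * h j"]) (auto simp: sum_distrib_left mult.assoc)
qed

lemma point_ideal_indet:
  assumes "j < k"
  shows "r ! j - of_int (as ! j) \<in> point_ideal k r as"
proof -
  have "r ! j - of_int (as ! j) = (\<Sum>i<k. (if i = j then 1 else 0) * (r ! i - of_int (as ! i)))"
    using assms by (simp add: if_distrib[of "\<lambda>x. x * _"] cong: if_cong)
  then show ?thesis unfolding point_ideal_def
    by (intro CollectI exI[of _ "\<lambda>i. if i = j then 1 else 0"]) auto
qed

text \<open>Modulo the ideal each \<open>r ! j\<close> is congruent to \<open>as ! j\<close>, and
  congruence is preserved by the operation from which polynomials are built.\<close>

lemma peval_minus_eval_in_point_ideal: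
  assumes f: "f \<in> int_mpolys k" and r: "\<And>i. i < k \<Longrightarrow> r ! i \<in> int_mpolys k"
  shows "peval ((!) r) f - of_int (peval ((!) as) f) \<in> point_ideal k r as"
  using f
proof (induction f rule: int_mpolys_induct)
  case (add_mult f g h)
  let ?e = "peval ((!) r)" and ?c = "\<lambda>f. of_int (peval ((!) as) f)"
  have "?e (f + g * h) - ?c (f + g * h) = (?e f - ?c f) + (?e h * (?e g - ?c g) + ?c g * (?e h - ?c h))"
    by (simp add: peval_add peval_mult algebra_simps)
  also have "\<dots> \<in> point_ideal k r as"
    using add_mult r by (intro point_ideal_add point_ideal_mult peval_in_int_mpolys) auto
  finally show ?case .
qed (auto simp: point_ideal_0 point_ideal_indet peval_minus)

lemma peval_point_ideal_indets:
  assumes "f \<in> point_ideal k (map indet [0..<k]) as"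
  shows "peval ((!) as) f = (0::int)"
proof -
  obtain h where "f = (\<Sum>j<k. h j * (map indet [0..<k] ! j - of_int (as ! j)))"
    using assms unfolding point_ideal_def by blast
  then show ?thesis by (simp add: peval_sum peval_mult peval_add peval_minus flip: add_uminus_conv_diff)
qed

text \<open>The language has no subtraction, so the terms with a minus sign have moved to the other
  side; membership in the ideal becomes one quantifier over \<open>k\<close>-tuples of
  coefficients.\<close>

lemma point_ideal_iff:
  assumes as: "length as = k"
  shows "(\<exists>hs\<in>tuples (mpoly_ring k) k.
      f + (\<Sum>j<k. hs ! j * map of_int as ! j) = v + (\<Sum>j<k. hs ! j * r ! j))
    \<longleftrightarrow> f - v \<in> point_ideal k r as" (is "?L \<longleftrightarrow> ?R")
proof -
  have eq: "f + (\<Sum>j<k. hs ! j * map of_int as ! j) = v + (\<Sum>j<k. hs ! j * r ! j) \<longleftrightarrow>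
    f - v = (\<Sum>j<k. hs ! j * (r ! j - of_int (as ! j)))" for hs :: "mpoly list"
  proof -
    have "(\<Sum>j<k. hs ! j * map of_int as ! j) = (\<Sum>j<k. hs ! j * of_int (as ! j))"
      using as by (intro sum.cong) auto
    then show ?thesis by (simp add: right_diff_distrib sum_subtractf) (auto simp: algebra_simps)
  qed
  show ?thesis
  proof
    assume ?L
    then obtain hs where "hs \<in> tuples (mpoly_ring k) k"
      "f - v = (\<Sum>j<k. hs ! j * (r ! j - of_int (as ! j)))" unfolding eq by blast
    then show ?R unfolding point_ideal_def by (intro CollectI exI[of _ "(!) hs"]) (auto simp: tuples_def)
  next
    assume ?R
    then obtain h where h: "f - v = (\<Sum>j<k. h j * (r ! j - of_int (as ! j)))" "\<forall>j<k. h j \<in> int_mpolys k"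
      unfolding point_ideal_def by blast
    then show ?L unfolding eq by (intro bexI[of _ "map h [0..<k]"]) (auto simp: tuples_def)
  qed
qed

text \<open>The definable substitute for the statement that the program \<open>u\<close>, run at the
  generators \<open>r\<close>, yields \<open>f\<close>: agreement is required modulo the ideal of
  each integer point.\<close>

definition represents :: "nat \<Rightarrow> mpoly list \<Rightarrow> int list \<Rightarrow> mpoly \<Rightarrow> bool" where
  "represents k r u f \<longleftrightarrow> (\<forall>as. length as = k \<longrightarrow>
     (\<exists>v. run k u as v \<and> f - of_int v \<in> point_ideal k r as))"

text \<open>Makes \<open>represents\<close> single-valued in its last argument: elements with the
  same residues at all integer points are equal.\<close>

definition separated :: "nat \<Rightarrow> mpoly list \<Rightarrow> bool" where
  "separated k r \<longleftrightarrow> (\<forall>g\<in>int_mpolys k. (\<forall>as. length as = k \<longrightarrow> g \<in> point_ideal k r as) \<longrightarrow> g = 0)"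

text \<open>The clauses after \<open>separated\<close> express that substituting \<open>r\<close>
  for the indeterminates is onto and has trivial kernel; a program representing 0 computes an
  element of the kernel.\<close>

definition generators :: "nat \<Rightarrow> mpoly list \<Rightarrow> bool" where
  "generators k r \<longleftrightarrow> separated k r \<and>
     (\<forall>f\<in>int_mpolys k. \<exists>u. length u = 5 \<and> valid_code k u \<and> represents k r u f) \<and>
     (\<forall>u. length u = 5 \<and> valid_code k u \<and> represents k r u 0 \<longrightarrow> (\<forall>as. length as = k \<longrightarrow> run k u as 0))"

text \<open>The polynomial of the program, evaluated at \<open>r\<close>, satisfies all the
  congruences; hence its difference from a represented \<open>f\<close> lies in every point ideal
  and is 0 by \<open>separated\<close>.\<close>

lemma represents_iff:
  assumes r: "r \<in> tuples (mpoly_ring k) k" and sep: "separated k r"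
    and u: "valid_code k u" and f: "f \<in> int_mpolys k"
  shows "represents k r u f \<longleftrightarrow> f = peval ((!) r) (decode k u)"
proof -
  let ?g = "peval ((!) r) (decode k u)"
  have r_in: "\<And>i. i < k \<Longrightarrow> r ! i \<in> int_mpolys k" using r by (auto simp: tuples_def)
  have g: "?g \<in> int_mpolys k" by (rule peval_in_int_mpolys[OF decode_in[OF u] r_in])
  have "represents k r u f \<longleftrightarrow>
    (\<forall>as. length as = k \<longrightarrow> f - of_int (peval ((!) as) (decode k u)) \<in> point_ideal k r as)"
    using run_iff_decode[OF u] by (simp add: represents_def)
  also have "\<dots> \<longleftrightarrow> f = ?g"
  proof
    assume f_in: "\<forall>as. length as = k \<longrightarrow> f - of_int (peval ((!) as) (decode k u)) \<in> point_ideal k r as"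
    have "f - ?g \<in> point_ideal k r as" if "length as = k" for as
    proof -
      let ?c = "of_int (peval ((!) as) (decode k u)) :: mpoly"
      have "- 1 * (?g - ?c) \<in> point_ideal k r as"
        by (intro point_ideal_mult peval_minus_eval_in_point_ideal decode_in u r_in) auto
      then have "(f - ?c) + - 1 * (?g - ?c) \<in> point_ideal k r as"
        using f_in that point_ideal_add by blast
      then show ?thesis by simp
    qed
    moreover have "f + - ?g \<in> int_mpolys k" using f g by blast
    ultimately show "f = ?g" using sep unfolding separated_def by (metis add_uminus_conv_diff eq_iff_diff_eq_0)
  next
    assume "f = ?g"
    then show "\<forall>as. length as = k \<longrightarrow> f - of_int (peval ((!) as) (decode k u)) \<in> point_ideal k r as"
      using peval_minus_eval_in_point_ideal[OF decode_in[OF u] r_in] by simp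
  qed
  finally show ?thesis .
qed

lemma separated_indets: "separated k (map indet [0..<k])"
  unfolding separated_def by (metis peval_point_ideal_indets peval_zero_imp_zero)

text \<open>Provides a solution of the parameter condition: at the indeterminates substitution is
  the identity, so \<open>represents\<close> reduces to \<open>f = decode k u\<close>.\<close>

lemma generators_indets: "generators k (map indet [0..<k])"
proof -
  let ?r = "map indet [0..<k]"
  have r: "?r \<in> tuples (mpoly_ring k) k" by (auto simp: tuples_def)
  have "peval ((!) ?r) f = f" if "f \<in> int_mpolys k" for f
    using peval_cong_vars[OF that, of "(!) ?r" indet] by (simp add: peval_indet_id)
  then have rep: "represents k ?r u f \<longleftrightarrow> f = decode k u" if "valid_code k u" "f \<in> int_mpolys k" for u f
    using represents_iff[OF r separated_indets that] decode_in[OF that(1)] by simp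
  have "\<exists>u. length u = 5 \<and> valid_code k u \<and> represents k ?r u f" if f: "f \<in> int_mpolys k" for f
  proof -
    obtain u where u: "length u = 5" "valid_code k u" "decode k u = f" using decode_surj[OF f] .
    then show ?thesis using rep[OF u(2) f] by blast
  qed
  moreover have "run k u as 0" if "valid_code k u" "represents k ?r u 0" "length as = k" for u as
    using that(2) rep[OF that(1) int_mpolys_0] run_iff_decode[OF that(1,3), of 0] by simp
  ultimately show ?thesis using separated_indets by (auto simp: generators_def)
qed

text \<open>The justification of \<open>generators\<close> as parameter condition: any solution
  differs from the indeterminates by an automorphism, which is composed with \<open>decode\<close>
  in the coordinate map.\<close>

lemma is_iso_eval_generators:
  assumes r: "r \<in> tuples (mpoly_ring k) k" and gen: "generators k r"
  shows "is_iso (peval ((!) r)) (mpoly_ring k) (mpoly_ring k)"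
proof -
  let ?A = "int_mpolys k" and ?s = "peval ((!) r)"
  have r_in: "\<And>i. i < k \<Longrightarrow> r ! i \<in> ?A" using r by (auto simp: tuples_def)
  have sep: "separated k r" using gen by (simp add: generators_def)
  note rep = represents_iff[OF r sep]
  have s_in: "?s f \<in> ?A" if "f \<in> ?A" for f by (rule peval_in_int_mpolys[OF that r_in])
  have ker: "f = 0" if f: "f \<in> ?A" "?s f = 0" for f
  proof -
    obtain u where u: "length u = 5" "valid_code k u" "decode k u = f" using decode_surj[OF f(1)] .
    then have "represents k r u 0" using rep[of u 0] f(2) by simp
    then have run: "\<forall>as. length as = k \<longrightarrow> run k u as 0"
      using gen u(1,2) unfolding generators_def by blast
    have "peval ((!) as) f = (0::int)" if "length as = k" for as
      using run_iff_decode[OF u(2) that, of 0] u(3) run that by simp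
    then show ?thesis by (rule peval_zero_imp_zero[OF f(1)])
  qed
  have "inj_on ?s ?A"
  proof (rule inj_onI)
    fix f g assume fg: "f \<in> ?A" "g \<in> ?A" "?s f = ?s g"
    then have zero: "?s (f + - g) = 0" by (simp only: peval_add peval_minus) simp
    have "f + - g \<in> ?A" using fg(1,2) by (intro int_mpolys_add int_mpolys_minus)
    from ker[OF this zero] show "f = g" by simp
  qed
  moreover have "?s ` ?A = ?A"
  proof
    show "?A \<subseteq> ?s ` ?A"
    proof
      fix f assume f: "f \<in> ?A"
      then obtain u where u: "valid_code k u" "represents k r u f"
        using gen unfolding generators_def by blast
      then have "f = ?s (decode k u)" using rep f by blast
      then show "f \<in> ?s ` ?A" using decode_in[OF u(1)] by blast
    qed
  qed (use s_in in blast)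
  moreover have "?s (ring_interp f xs) = ring_interp f (map ?s xs)"
    if "length xs = arity f" for f xs
    using that by (cases f) (auto simp: peval_add peval_mult numeral_2_eq_2)
  ultimately show ?thesis by (simp add: is_iso_def bij_betw_def tuples_def)
qed

lemma coordinate_map_iso:
  fixes \<Gamma> :: "('f::language, 'g) code"
  assumes \<mu>: "coordinate_map \<Gamma> B p A \<mu>" and g: "is_iso g A A'"
  shows "coordinate_map \<Gamma> B p A' (\<lambda>x. g (\<mu> x))"
proof -
  obtain h where h: "is_iso h (interp_struct \<Gamma> B p) A"
    "\<forall>x \<in> code_dom \<Gamma> B p. \<mu> x = h (code_eqv \<Gamma> B p `` {x})"
    using \<mu> unfolding coordinate_map_def by blast
  have "is_iso (g \<circ> h) (interp_struct \<Gamma> B p) A'"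
    unfolding is_iso_def
  proof (intro conjI allI ballI)
    show "bij_betw (g \<circ> h) (univ (interp_struct \<Gamma> B p)) (univ A')"
      using h(1) g by (auto simp: is_iso_def intro: bij_betw_trans)
  next
    fix f :: 'f and xs assume xs: "xs \<in> tuples (interp_struct \<Gamma> B p) (arity f)"
    then have "map h xs \<in> tuples A (arity f)"
      using h(1) by (auto simp: is_iso_def tuples_def bij_betw_def)
    then show "(g \<circ> h) (interp (interp_struct \<Gamma> B p) f xs) = interp A' f (map (g \<circ> h) xs)"
      using h(1) g xs by (simp add: is_iso_def)
  qed
  moreover have "(\<lambda>x. g (\<mu> x)) ` code_dom \<Gamma> B p = univ A'"
    using coordinate_map_surj[OF \<mu>] g by (auto simp: is_iso_def bij_betw_def image_image[symmetric, of g \<mu>])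
  ultimately show ?thesis
    using \<mu> h(2) unfolding coordinate_map_def by (intro conjI exI[of _ "g \<circ> h"]) auto
qed

section \<open>Definability of representation and of admissible parameters\<close>

lemma definable_fun_nth_map:
  "j < length js \<Longrightarrow> definable_fun M n (t (js ! j)) \<Longrightarrow> definable_fun M n (\<lambda>e. map (\<lambda>i. t i e) js ! j)"
  by simp

lemma definable_fun_ring_interp:
  assumes "definable_list (ring_struct S) n (arity f) l"
  shows "definable_fun (ring_struct S) n (\<lambda>e. ring_interp f (l e))"
  using assms by (cases f) (auto simp: definable_list_def intro!: definable_fun_intros)

lemma all_tuple_int_ring: "(\<forall>xs\<in>tuples int_ring n. P xs) \<longleftrightarrow> (\<forall>xs. length xs = n \<longrightarrow> P xs)"
  by (auto simp: tuples_def)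

lemma all_Ints_tuple:
  "(\<forall>as\<in>tuples (mpoly_ring k) n. (\<forall>j<n. as ! j \<in> \<int>) \<longrightarrow> P as) \<longleftrightarrow>
   (\<forall>as. length as = n \<longrightarrow> P (map of_int as))" (is "?L \<longleftrightarrow> ?R")
proof (intro iffI allI ballI impI)
  fix as :: "int list" assume P: ?L and len: "length as = n"
  have "map of_int as \<in> tuples (mpoly_ring k) n" using len by (auto simp: tuples_def)
  moreover have "\<forall>j<n. map of_int as ! j \<in> (\<int> :: mpoly set)" using len by simp
  ultimately show "P (map of_int as)" using P by blast
next
  fix as assume P: ?R
    and as: "as \<in> tuples (mpoly_ring k) n" "\<forall>j<n. as ! j \<in> \<int>"
  then have "length as = n" by (simp add: tuples_def)
  have "\<forall>j. \<exists>z. j < n \<longrightarrow> as ! j = of_int z" using as(2) by (metis Ints_cases)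
  then obtain z where "\<And>j. j < n \<Longrightarrow> as ! j = of_int (z j)" by metis
  then have "as = map of_int (map z [0..<n])"
    using \<open>length as = n\<close> by (auto intro!: nth_equalityI)
  moreover have "P (map of_int (map z [0..<n]))" using P by (rule allE[of _ "map z [0..<n]"]) simp
  ultimately show "P as" by (simp only:)
qed

lemma definable_valid_code_of_int:
  "definable_list (mpoly_ring k) n 5 l \<Longrightarrow>
    definable (mpoly_ring k) n (\<lambda>e. \<exists>u. l e = map of_int u \<and> valid_code k u)"
  by (rule definable_of_int[OF definable_valid_code]) (auto intro!: definable_list_map definable_fun_var)

lemma definable_run_of_int:
  assumes "definable_list (mpoly_ring k) n 5 u" "definable_list (mpoly_ring k) n k as"
    "definable_fun (mpoly_ring k) n v"
  shows "definable (mpoly_ring k) n (\<lambda>e. \<exists>xs. u e @ as e @ [v e] = map of_int xs \<and> run_list k xs)"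
  by (rule definable_of_int[OF definable_run_list definable_list_run_args[OF assms]])

lemma run_of_int_iff:
  assumes "length u = 5" "length as = k"
  shows "(\<exists>xs. map of_int u @ map of_int as @ [x :: mpoly] = map of_int xs \<and> run_list k xs) \<longleftrightarrow> (\<exists>v. x = of_int v \<and> run k u as v)"
proof
  assume "\<exists>xs. map of_int u @ map of_int as @ [x] = map of_int xs \<and> run_list k xs"
  then obtain xs where xs: "map of_int u @ map of_int as @ [x] = map of_int xs"
    "run_list k xs" by blast
  from xs(1) obtain v where "x = of_int v" "xs = u @ as @ [v]"
    by (auto simp: append_eq_map_conv map_of_int_eq_iff)
  then show "\<exists>v. x = of_int v \<and> run k u as v" using xs(2) assms by (auto simp: nth_append)
next
  assume "\<exists>v. x = of_int v \<and> run k u as v"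
  then obtain v where "x = of_int v" "run k u as v" by blast
  then show "\<exists>xs. map of_int u @ map of_int as @ [x] = map of_int xs \<and> run_list k xs"
    using assms by (intro exI[of _ "u @ as @ [v]"]) (simp add: nth_append)
qed

lemmas definable_mpoly_intros =
  definable_ex_ring definable_all_ring definable_ex_tuple definable_all_tuple definable_intros
  definable_fun_intros definable_Ints definable_list_map definable_fun_nth_map
  definable_valid_code_of_int definable_run_of_int

lemma definable_represents:
  assumes l: "definable_list (mpoly_ring k) n 5 l"
    and f: "definable_fun (mpoly_ring k) n f"
    and r: "definable_list (mpoly_ring k) n k r"
  shows "definable (mpoly_ring k) n
    (\<lambda>e. \<exists>u. l e = map of_int u \<and> valid_code k u \<and> represents k (r e) u (f e))"
proof -
  let ?A = "mpoly_ring k"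
  \<comment> \<open>\<open>represents\<close> inside the ring: points are tuples with integer
    entries, runs are relativized to the integers, and ideal membership is free of subtraction.
    \<open>c\<close> is the code, \<open>x\<close> the element and \<open>s\<close> the
    generators.\<close>
  define Q where "Q c x s \<longleftrightarrow>
    (\<forall>as\<in>tuples ?A k. (\<forall>j<k. as ! j \<in> \<int>) \<longrightarrow>
      (\<exists>v\<in>int_mpolys k. (\<exists>ys. c @ as @ [v] = map of_int ys \<and> run_list k ys) \<and>
        (\<exists>hs\<in>tuples ?A k. x + (\<Sum>j<k. hs ! j * as ! j) = v + (\<Sum>j<k. hs ! j * s j))))" for c x s
  \<comment> \<open>Layout of \<open>xs\<close>: the code at positions 0 to 4, the element at 5, the
    generators from 6 on.\<close>
  define R where "R xs \<longleftrightarrow> (\<exists>u. take 5 xs = map of_int u \<and> valid_code k u) \<and>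
    Q (take 5 xs) (xs ! 5) (\<lambda>j. xs ! (6 + j))" for xs
  have "definable ?A (5 + (1 + k)) (\<lambda>e. R (map e [0..<5 + (1 + k)]))"
    unfolding R_def Q_def take_map
    by (intro definable_mpoly_intros) simp_all
  moreover have "definable_list ?A n (5 + (1 + k)) (\<lambda>e. l e @ [f e] @ r e)"
    using definable_list_Cons[OF f definable_list_Nil]
    by (intro definable_list_append l r) simp
  ultimately have "definable ?A n (\<lambda>e. R (l e @ [f e] @ r e))"
    by (rule definable_apply[OF closed_int_mpolys])
  moreover have "R (l e @ [f e] @ r e) \<longleftrightarrow>
    (\<exists>u. l e = map of_int u \<and> valid_code k u \<and> represents k (r e) u (f e))" for e
  proof -
    have len: "length (l e) = 5" "length (r e) = k"
      using l r by (auto simp: definable_list_def)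
    have rep: "Q (map of_int u) (f e) ((!) (r e)) \<longleftrightarrow> represents k (r e) u (f e)"
      if u: "length u = 5" for u
    proof -
      have "(\<exists>v\<in>int_mpolys k. (\<exists>ys. map of_int u @ map of_int as @ [v] = map of_int ys \<and> run_list k ys) \<and>
        (\<exists>hs\<in>tuples ?A k. f e + (\<Sum>j<k. hs ! j * map of_int as ! j) = v + (\<Sum>j<k. hs ! j * r e ! j))) \<longleftrightarrow>
        (\<exists>v. run k u as v \<and> f e - of_int v \<in> point_ideal k (r e) as)" if as: "length as = k" for as
        unfolding run_of_int_iff[OF u as] point_ideal_iff[OF as] by auto
      then show ?thesis unfolding Q_def all_Ints_tuple represents_def by blast
    qed
    have "length u = 5" if "l e = map of_int u" for u :: "int list"
      using that len(1) by (metis length_map)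
    moreover have "R (l e @ [f e] @ r e) \<longleftrightarrow>
        (\<exists>u. l e = map of_int u \<and> valid_code k u) \<and> Q (l e) (f e) ((!) (r e))"
      using len by (simp add: R_def nth_append)
    ultimately show ?thesis using rep by metis
  qed
  ultimately show ?thesis by simp
qed

lemma definable_generators:
  "definable (mpoly_ring k) k (\<lambda>e. generators k (map e [0..<k]))"
proof -
  let ?A = "mpoly_ring k"
  have sep: "definable ?A k (\<lambda>e. separated k (map e [0..<k]))"
  proof -
    \<comment> \<open>The summand 0 gives membership of \<open>g\<close> the shape of
      \<open>point_ideal_iff\<close> with \<open>v = 0\<close>.\<close>
    have def: "definable ?A k (\<lambda>e. \<forall>g\<in>int_mpolys k. (\<forall>as\<in>tuples ?A k. (\<forall>j<k. as ! j \<in> \<int>) \<longrightarrow>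
      (\<exists>hs\<in>tuples ?A k. g + (\<Sum>j<k. hs ! j * as ! j) = 0 + (\<Sum>j<k. hs ! j * map e [0..<k] ! j))) \<longrightarrow> g = 0)"
      by (intro definable_mpoly_intros) simp_all
    have "(\<exists>hs\<in>tuples ?A k. g + (\<Sum>j<k. hs ! j * map of_int as ! j) = 0 + (\<Sum>j<k. hs ! j * r ! j)) \<longleftrightarrow>
      g \<in> point_ideal k r as" if as: "length as = k" for g as r
      using point_ideal_iff[OF as, of g 0 r] by simp
    note point_iff = this
    show ?thesis by (rule definable_cong[OF def])
        (simp only: all_Ints_tuple separated_def point_iff cong: imp_cong)
  qed
  have surj: "definable ?A k (\<lambda>e. \<forall>f\<in>int_mpolys k. \<exists>l\<in>tuples ?A 5.
    \<exists>u. l = map of_int u \<and> valid_code k u \<and> represents k (map e [0..<k]) u f)"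
    by (intro definable_mpoly_intros definable_represents) simp_all
  have inj: "definable ?A k (\<lambda>e. \<forall>l\<in>tuples ?A 5.
    (\<exists>u. l = map of_int u \<and> valid_code k u \<and> represents k (map e [0..<k]) u 0) \<longrightarrow>
    (\<forall>as\<in>tuples ?A k. (\<forall>j<k. as ! j \<in> \<int>) \<longrightarrow> (\<exists>xs. l @ as @ [0] = map of_int xs \<and> run_list k xs)))"
    by (intro definable_mpoly_intros definable_represents) simp_all
  have tuple: "map of_int u \<in> tuples ?A 5 \<longleftrightarrow> length u = 5" for u :: "int list"
    by (auto simp: tuples_def)
  have ex_code: "(\<exists>l\<in>tuples ?A 5. \<exists>u. l = map of_int u \<and> P u) \<longleftrightarrow> (\<exists>u. length u = 5 \<and> P u)" for P
    using tuple by blast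
  have all_code: "(\<forall>l\<in>tuples ?A 5. (\<exists>u. l = map of_int u \<and> P u) \<longrightarrow> (\<forall>as\<in>tuples ?A k. (\<forall>j<k. as ! j \<in> \<int>) \<longrightarrow>
      (\<exists>xs. l @ as @ [0] = map of_int xs \<and> run_list k xs))) \<longleftrightarrow>
    (\<forall>u. length u = 5 \<and> P u \<longrightarrow> (\<forall>as. length as = k \<longrightarrow> run k u as 0))" (is "?L \<longleftrightarrow> ?R") for P
  proof -
    have "?L \<longleftrightarrow> (\<forall>u. length u = 5 \<and> P u \<longrightarrow> (\<forall>as. length as = k \<longrightarrow> 
      (\<exists>xs. map of_int u @ map of_int as @ [0 :: mpoly] = map of_int xs \<and> run_list k xs)))"
      unfolding all_Ints_tuple tuple[symmetric] by blast
    then show ?thesis by (simp add: run_of_int_iff)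
  qed
  show ?thesis
    using definable_conj[OF sep definable_conj[OF surj inj]]
    unfolding generators_def ex_code all_code by (simp only: conj_assoc)
qed

section \<open>The codes of the two interpretations\<close>

definition block_of :: "nat \<Rightarrow> 'a list \<Rightarrow> 'a list" where
  "block_of j xs = take 5 (drop (5 * j) xs)"

lemma block_of_concat:
  "(\<And>u. u \<in> set us \<Longrightarrow> length u = 5) \<Longrightarrow> j < length us \<Longrightarrow> block_of j (concat us) = us ! j"
proof (induction us arbitrary: j)
  case (Cons u us)
  then show ?case by (cases j) (auto simp: block_of_def)
qed simp

text \<open>Integer polynomials are determined by their values, so an operation on codes is tested
  at every point \<open>as\<close>; \<open>vs\<close> collects the values of the arguments
  there.\<close>

definition code_op :: "nat \<Rightarrow> ring_sym \<Rightarrow> int list \<Rightarrow> bool" where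
  "code_op k f xs \<longleftrightarrow> (\<forall>as\<in>tuples int_ring k. \<forall>vs\<in>tuples int_ring (arity f).
     (\<forall>j<arity f. run k (block_of j xs) as (vs ! j)) \<longrightarrow>
       run k (block_of (arity f) xs) as (ring_interp f vs))"

lemma definable_code_op:
  "definable int_ring (5 * Suc (arity f)) (\<lambda>e. code_op k f (map e [0..<5 * Suc (arity f)]))"
proof -
  have block: "block_of j (map e [0..<5 * Suc n]) = map e [5 * j..<5 * j + 5]" if "j \<le> n"
    for e :: "nat \<Rightarrow> int" and j n
    using that by (simp add: block_of_def take_map drop_map)
  have "definable int_ring (5 * Suc (arity f)) (\<lambda>e. \<forall>as\<in>tuples int_ring k. \<forall>vs\<in>tuples int_ring (arity f).
     (\<forall>j<arity f. run k (map e [5 * j..<5 * j + 5]) as (vs ! j)) \<longrightarrow>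
       run k (map e [5 * arity f..<5 * arity f + 5]) as (ring_interp f vs))"
    by (intro definable_all_tuple definable_imp definable_all_less definable_run definable_list_map
        definable_fun_ring_interp definable_fun_nth_map definable_fun_var) auto
  moreover have "j < arity f \<Longrightarrow> block_of j (map e [0..<5 * Suc (arity f)]) = map e [5 * j..<5 * j + 5]"
    for e :: "nat \<Rightarrow> int" and j by (rule block) simp
  ultimately show ?thesis
    unfolding code_op_def by (simp only: block[OF order_refl] cong: imp_cong)
qed

lemma code_op_iff:
  assumes us: "length us = arity f" "\<And>u. u \<in> set us \<Longrightarrow> length u = 5 \<and> valid_code k u"
    and y: "length y = 5" "valid_code k y"
  shows "code_op k f (concat us @ y) \<longleftrightarrow> decode k y = ring_interp f (map (decode k) us)"
proof -
  let ?g = "ring_interp f (map (decode k) us)"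
  have block: "block_of j (concat us @ y) = (us @ [y]) ! j" if "j < Suc (arity f)" for j
    using block_of_concat[of "us @ [y]" j] us y that by auto
  have blocks: "block_of j (concat us @ y) = us ! j" if "j < arity f" for j
    using block[of j] that us(1) by (simp add: nth_append)
  have last: "block_of (arity f) (concat us @ y) = y"
    using block[of "arity f"] us(1) by (simp add: nth_append)
  have us_valid: "valid_code k (us ! j)" if "j < arity f" for j
    using us that by (metis nth_mem)
  have g: "?g \<in> int_mpolys k"
  proof -
    have "map (decode k) us \<in> tuples (mpoly_ring k) (arity f)"
      using us decode_in by (auto simp: tuples_def)
    then show ?thesis using closed_int_mpolys[of k] by (auto simp: closed_struct_def)
  qed
  have eval_g: "peval ((!) as) ?g = ring_interp f (map (\<lambda>u. peval ((!) as) (decode k u)) us)" for as :: "int list"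
    using us(1) by (cases f) (auto simp: peval_add peval_mult numeral_2_eq_2)
  have "code_op k f (concat us @ y) \<longleftrightarrow>
    (\<forall>as::int list. length as = k \<longrightarrow> (\<forall>vs. length vs = arity f \<longrightarrow>
      vs = map (\<lambda>u. peval ((!) as) (decode k u)) us \<longrightarrow> peval ((!) as) (decode k y) = ring_interp f vs))"
  proof -
    have "(\<forall>j<arity f. run k (us ! j) as (vs ! j)) \<longleftrightarrow> vs = map (\<lambda>u. peval ((!) as) (decode k u)) us"
      if "length as = k" "length vs = arity f" for as vs
    proof -
      have "(\<forall>j<arity f. run k (us ! j) as (vs ! j)) \<longleftrightarrow>
        (\<forall>j<arity f. vs ! j = peval ((!) as) (decode k (us ! j)))"
        using run_iff_decode[OF us_valid that(1)] by auto
      also have "\<dots> \<longleftrightarrow> vs = map (\<lambda>u. peval ((!) as) (decode k u)) us"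
        using that(2) us(1) by (auto simp: list_eq_iff_nth_eq)
      finally show ?thesis .
    qed
    moreover have "run k y as v \<longleftrightarrow> peval ((!) as) (decode k y) = v" if "length as = k" for as v
      using run_iff_decode[OF y(2) that] by auto
    ultimately show ?thesis
      unfolding code_op_def all_tuple_int_ring by (simp add: blocks last cong: imp_cong)
  qed
  also have "\<dots> \<longleftrightarrow> (\<forall>as. length as = k \<longrightarrow> peval ((!) as) (decode k y) = (peval ((!) as) ?g :: int))"
    using us(1) by (auto simp: eval_g)
  also have "\<dots> \<longleftrightarrow> decode k y = ?g"
    using peval_inj[OF decode_in[OF y(2)] g] by auto
  finally show ?thesis .
qed

lemma poly_code_exists:
  obtains \<Gamma> :: "(ring_sym, ring_sym) code" where
    "wf_code \<Gamma>" "cpar \<Gamma> = 0" "cdim \<Gamma> = 5"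
    "code_dom \<Gamma> int_ring [] = {u. length u = 5 \<and> valid_code k u}"
    "coordinate_map \<Gamma> int_ring [] (mpoly_ring k) (decode k)"
proof -
  obtain d where d: "fm_in 5 d" "\<And>xs. xs \<in> tuples int_ring 5 \<Longrightarrow> holds int_ring d xs \<longleftrightarrow> valid_code k xs"
    using definable_holds[OF definable_valid_code[OF definable_list_map[of "[0..<5]" int_ring 5 "\<lambda>j e. e j"]]]
      definable_fun_var by (metis atLeastLessThan_iff length_upt diff_zero set_upt)
  \<comment> \<open>One implication suffices, since a valid program has exactly one value at each
    point.\<close>
  define same where "same xs \<longleftrightarrow> (\<forall>as\<in>tuples int_ring k. \<forall>v. run k (take 5 xs) as v \<longrightarrow> run k (drop 5 xs) as v)" for xs
  have "definable int_ring (5 * 2) (\<lambda>e. same (map e [0..<5 * 2]))"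
    unfolding same_def take_map drop_map
    by (intro definable_all_tuple definable_all_UNIV definable_imp definable_run definable_list_map
        definable_fun_var) auto
  then obtain q where q: "fm_in (5 * 2) q" "\<And>xs. xs \<in> tuples int_ring (5 * 2) \<Longrightarrow> holds int_ring q xs \<longleftrightarrow> same xs"
    by (rule definable_holds) (rule that; blast)
  have "\<exists>\<phi>. fm_in (5 * Suc (arity f)) \<phi> \<and>
    (\<forall>xs\<in>tuples int_ring (5 * Suc (arity f)). holds int_ring \<phi> xs \<longleftrightarrow> code_op k f xs)" for f
    using definable_holds[OF definable_code_op[of f k]] by metis
  then obtain c where c: "\<And>f. fm_in (5 * Suc (arity f)) (c f)"
    "\<And>f xs. xs \<in> tuples int_ring (5 * Suc (arity f)) \<Longrightarrow> holds int_ring (c f) xs \<longleftrightarrow> code_op k f xs"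
    by metis
  define \<Gamma> :: "(ring_sym, ring_sym) code" where
    "\<Gamma> = \<lparr>cdim = 5, cpar = 0, cdom = d, ceqv = q, cop = c\<rparr>"
  have dom: "code_dom \<Gamma> int_ring [] = {u. length u = 5 \<and> valid_code k u}"
    using d(2) by (auto simp: code_dom_def \<Gamma>_def tuples_def)
  have "coordinate_map \<Gamma> int_ring [] (mpoly_ring k) (decode k)"
  proof (rule coordinate_mapI[OF closed_int_mpolys], unfold dom)
    show "univ (mpoly_ring k) \<noteq> {}" by (simp add: int_mpolys_nonempty)
    show "decode k ` {u. length u = 5 \<and> valid_code k u} = univ (mpoly_ring k)"
      using decode_in decode_surj[of _ k] by (auto simp: image_iff) metis
  next
    fix x y assume "x \<in> {u. length u = 5 \<and> valid_code k u}" "y \<in> {u. length u = 5 \<and> valid_code k u}"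
    then have xy: "length x = 5" "valid_code k x" "length y = 5" "valid_code k y" by auto
    have "holds int_ring (ceqv \<Gamma>) ([] @ x @ y) \<longleftrightarrow> same (x @ y)"
      using q(2)[of "x @ y"] xy by (simp add: \<Gamma>_def tuples_def)
    also have "\<dots> \<longleftrightarrow> (\<forall>as. length as = k \<longrightarrow> peval ((!) as) (decode k x) = (peval ((!) as) (decode k y) :: int))"
      unfolding same_def all_tuple_int_ring using run_iff_decode[OF xy(2)] run_iff_decode[OF xy(4)] xy(1)
      by simp
    also have "\<dots> \<longleftrightarrow> decode k x = decode k y"
      using peval_inj[OF decode_in[OF xy(2)] decode_in[OF xy(4)]] by auto
    finally show "holds int_ring (ceqv \<Gamma>) ([] @ x @ y) \<longleftrightarrow> decode k x = decode k y" .
  next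
    fix f :: ring_sym and xs y
    assume xs: "xs \<in> lists {u. length u = 5 \<and> valid_code k u}" "length xs = arity f"
      and y: "y \<in> {u. length u = 5 \<and> valid_code k u}"
    have "length (concat xs) = 5 * arity f"
      using length_concat_uniform[of xs 5] xs by auto
    then have "code_graph \<Gamma> int_ring [] f xs y \<longleftrightarrow> code_op k f (concat xs @ y)"
      using c(2)[of "concat xs @ y" f] y by (simp add: code_graph_def \<Gamma>_def tuples_def)
    also have "\<dots> \<longleftrightarrow> decode k y = ring_interp f (map (decode k) xs)"
      using code_op_iff[of xs f k y] xs y by auto
    finally show "code_graph \<Gamma> int_ring [] f xs y \<longleftrightarrow>
      decode k y = interp (mpoly_ring k) f (map (decode k) xs)" by simp
  qed
  moreover have "wf_code \<Gamma>" using d(1) q(1) c(1) by (simp add: wf_code_def \<Gamma>_def)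
  ultimately show ?thesis using dom by (intro that[of \<Gamma>]) (simp_all add: \<Gamma>_def)
qed

text \<open>On the domain of the code below the single entry is an integer, and its constant
  coefficient recovers it.\<close>

definition int_coord :: "mpoly list \<Rightarrow> int" where
  "int_coord u = lookup (hd u) 0"

lemma int_coord_of_int [simp]: "int_coord [of_int z] = z"
  by (simp add: int_coord_def lookup_of_int)

text \<open>The copy of the integers is the same for all \<open>p\<close>. Parameters are attached
  because the coordinate map of the composite onto the polynomial ring has to name generators, and
  \<open>comp_code\<close> hands the parameters of this code on to the composite.\<close>

lemma int_code_exists:
  obtains \<Delta> :: "(ring_sym, ring_sym) code" where
    "wf_code \<Delta>" "cpar \<Delta> = k" "cdim \<Delta> = 1"
    "\<And>p. p \<in> tuples (mpoly_ring k) k \<Longrightarrow>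
       code_dom \<Delta> (mpoly_ring k) p = (\<lambda>z. [of_int z]) ` UNIV"
    "\<And>p. p \<in> tuples (mpoly_ring k) k \<Longrightarrow>
       coordinate_map \<Delta> (mpoly_ring k) p int_ring int_coord"
proof -
  let ?A = "mpoly_ring k"
  have "definable ?A (k + 1) (\<lambda>e. map e [0..<k + 1] ! k \<in> \<int>)"
    by (intro definable_Ints definable_fun_nth_map definable_fun_var) (auto simp del: upt_Suc)
  then obtain d where d: "fm_in (k + 1) d" "\<And>xs. xs \<in> tuples ?A (k + 1) \<Longrightarrow> holds ?A d xs \<longleftrightarrow> xs ! k \<in> \<int>"
    by (rule definable_holds) (rule that; blast)
  have "definable ?A (k + 2) (\<lambda>e. map e [0..<k + 2] ! k = map e [0..<k + 2] ! (k + 1))"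
    by (intro definable_eq definable_fun_nth_map definable_fun_var) (auto simp del: upt_Suc)
  then obtain q where q: "fm_in (k + 2) q"
    "\<And>xs. xs \<in> tuples ?A (k + 2) \<Longrightarrow> holds ?A q xs \<longleftrightarrow> xs ! k = xs ! (k + 1)"
    by (rule definable_holds) (rule that; blast)
  have "\<exists>\<phi>. fm_in (k + Suc (arity f)) \<phi> \<and> (\<forall>xs\<in>tuples ?A (k + Suc (arity f)).
      holds ?A \<phi> xs \<longleftrightarrow> xs ! (k + arity f) = ring_interp f (take (arity f) (drop k xs)))" for f
  proof -
    have "definable ?A (k + Suc (arity f)) (\<lambda>e. map e [0..<k + Suc (arity f)] ! (k + arity f) =
      ring_interp f (take (arity f) (drop k (map e [0..<k + Suc (arity f)]))))"
      unfolding take_map drop_map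
      by (intro definable_eq definable_fun_ring_interp definable_list_map definable_fun_nth_map definable_fun_var)
        (auto simp del: upt_Suc)
    from definable_holds[OF this] show ?thesis by metis
  qed
  then obtain c where c: "\<And>f. fm_in (k + Suc (arity f)) (c f)"
    "\<And>f xs. xs \<in> tuples ?A (k + Suc (arity f)) \<Longrightarrow>
      holds ?A (c f) xs \<longleftrightarrow> xs ! (k + arity f) = ring_interp f (take (arity f) (drop k xs))"
    by metis
  define \<Delta> :: "(ring_sym, ring_sym) code" where
    "\<Delta> = \<lparr>cdim = 1, cpar = k, cdom = d, ceqv = q, cop = c\<rparr>"
  let ?D = "(\<lambda>z::int. [of_int z :: mpoly]) ` UNIV"
  have dom: "code_dom \<Delta> ?A p = ?D" if p: "p \<in> tuples ?A k" for p
  proof -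
    have "x \<in> code_dom \<Delta> ?A p \<longleftrightarrow> (\<exists>f\<in>int_mpolys k. x = [f] \<and> f \<in> \<int>)" for x
    proof -
      have "holds ?A d (p @ [f]) \<longleftrightarrow> f \<in> \<int>" if "f \<in> int_mpolys k" for f
        using d(2)[of "p @ [f]"] p that by (auto simp: tuples_def nth_append)
      moreover have "x \<in> code_dom \<Delta> ?A p \<longleftrightarrow> (\<exists>f. x = [f] \<and> f \<in> int_mpolys k \<and> holds ?A d (p @ [f]))"
        by (cases x) (auto simp: code_dom_def \<Delta>_def tuples_def)
      ultimately show ?thesis by blast
    qed
    moreover have "(\<exists>f\<in>int_mpolys k. x = [f] \<and> f \<in> \<int>) \<longleftrightarrow> x \<in> ?D" for x
      by (metis (no_types, lifting) Ints_cases Ints_of_int imageE int_mpolys_of_int rangeI)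
    ultimately show ?thesis by blast
  qed
  moreover have "coordinate_map \<Delta> ?A p int_ring int_coord" if p: "p \<in> tuples ?A k" for p
  proof (rule coordinate_mapI[OF closed_int_ring], unfold dom[OF p])
    have p_len: "length p = k" "set p \<subseteq> int_mpolys k" using p by (auto simp: tuples_def)
    show "univ int_ring \<noteq> {}" by simp
    show "int_coord ` ?D = univ int_ring" by (auto simp: image_image)
    show "holds ?A (ceqv \<Delta>) (p @ x @ y) \<longleftrightarrow> int_coord x = int_coord y" if "x \<in> ?D" "y \<in> ?D" for x y
    proof -
      obtain a b where ab: "x = [of_int a]" "y = [of_int b]" using \<open>x \<in> ?D\<close> \<open>y \<in> ?D\<close> by blast
      have "p @ x @ y \<in> tuples ?A (k + 2)" using p_len by (auto simp: tuples_def ab)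
      then have "holds ?A (ceqv \<Delta>) (p @ x @ y) \<longleftrightarrow> (p @ x @ y) ! k = (p @ x @ y) ! (k + 1)"
        using q(2) by (simp add: \<Delta>_def)
      then show ?thesis using p_len(1) by (simp add: ab nth_append)
    qed
    fix f :: ring_sym and xs y assume xs: "xs \<in> lists ?D" "length xs = arity f" and "y \<in> ?D"
    then obtain b where b: "y = [of_int b]" by blast
    have "\<exists>zs. xs = map (\<lambda>z. [of_int z]) zs"
      using xs(1) unfolding lists_image by blast
    then obtain zs where zs: "xs = map (\<lambda>z. [of_int z]) zs" ..
    have concat: "concat xs = map of_int zs" unfolding zs by (induction zs) auto
    have len: "length zs = arity f" using zs xs(2) by simp
    have "p @ concat xs @ y \<in> tuples ?A (k + Suc (arity f))"
      using p_len len by (auto simp: tuples_def concat b)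
    then have "code_graph \<Delta> ?A p f xs y \<longleftrightarrow> (of_int b :: mpoly) = ring_interp f (map of_int zs)"
      using c(2)[of "p @ concat xs @ y" f] p_len(1) len
      by (simp add: code_graph_def \<Delta>_def concat b nth_append)
    also have "\<dots> \<longleftrightarrow> b = ring_interp f zs"
    proof -
      have "ring_interp f (map of_int zs) = (of_int (ring_interp f zs) :: mpoly)"
        using len by (cases f) (auto simp: numeral_2_eq_2)
      then show ?thesis by (simp only: of_int_eq_iff)
    qed
    finally show "code_graph \<Delta> ?A p f xs y \<longleftrightarrow> int_coord y = interp int_ring f (map int_coord xs)"
      by (simp add: b zs comp_def)
  qed
  moreover have "wf_code \<Delta>" using d(1) q(1) c(1) by (simp add: wf_code_def \<Delta>_def)
  ultimately show ?thesis by (intro that[of \<Delta>]) (simp_all add: \<Delta>_def)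
qed

theorem theorem6p3:
  fixes k :: nat
  assumes "k \<ge> 1"
  shows "regularly_bi_interpretable (ring_struct (int_mpolys k)) (ring_struct (UNIV :: int set))"
proof -
  let ?A = "mpoly_ring k"
  have A_nonempty: "univ ?A \<noteq> {}" by (simp add: int_mpolys_nonempty)
  obtain \<Gamma> :: "(ring_sym, ring_sym) code" where \<Gamma>: "wf_code \<Gamma>" "cpar \<Gamma> = 0" "cdim \<Gamma> = 5"
    and \<Gamma>_dom: "code_dom \<Gamma> int_ring [] = {u. length u = 5 \<and> valid_code k u}"
    and \<Gamma>_coord: "coordinate_map \<Gamma> int_ring [] ?A (decode k)"
    using poly_code_exists[of k] by blast
  obtain \<Delta> :: "(ring_sym, ring_sym) code" where \<Delta>: "wf_code \<Delta>" "cpar \<Delta> = k" "cdim \<Delta> = 1"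
    and \<Delta>_dom: "\<And>p. p \<in> tuples ?A k \<Longrightarrow> code_dom \<Delta> ?A p = (\<lambda>z. [of_int z]) ` UNIV"
    and \<Delta>_coord: "\<And>p. p \<in> tuples ?A k \<Longrightarrow> coordinate_map \<Delta> ?A p int_ring int_coord"
    using int_code_exists[of k] by blast
  obtain \<psi> where \<psi>: "fm_in k \<psi>" "\<And>r. r \<in> tuples ?A k \<Longrightarrow> holds ?A \<psi> r \<longleftrightarrow> generators k r"
    by (rule definable_holds[OF definable_generators]) (rule that; blast)
  have \<psi>_sol: "solutions ?A k \<psi> = {r \<in> tuples ?A k. generators k r}"
    using \<psi>(2) by (auto simp: solutions_def)
  have Truth_sol: "solutions int_ring 0 Truth = {[]}"
    by (auto simp: solutions_def tuples_def holds_def)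

  have reg_\<Gamma>: "regular_interpretation \<Gamma> Truth ?A int_ring"
    unfolding regular_interpretation_def \<Gamma>(2) Truth_sol
    using \<Gamma>(1) coordinate_map_well_defined[OF \<Gamma>_coord] coordinate_map_isomorphic[OF \<Gamma>_coord] by simp
  have reg_\<Delta>: "regular_interpretation \<Delta> \<psi> int_ring ?A"
    unfolding regular_interpretation_def \<Delta>(2) \<psi>_sol
  proof (intro conjI ballI)
    have "map indet [0..<k] \<in> tuples ?A k" by (auto simp: tuples_def)
    then show "{r \<in> tuples ?A k. generators k r} \<noteq> {}" using generators_indets by blast
  qed (use \<Delta>(1) \<psi>(1) coordinate_map_well_defined[OF \<Delta>_coord] coordinate_map_isomorphic[OF \<Delta>_coord] in auto)

  \<comment> \<open>Layout of \<open>xs\<close>: the generators \<open>r\<close>, then the five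
    entries of the code, then the element at \<open>k + 5\<close>.\<close>
  define RA where "RA xs \<longleftrightarrow> (\<exists>u. take 5 (drop k xs) = map of_int u \<and> valid_code k u \<and>
    represents k (take k xs) u (xs ! (k + 5)))" for xs
  have "definable ?A (k + 5 + 1) (\<lambda>e. RA (map e [0..<k + 5 + 1]))"
    unfolding RA_def take_map drop_map
    by (intro definable_represents definable_list_map definable_fun_nth_map definable_fun_var)
      (auto simp del: upt_Suc)
  then obtain \<theta>A where \<theta>A: "fm_in (k + 5 + 1) \<theta>A"
    "\<And>xs. xs \<in> tuples ?A (k + 5 + 1) \<Longrightarrow> holds ?A \<theta>A xs \<longleftrightarrow> RA xs"
    by (rule definable_holds) (rule that; blast)
  \<comment> \<open>A valid program decodes to the integer \<open>x\<close> exactly if its value is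
    \<open>x\<close> at every integer point. Its five entries follow the \<open>5 * k\<close>
    entries that code the generators, and \<open>x\<close> comes last.\<close>
  define RB where "RB xs \<longleftrightarrow> valid_code k (take 5 (drop (5 * k) xs)) \<and>
    (\<forall>as\<in>tuples int_ring k. run k (take 5 (drop (5 * k) xs)) as (xs ! (5 * k + 5)))" for xs
  have "definable int_ring (5 * k + 5 + 1) (\<lambda>e. RB (map e [0..<5 * k + 5 + 1]))"
    unfolding RB_def take_map drop_map
    by (intro definable_conj definable_valid_code definable_all_tuple definable_run definable_list_map
        definable_fun_nth_map definable_fun_var) (auto simp del: upt_Suc)
  then obtain \<theta>B where \<theta>B: "fm_in (5 * k + 5 + 1) \<theta>B"
    "\<And>xs. xs \<in> tuples int_ring (5 * k + 5 + 1) \<Longrightarrow> holds int_ring \<theta>B xs \<longleftrightarrow> RB xs"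
    by (rule definable_holds) (rule that; blast)

  have "defines_coordinate_map \<theta>A (comp_code \<Gamma> \<Delta>) (comp_param \<Gamma> Truth \<Delta> \<psi>) ?A"
    unfolding defines_coordinate_map_def
  proof (intro conjI ballI)
    show "fm_in (cpar (comp_code \<Gamma> \<Delta>) + cdim (comp_code \<Gamma> \<Delta>) + 1) \<theta>A"
      using \<theta>A(1) \<Gamma> \<Delta> by (simp add: comp_code_def)
    fix r assume r: "r \<in> solutions ?A (cpar (comp_code \<Gamma> \<Delta>)) (comp_param \<Gamma> Truth \<Delta> \<psi>)"
    \<comment> \<open>\<open>\<Gamma>\<close> has no parameters, so no representatives are appended
      and the admissible tuples are those of \<open>\<Delta>\<close>.\<close>
    have "r \<in> solutions ?A k \<psi>"
    proof (rule solutions_comp_param[OF \<Delta>(1) _ _ _ closed_int_ring r])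
      show "coordinate_map \<Delta> ?A p int_ring int_coord" if "p \<in> solutions ?A (cpar \<Delta>) \<psi>" for p
        using that \<Delta>_coord by (simp add: \<Delta>(2) \<psi>_sol)
      show "r \<in> solutions ?A k \<psi>" if "r = p @ concat qs" "p \<in> solutions ?A (cpar \<Delta>) \<psi>"
        "length qs = cpar \<Gamma>" for p qs
        using that \<Gamma>(2) \<Delta>(2) by simp
    qed (use \<psi>(1) \<Delta>(2) in simp_all)
    then have r: "r \<in> tuples ?A k" "generators k r" by (auto simp: \<psi>_sol)
    interpret code_in_struct \<Delta> ?A r int_ring int_coord
      using \<Delta>(1,2) \<Delta>_coord[OF r(1)] closed_int_ring r(1) by unfold_locales (auto simp: tuples_def)
    have dom: "u \<in> code_dom (comp_code \<Gamma> \<Delta>) ?A r \<longleftrightarrow>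
      (\<exists>z. u = map of_int z \<and> length z = 5 \<and> valid_code k z)" for u
    proof -
      have "u \<in> code_dom (comp_code \<Gamma> \<Delta>) ?A r \<longleftrightarrow>
        (\<exists>ys\<in>map (\<lambda>z. [of_int z]) ` UNIV. u = concat ys \<and> length ys = 5 \<and> valid_code k (map int_coord ys))"
        using code_dom_comp[OF \<Gamma>(1), of "[]" u] \<Gamma>(2) by (simp add: \<Gamma>_dom \<Delta>_dom[OF r(1)] lists_image)
      also have "\<dots> \<longleftrightarrow> (\<exists>z. u = map of_int z \<and> length z = 5 \<and> valid_code k z)"
        by (simp add: comp_def)
      finally show ?thesis .
    qed
    \<comment> \<open>\<open>decode\<close> writes the polynomial in the indeterminates; evaluation
      at \<open>r\<close> carries it over by the automorphism that belongs to
      \<open>r\<close>.\<close>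
    define \<mu> where "\<mu> u = peval ((!) r) (decode k (map int_coord (chunks (cdim \<Delta>) (cdim \<Gamma>) u)))" for u
    have "coordinate_map (comp_code \<Gamma> \<Delta>) ?A (r @ concat []) ?A
      (\<lambda>u. decode k (map int_coord (chunks (cdim \<Delta>) (cdim \<Gamma>) u)))"
      by (rule coordinate_map_comp[OF \<Gamma>(1) _ _ _ closed_int_mpolys A_nonempty]) (use \<Gamma>(2) \<Gamma>_coord in simp_all)
    then have "coordinate_map (comp_code \<Gamma> \<Delta>) ?A r ?A \<mu>"
      unfolding \<mu>_def using coordinate_map_iso[OF _ is_iso_eval_generators[OF r]] by simp
    moreover have "holds ?A \<theta>A (r @ u @ [x]) \<longleftrightarrow> u \<in> code_dom (comp_code \<Gamma> \<Delta>) ?A r \<and> \<mu> u = x"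
      if "u \<in> tuples ?A (cdim (comp_code \<Gamma> \<Delta>))" "x \<in> univ ?A" for u x
    proof -
      have u: "length u = 5" "set u \<subseteq> int_mpolys k" and x: "x \<in> int_mpolys k"
        using that \<Gamma>(3) \<Delta>(3) by (auto simp: tuples_def comp_code_def)
      have len_r: "length r = k" using r(1) by (simp add: tuples_def)
      have "r @ u @ [x] \<in> tuples ?A (k + 5 + 1)" using r(1) u x by (auto simp: tuples_def)
      then have "holds ?A \<theta>A (r @ u @ [x]) \<longleftrightarrow>
        (\<exists>z. u = map of_int z \<and> valid_code k z \<and> represents k r z x)"
        using \<theta>A(2) u(1) len_r by (simp add: RA_def nth_append)
      also have "\<dots> \<longleftrightarrow> (\<exists>z. u = map of_int z \<and> length z = 5 \<and> valid_code k z \<and> peval ((!) r) (decode k z) = x)"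
        using represents_iff[OF r(1) _ _ x] r(2) u(1) by (auto simp: generators_def)
      also have "\<dots> \<longleftrightarrow> u \<in> code_dom (comp_code \<Gamma> \<Delta>) ?A r \<and> \<mu> u = x"
      proof -
        have "\<mu> (map of_int z) = peval ((!) r) (decode k z)" if "length z = 5" for z
          using chunks_one[of "map of_int z :: mpoly list"] that \<Gamma>(3) \<Delta>(3) by (simp add: \<mu>_def comp_def)
        then show ?thesis unfolding dom by auto
      qed
      finally show ?thesis .
    qed
    ultimately show "\<exists>\<mu>. coordinate_map (comp_code \<Gamma> \<Delta>) ?A r ?A \<mu> \<and>
        (\<forall>u \<in> tuples ?A (cdim (comp_code \<Gamma> \<Delta>)). \<forall>x \<in> univ ?A.
           holds ?A \<theta>A (r @ u @ [x]) \<longleftrightarrow> u \<in> code_dom (comp_code \<Gamma> \<Delta>) ?A r \<and> \<mu> u = x)"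
      by blast
  qed
  moreover have "defines_coordinate_map \<theta>B (comp_code \<Delta> \<Gamma>) (comp_param \<Delta> \<psi> \<Gamma> Truth) int_ring"
    unfolding defines_coordinate_map_def
  proof (intro conjI ballI)
    show "fm_in (cpar (comp_code \<Delta> \<Gamma>) + cdim (comp_code \<Delta> \<Gamma>) + 1) \<theta>B"
      using \<theta>B(1) \<Gamma> \<Delta> by (simp add: comp_code_def)
    interpret code_in_struct \<Gamma> int_ring "[]" ?A "decode k"
      using \<Gamma>(1,2) \<Gamma>_coord closed_int_mpolys by unfold_locales simp_all
    fix r assume r: "r \<in> solutions int_ring (cpar (comp_code \<Delta> \<Gamma>)) (comp_param \<Delta> \<psi> \<Gamma> Truth)"
    have "\<exists>qs. r = concat qs \<and> qs \<in> lists D \<and> length qs = k \<and> map (decode k) qs \<in> tuples ?A k"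
    proof (rule solutions_comp_param[OF \<Gamma>(1) _ _ _ closed_int_mpolys r])
      show "coordinate_map \<Gamma> int_ring p ?A (decode k)" if "p \<in> solutions int_ring (cpar \<Gamma>) Truth" for p
        using that \<Gamma>_coord by (simp add: \<Gamma>(2) Truth_sol)
      show "\<exists>qs. r = concat qs \<and> qs \<in> lists D \<and> length qs = k \<and> map (decode k) qs \<in> tuples ?A k"
        if "r = p @ concat qs" "p \<in> solutions int_ring (cpar \<Gamma>) Truth" "qs \<in> lists (code_dom \<Gamma> int_ring p)"
          "length qs = cpar \<Delta>" "map (decode k) qs \<in> solutions ?A (cpar \<Delta>) \<psi>" for p qs
        using that by (intro exI[of _ qs]) (simp add: \<Gamma>(2) \<Delta>(2) Truth_sol \<psi>_sol)
    qed (use \<psi>(1) \<Delta>(2) in simp_all)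
    then obtain qs where qs: "r = concat qs" "qs \<in> lists D" "length qs = k" "map (decode k) qs \<in> tuples ?A k"
      by blast
    have len_r: "length r = 5 * k"
      using length_concat_uniform[of qs 5] qs(1-3) by (auto simp: \<Gamma>_dom)
    have dom: "u \<in> code_dom (comp_code \<Delta> \<Gamma>) int_ring r \<longleftrightarrow>
      length u = 5 \<and> valid_code k u \<and> decode k u \<in> \<int>" for u
    proof -
      have "u \<in> code_dom (comp_code \<Delta> \<Gamma>) int_ring r \<longleftrightarrow>
        (\<exists>ys\<in>lists D. u = concat ys \<and> map (decode k) ys \<in> (\<lambda>z. [of_int z]) ` UNIV)"
        using code_dom_comp[OF \<Delta>(1) qs(2), of u] qs \<Delta>(2) by (simp add: \<Delta>_dom)
      \<comment> \<open>\<open>\<Delta>\<close> has dimension 1, so \<open>ys\<close> is a single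
        block.\<close>
      also have "\<dots> \<longleftrightarrow> (\<exists>y\<in>D. u = y \<and> decode k y \<in> \<int>)"
        by (auto simp: map_eq_Cons_conv Ints_def image_iff) (metis Cons_in_lists_iff concat.simps append_Nil2 list.simps(8,9) lists.Nil)
      finally show ?thesis by (auto simp: \<Gamma>_dom)
    qed
    define \<mu> where "\<mu> u = int_coord (map (decode k) (chunks (cdim \<Gamma>) (cdim \<Delta>) u))" for u
    have "coordinate_map (comp_code \<Delta> \<Gamma>) int_ring ([] @ concat qs) int_ring \<mu>"
      unfolding \<mu>_def
      by (rule coordinate_map_comp[OF \<Delta>(1) qs(2) _ \<Delta>_coord[OF qs(4)] closed_int_ring]) (use qs \<Delta>(2) in simp_all)
    moreover have "holds int_ring \<theta>B (r @ u @ [x]) \<longleftrightarrow> u \<in> code_dom (comp_code \<Delta> \<Gamma>) int_ring r \<and> \<mu> u = x"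
      if "u \<in> tuples int_ring (cdim (comp_code \<Delta> \<Gamma>))" for u x
    proof -
      have u: "length u = 5" using that \<Gamma>(3) \<Delta>(3) by (auto simp: tuples_def comp_code_def)
      have \<mu>: "\<mu> u = lookup (decode k u) 0"
        using chunks_whole[OF u] \<Gamma>(3) \<Delta>(3) by (simp add: \<mu>_def int_coord_def)
      have "r @ u @ [x] \<in> tuples int_ring (5 * k + 5 + 1)" using len_r u by (auto simp: tuples_def)
      then have "holds int_ring \<theta>B (r @ u @ [x]) \<longleftrightarrow>
        valid_code k u \<and> (\<forall>as. length as = k \<longrightarrow> run k u as x)"
        using \<theta>B(2) u len_r by (simp add: RB_def nth_append all_tuple_int_ring)
      also have "\<dots> \<longleftrightarrow> valid_code k u \<and> decode k u = of_int x"
      proof -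
        have "(\<forall>as. length as = k \<longrightarrow> run k u as x) \<longleftrightarrow> decode k u = of_int x" if "valid_code k u"
          using peval_inj[OF decode_in[OF that] int_mpolys_of_int[of x]] run_iff_decode[OF that] by auto
        then show ?thesis by blast
      qed
      also have "\<dots> \<longleftrightarrow> u \<in> code_dom (comp_code \<Delta> \<Gamma>) int_ring r \<and> \<mu> u = x"
        using u by (auto simp: dom \<mu> lookup_of_int elim!: Ints_cases)
      finally show ?thesis .
    qed
    ultimately show "\<exists>\<mu>. coordinate_map (comp_code \<Delta> \<Gamma>) int_ring r int_ring \<mu> \<and>
        (\<forall>u \<in> tuples int_ring (cdim (comp_code \<Delta> \<Gamma>)). \<forall>x \<in> univ int_ring.
           holds int_ring \<theta>B (r @ u @ [x]) \<longleftrightarrow> u \<in> code_dom (comp_code \<Delta> \<Gamma>) int_ring r \<and> \<mu> u = x)"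
      using qs(1) by auto
  qed
  ultimately show ?thesis
    unfolding regularly_bi_interpretable_def using reg_\<Gamma> reg_\<Delta> by blast
qed

end
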